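(* Let $d\ge 1$, $\beta>0$, and let $Z=(Z(t))_{t\ge 0}$ be a strictly dyadic branching Brownian motion in $\mathbb{R}^d$ with constant branching rate $\beta$, started from a single particle at the origin. Let $B\subseteq\mathbb{R}^d$ be any fixed (open) ball. Then, for $0\le a<1$, $$\lim_{t\to\infty}\frac1t\log P\left(Z_t(B)<e^{\beta a t}\right)=\begin{cases}-\beta\left[2\sqrt{2(1-a)}-2+a\right], & 0\le a<1/2,\\ -\beta(1-a), & 1/2\le a<1.\end{cases}$$
   Context: Strictly dyadic branching Brownian motion (BBM) with constant branching rate $\beta>0$: the process starts with a single particle, which performs a standard Brownian motion in $\mathbb{R}^d$ for a random exponential time of parameter $\beta$; it then dies and simultaneously gives birth to exactly two offspring at its death position; each offspring, independently of everything else, repeats the same procedure started from that position, and so on. All Brownian motions and exponential lifetimes are independent. $P$ is the law of $Z$ when started with a single particle at the origin. For a Borel set $A\subseteq\mathbb{R}^d$, $Z_t(A)$ is the number of particles located in $A$ at time $t$. *)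

theory Defs
  imports "HOL-Probability.Probability"
begin

text \<open>
  Path continuity is required for every outcome, not just almost surely. Random-time evaluations
  \<open>W (T \<omega>) \<omega>\<close> are then measurable without completing \<open>M\<close>.
\<close>

locale standard_brownian_motion = prob_space M
  for M :: "'w measure" and W :: "real \<Rightarrow> 'w \<Rightarrow> 'v::euclidean_space" +
  assumes rv: "\<And>t. 0 \<le> t \<Longrightarrow> random_variable borel (W t)"
    and start: "\<And>\<omega>. \<omega> \<in> space M \<Longrightarrow> W 0 \<omega> = 0"
    and continuous_paths: "\<And>\<omega>. \<omega> \<in> space M \<Longrightarrow> continuous_on {0..} (\<lambda>t. W t \<omega>)"
    and gaussian_increments: "\<And>s t. 0 \<le> s \<Longrightarrow> s < t \<Longrightarrow>
      distributed M lborel (\<lambda>\<omega>. W t \<omega> - W s \<omega>)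
        (\<lambda>x. ennreal (\<Prod>b\<in>Basis. normal_density 0 (sqrt (t - s)) (x \<bullet> b)))"
    and independent_increments: "\<And>(s :: nat \<Rightarrow> real) n. 0 \<le> s 0 \<Longrightarrow> incseq s \<Longrightarrow>
      indep_vars (\<lambda>_. borel) (\<lambda>i \<omega>. W (s (Suc i)) \<omega> - W (s i) \<omega>) {..<n}"

text \<open>
  Particles carry Ulam--Harris labels: the root is \<open>[]\<close> and the two children of \<open>u\<close> are
  \<open>u @ [False]\<close> and \<open>u @ [True]\<close>, so the proper ancestors of \<open>u\<close> are \<open>take k u\<close> for
  \<open>k < length u\<close>. \<open>\<tau> u\<close> is the lifetime of \<open>u\<close>, and \<open>W u\<close> is its displacement from its birth
  place as a function of its age.
\<close>

definition birth_time :: "(bool list \<Rightarrow> 'w \<Rightarrow> real) \<Rightarrow> bool list \<Rightarrow> 'w \<Rightarrow> real" where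
  "birth_time \<tau> u \<omega> = (\<Sum>k<length u. \<tau> (take k u) \<omega>)"

definition birth_place ::
  "(bool list \<Rightarrow> 'w \<Rightarrow> real) \<Rightarrow> (bool list \<Rightarrow> real \<Rightarrow> 'w \<Rightarrow> 'v::euclidean_space) \<Rightarrow>
    bool list \<Rightarrow> 'w \<Rightarrow> 'v" where
  "birth_place \<tau> W u \<omega> = (\<Sum>k<length u. W (take k u) (\<tau> (take k u) \<omega>) \<omega>)"

definition alive :: "(bool list \<Rightarrow> 'w \<Rightarrow> real) \<Rightarrow> real \<Rightarrow> 'w \<Rightarrow> bool list set" where
  "alive \<tau> t \<omega> = {u. birth_time \<tau> u \<omega> \<le> t \<and> t < birth_time \<tau> u \<omega> + \<tau> u \<omega>}"

definition position ::
  "(bool list \<Rightarrow> 'w \<Rightarrow> real) \<Rightarrow> (bool list \<Rightarrow> real \<Rightarrow> 'w \<Rightarrow> 'v::euclidean_space) \<Rightarrow>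
    bool list \<Rightarrow> real \<Rightarrow> 'w \<Rightarrow> 'v" where
  "position \<tau> W u t \<omega> = birth_place \<tau> W u \<omega> + W u (t - birth_time \<tau> u \<omega>) \<omega>"

text \<open>
  The set counted is almost surely finite, since the process does not explode; on the null event
  where it is infinite, \<open>card\<close> yields 0.
\<close>

definition particle_count ::
  "(bool list \<Rightarrow> 'w \<Rightarrow> real) \<Rightarrow> (bool list \<Rightarrow> real \<Rightarrow> 'w \<Rightarrow> 'v::euclidean_space) \<Rightarrow>
    real \<Rightarrow> 'v set \<Rightarrow> 'w \<Rightarrow> nat" where
  "particle_count \<tau> W t A \<omega> = card {u \<in> alive \<tau> t \<omega>. position \<tau> W u t \<omega> \<in> A}"

text \<open>
  Joint independence is that of the sigma-algebras generated by each lifetime (\<open>Inl u\<close>) and by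
  each whole path, as a random element of the product space over \<open>{0..}\<close> (\<open>Inr u\<close>).
  Within one label, too, the lifetime is independent of the motion.
\<close>

locale dyadic_branching_brownian_motion = prob_space M
  for M :: "'w measure" and \<beta> :: real
    and \<tau> :: "bool list \<Rightarrow> 'w \<Rightarrow> real"
    and W :: "bool list \<Rightarrow> real \<Rightarrow> 'w \<Rightarrow> 'v::euclidean_space" +
  assumes rate_pos: "\<beta> > 0"
    and lifetime_pos: "\<And>u \<omega>. \<omega> \<in> space M \<Longrightarrow> \<tau> u \<omega> > 0"
    and lifetime: "\<And>u. distributed M lborel (\<tau> u) (\<lambda>x. ennreal (exponential_density \<beta> x))"
    and motion: "\<And>u. standard_brownian_motion M (W u)"
    and independence: "indep_sets
      (\<lambda>i. case i of
          Inl u \<Rightarrow> {\<tau> u -` A \<inter> space M | A. A \<in> sets borel}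
        | Inr u \<Rightarrow> {(\<lambda>\<omega>. \<lambda>t\<in>{0..}. W u t \<omega>) -` A \<inter> space M | A.
                     A \<in> sets (Pi\<^sub>M {0..} (\<lambda>_. borel))})
      (UNIV :: (bool list + bool list) set)"

end

theory Submission
  imports Defs "HOL-Real_Asymp.Real_Asymp"
begin

text \<open>
  By conditioning on the first branching, \<open>\<phi>\<^sub>\<theta>(t,x) = E\<^sub>x exp(- \<theta> Z\<^sub>t(B))\<close> solves the mild form of the KPP
  equation \<open>\<phi>\<^sub>t = \<Delta>\<phi>/2 + \<beta>(\<phi>\<^sup>2 - \<phi>)\<close>, and \<open>P(Z\<^sub>t(B) < e\<^bsup>\<beta>at\<^esup>)\<close> is at most
  \<open>e \<phi>\<^sub>\<theta>(t,0)\<close> with \<open>\<theta> = e\<^bsup>-\<beta>at\<^esup>\<close> and at least \<open>\<phi>\<^sub>\<theta>(t,0) - exp(- t\<^sup>2)\<close> with \<open>\<theta> = t\<^sup>2 e\<^bsup>-\<beta>at\<^esup>\<close>.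

  Upper bound: \<open>\<phi>\<^sub>\<theta>(\<tau>,x)\<close> is uniformly small in the region \<open>\<beta>\<tau> - |x|\<^sup>2/(2\<tau>) > \<beta>at\<close>, where the expected
  number of particles in \<open>B\<close> exceeds \<open>e\<^bsup>\<beta>at\<^esup>\<close>; there the equation is almost the linear one with killing
  rate \<open>\<beta>\<close>, so \<open>\<phi>\<^sub>\<theta>(t,0)\<close> is controlled by \<open>\<integral> e\<^bsup>-\<beta>s\<^esup> P(W\<^sub>s is outside the region at time t - s) ds\<close>.
  Lower bound: the initial particle does not branch before time \<open>\<kappa>t\<close> and leaves that region by then; the
  first moment bounds the number of descendants in \<open>B\<close>. Both give the minimum over \<open>\<kappa>\<close> of
  \<open>\<beta>(\<kappa> + (1 - \<kappa>)(1 - \<kappa> - a)/\<kappa>)\<close>.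
\<close>

section \<open>Heat semigroup\<close>

text \<open>A large expected number of particles does not by itself rule out a small count, so the
  first moment serves only the lower bound on the probability; the upper bound has to come from the
  nonlinear equation. The deficit \<open>1 - \<phi>\<close> solves a logistic equation and, while
  small, grows almost like the first moment. Inside the region it therefore climbs from the tiny
  initial value on \<open>B\<close> to a fixed level, and this fixed gap is then amplified until
  \<phi> is below any prescribed \<epsilon>. Only an arbitrarily small \<phi> gives a killing rate
  arbitrarily close to \<beta>, which the sharp constant requires. Comparison arguments are sup-norm
  contractions on Duhamel integrals with exponential weights, since \<phi> is known only to be
  measurable and bounded. On the probabilistic side the tree is truncated by generation: products
  over labels are then finite, their expectations satisfy a recursion in the generation, and the
  equation for the limit itself excludes explosion when the transform parameter tends to 0.\<close>

definition gauss_density :: "real \<Rightarrow> 'v::euclidean_space \<Rightarrow> real" where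
  "gauss_density s x = (\<Prod>b\<in>Basis. normal_density 0 (sqrt s) (x \<bullet> b))"

definition gauss :: "'v::euclidean_space measure" where
  "gauss = density lborel (\<lambda>x. ennreal (gauss_density 1 x))"

text \<open>Every time \<open>s\<close> uses the same measure \<open>gauss\<close>, with the point
  scaled by \<open>sqrt s\<close>: joint measurability in \<open>s\<close> and \<open>x\<close> is
  then immediate, and \<open>s = 0\<close> gives the identity without a case distinction.\<close>

definition heat :: "real \<Rightarrow> ('v::euclidean_space \<Rightarrow> real) \<Rightarrow> 'v \<Rightarrow> real" where
  "heat s g x = (\<integral>z. g (x + sqrt s *\<^sub>R z) \<partial>gauss)"

lemma gauss_density_nonneg [simp]: "0 \<le> gauss_density s x"
  by (simp add: gauss_density_def prod_nonneg)

lemma gauss_density_measurable [measurable]: "gauss_density s \<in> borel_measurable borel"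
  unfolding gauss_density_def[abs_def] by measurable

lemma gauss_density_eq:
  fixes x :: "'v::euclidean_space"
  assumes "0 < s"
  shows "gauss_density s x = (1 / sqrt (2 * pi * s)) ^ DIM('v) * exp (- (norm x)\<^sup>2 / (2 * s))"
proof -
  have "gauss_density s x = (\<Prod>b\<in>(Basis::'v set). 1 / sqrt (2 * pi * s) * exp (- (x \<bullet> b)\<^sup>2 / (2 * s)))"
    unfolding gauss_density_def normal_density_def using assms by simp
  also have "\<dots> = (1 / sqrt (2 * pi * s)) ^ DIM('v) * exp (\<Sum>b\<in>(Basis::'v set). - (x \<bullet> b)\<^sup>2 / (2 * s))"
    by (simp only: prod.distrib exp_sum finite_Basis prod_constant)
  also have "(\<Sum>b\<in>(Basis::'v set). - (x \<bullet> b)\<^sup>2 / (2 * s)) = - (norm x)\<^sup>2 / (2 * s)"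
    unfolding power2_norm_eq_inner by (subst euclidean_inner)
       (simp add: sum_divide_distrib[symmetric] sum_negf power2_eq_square)
  finally show ?thesis .
qed

lemma gauss_density_minus: "gauss_density s (- x) = gauss_density s x"
  by (simp add: gauss_density_def normal_density_def)

lemma nn_integral_gauss_density:
  assumes "0 < s"
  shows "(\<integral>\<^sup>+x. ennreal (gauss_density s (x::'v::euclidean_space)) \<partial>lborel) = 1"
proof -
  have *: "(\<integral>\<^sup>+x. ennreal (normal_density 0 (sqrt s) x) \<partial>lborel) = 1"
    using assms by (subst nn_integral_eq_integral) (auto intro!: integrable_normal_density)
  have "(\<integral>\<^sup>+x. ennreal (gauss_density s (x::'v)) \<partial>lborel)
      = (\<integral>\<^sup>+x. (\<Prod>b\<in>Basis. ennreal (normal_density 0 (sqrt s) ((x::'v) \<bullet> b))) \<partial>lborel)"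
    by (simp add: gauss_density_def prod_ennreal)
  also have "\<dots> = 1" by (subst nn_integral_lborel_prod) (auto simp: *)
  finally show ?thesis .
qed

lemma gauss_density_convolution:
  fixes x :: "'v::euclidean_space"
  assumes "0 < s" "0 < t"
  shows "(\<integral>\<^sup>+y. ennreal (gauss_density s (x - y) * gauss_density t y) \<partial>lborel)
    = ennreal (gauss_density (s + t) x)"
proof -
  have *: "(\<integral>\<^sup>+y. ennreal (normal_density 0 (sqrt s) (c - y) * normal_density 0 (sqrt t) y) \<partial>lborel)
      = ennreal (normal_density 0 (sqrt (s + t)) c)" for c
    using fun_cong[OF conv_normal_density_zero_mean[of "sqrt s" "sqrt t"], of c] assms by simp
  have "(\<integral>\<^sup>+y. ennreal (gauss_density s (x - y) * gauss_density t y) \<partial>lborel)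
     = (\<integral>\<^sup>+y. (\<Prod>b\<in>Basis. ennreal (normal_density 0 (sqrt s) (x \<bullet> b - (y::'v) \<bullet> b)
          * normal_density 0 (sqrt t) (y \<bullet> b))) \<partial>lborel)"
    by (simp add: gauss_density_def prod_ennreal prod.distrib inner_diff_left)
  also have "\<dots> = (\<Prod>b\<in>(Basis::'v set). ennreal (normal_density 0 (sqrt (s + t)) (x \<bullet> b)))"
    by (subst nn_integral_lborel_prod[where f="\<lambda>b y. ennreal (normal_density 0 (sqrt s) (x \<bullet> b - y)
          * normal_density 0 (sqrt t) y)"]) (auto simp: *)
  also have "\<dots> = ennreal (gauss_density (s + t) x)" by (simp add: gauss_density_def prod_ennreal)
  finally show ?thesis .
qed

lemma sets_gauss [simp, measurable_cong]: "sets gauss = sets borel" by (simp add: gauss_def)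

lemma space_gauss [simp]: "space gauss = UNIV" by (simp add: gauss_def)

lemma prob_space_gauss: "prob_space (gauss :: 'v::euclidean_space measure)" by (rule prob_spaceI)
     (simp add: gauss_def emeasure_density nn_integral_gauss_density)

interpretation gauss: prob_space "gauss :: 'v::euclidean_space measure" by (rule prob_space_gauss)

lemma measure_gauss_UNIV [simp]: "measure gauss UNIV = 1" using gauss.prob_space by simp

lemma distr_gauss_scale:
  assumes s: "0 < s"
  shows "distr gauss borel (\<lambda>z::'v::euclidean_space. sqrt s *\<^sub>R z)
    = density lborel (\<lambda>x. ennreal (gauss_density s x))"
proof (rule measure_eqI)
  fix A assume "A \<in> sets (distr gauss borel (\<lambda>z::'v. sqrt s *\<^sub>R z))"
  then have [measurable]: "A \<in> sets borel" by simp
  have sc: "gauss_density 1 x = sqrt s ^ DIM('v) * gauss_density s (sqrt s *\<^sub>R x)" for x :: 'v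
  proof -
    have "sqrt s * (1 / sqrt (2 * pi * s)) = 1 / sqrt (2 * pi * 1)"
      using s by (simp add: real_sqrt_mult)
    moreover have "- (norm (sqrt s *\<^sub>R x))\<^sup>2 / (2 * s) = - (norm x)\<^sup>2 / (2 * 1)"
      using s by (simp add: power_mult_distrib)
    ultimately show ?thesis
      using s by (simp only: gauss_density_eq zero_less_one mult.assoc[symmetric]
          power_mult_distrib[symmetric])
  qed
  have "emeasure (distr gauss borel (\<lambda>z::'v. sqrt s *\<^sub>R z)) A
      = (\<integral>\<^sup>+x. ennreal (gauss_density 1 (x::'v)) * indicator A (sqrt s *\<^sub>R x) \<partial>lborel)"
    by (subst nn_integral_indicator[symmetric], simp, subst nn_integral_distr)
       (auto simp: gauss_def nn_integral_density)
  also have "\<dots> = (\<integral>\<^sup>+x. ennreal (gauss_density s (x::'v)) * indicator A x \<partial>lborel)"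
    using s by (subst (2) lborel_affine[of "sqrt s" 0])
      (auto simp: nn_integral_density nn_integral_distr sc ennreal_mult ennreal_power mult_ac)
  finally show "emeasure (distr gauss borel (\<lambda>z::'v. sqrt s *\<^sub>R z)) A
      = emeasure (density lborel (\<lambda>x. ennreal (gauss_density s x))) A"
    by (simp add: emeasure_density)
qed simp

lemma emeasure_gauss_UNIV [simp]: "emeasure gauss UNIV = 1" using gauss.emeasure_space_1 by simp

lemma gauss_integrable:
  fixes g :: "'v::euclidean_space \<Rightarrow> real"
  assumes [measurable]: "g \<in> borel_measurable borel" and "\<And>x. \<bar>g x\<bar> \<le> C"
  shows "integrable gauss g"
  by (rule gauss.integrable_const_bound[of _ C]) (use assms in \<open>auto simp: gauss_def\<close>)

lemma heat_integrable:
  fixes g :: "'v::euclidean_space \<Rightarrow> real"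
  assumes [measurable]: "g \<in> borel_measurable borel" and "\<And>x. \<bar>g x\<bar> \<le> C"
  shows "integrable gauss (\<lambda>z. g (x + sqrt s *\<^sub>R z))"
  by (rule gauss_integrable[of _ C]) (use assms in auto)

section \<open>Order and linearity of the heat operator\<close>

lemma heat_mono:
  fixes g :: "'v::euclidean_space \<Rightarrow> real"
  assumes [measurable]: "g \<in> borel_measurable borel" "g' \<in> borel_measurable borel"
    and "\<And>x. \<bar>g x\<bar> \<le> C" "\<And>x. \<bar>g' x\<bar> \<le> C'" and "\<And>x. g x \<le> g' x"
  shows "heat s g x \<le> heat s g' x"
  unfolding heat_def using assms by (intro integral_mono heat_integrable) auto

lemma heat_const [simp]: "heat s (\<lambda>_. c) x = c" by (simp add: heat_def gauss.prob_space)

lemma heat_cmult: "heat s (\<lambda>y. c * g y) x = c * heat s g x" by (simp add: heat_def)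

lemma heat_add:
  fixes g :: "'v::euclidean_space \<Rightarrow> real"
  assumes [measurable]: "g \<in> borel_measurable borel" "g' \<in> borel_measurable borel"
    and "\<And>x. \<bar>g x\<bar> \<le> C" "\<And>x. \<bar>g' x\<bar> \<le> C'"
  shows "heat s (\<lambda>y. g y + g' y) x = heat s g x + heat s g' x"
  unfolding heat_def using assms by (intro Bochner_Integration.integral_add heat_integrable) auto

lemma heat_diff:
  fixes g :: "'v::euclidean_space \<Rightarrow> real"
  assumes [measurable]: "g \<in> borel_measurable borel" "g' \<in> borel_measurable borel"
    and "\<And>x. \<bar>g x\<bar> \<le> C" "\<And>x. \<bar>g' x\<bar> \<le> C'"
  shows "heat s (\<lambda>y. g y - g' y) x = heat s g x - heat s g' x"
  unfolding heat_def using assms by (intro Bochner_Integration.integral_diff heat_integrable) auto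

lemma heat_nonneg: "(\<And>x. 0 \<le> g x) \<Longrightarrow> 0 \<le> heat s g x" by (simp add: heat_def)

lemma heat_le:
  fixes g :: "'v::euclidean_space \<Rightarrow> real"
  assumes [measurable]: "g \<in> borel_measurable borel"
    and "\<And>x. \<bar>g x\<bar> \<le> C" "\<And>x. g x \<le> c"
  shows "heat s g x \<le> c" using heat_mono[of g "\<lambda>_. c" C "\<bar>c\<bar>" s x] assms by simp

lemma heat_abs_le:
  fixes g :: "'v::euclidean_space \<Rightarrow> real"
  assumes [measurable]: "g \<in> borel_measurable borel"
    and "\<And>x. \<bar>g x\<bar> \<le> C"
  shows "\<bar>heat s g x\<bar> \<le> C"
proof -
  have "heat s (\<lambda>_. -C) x \<le> heat s g x"
    by (rule heat_mono[of _ _ "\<bar>C\<bar>" C]) (use assms(2) abs_le_D2 in \<open>auto simp: abs_le_iff minus_le_iff\<close>)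
  with heat_le[of g C C s x] assms show ?thesis by (auto simp: abs_le_iff)
qed

lemma heat_0: "heat 0 g x = g x" by (simp add: heat_def gauss.prob_space)

lemma heat_measurable [measurable (raw)]:
  fixes g :: "'a \<Rightarrow> 'v::euclidean_space \<Rightarrow> real"
  assumes [measurable]: "case_prod g \<in> borel_measurable (N \<Otimes>\<^sub>M borel)"
    "s \<in> borel_measurable N" "x \<in> measurable N borel"
  shows "(\<lambda>w. heat (s w) (g w) (x w)) \<in> borel_measurable N" unfolding heat_def by measurable

text \<open>The kernel form, with nonnegative integrals so that the semigroup law becomes an
  application of Tonelli. Time 0 is excluded because it has no density.\<close>

lemma nn_integral_heat:
  fixes g :: "'v::euclidean_space \<Rightarrow> real"
  assumes [measurable]: "g \<in> borel_measurable borel"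
    and g: "\<And>x. 0 \<le> g x" "\<And>x. g x \<le> C" and s: "0 < s"
  shows "ennreal (heat s g x) = (\<integral>\<^sup>+y. ennreal (gauss_density s (x - y)) * ennreal (g y) \<partial>lborel)"
proof -
  have "ennreal (heat s g x) = (\<integral>\<^sup>+z. ennreal (g (x + sqrt s *\<^sub>R z)) \<partial>gauss)"
    unfolding heat_def using g
    by (subst nn_integral_eq_integral) (auto intro!: heat_integrable[of _ C] simp: abs_le_iff order_trans[of _ 0])
  also have "\<dots> = (\<integral>\<^sup>+y. ennreal (g (x + y)) \<partial>distr gauss borel (\<lambda>z. sqrt s *\<^sub>R z))"
    by (subst nn_integral_distr) auto
  also have "\<dots> = (\<integral>\<^sup>+y. ennreal (gauss_density s y) * ennreal (g (x + y)) \<partial>lborel)"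
    unfolding distr_gauss_scale[OF s] by (subst nn_integral_density) auto
  also have "\<dots> = (\<integral>\<^sup>+y. ennreal (gauss_density s (x - y)) * ennreal (g y) \<partial>lborel)"
  proof -
    have *: "gauss_density s (y - x) = gauss_density s (x - y)" for y
      using gauss_density_minus[of s "x - y"] by simp
    show ?thesis
      by (subst lborel_affine[of 1 "- x"]) (auto simp: nn_integral_density nn_integral_distr *)
  qed
  finally show ?thesis .
qed

lemma heat_heat_nonneg:
  fixes g :: "'v::euclidean_space \<Rightarrow> real"
  assumes [measurable]: "g \<in> borel_measurable borel"
    and g: "\<And>x. 0 \<le> g x" "\<And>x. g x \<le> C" and s: "0 \<le> s" "0 \<le> t"
  shows "heat s (heat t g) x = heat (s + t) g x"
proof (cases "s = 0 \<or> t = 0")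
  case True
  then show ?thesis by (auto simp: heat_0 heat_0[abs_def])
next
  case False
  with s have s: "0 < s" "0 < t" by auto
  have b: "\<And>x. 0 \<le> heat t g x" "\<And>x. heat t g x \<le> C"
    using g by (auto intro!: heat_nonneg heat_le[of _ C] simp: abs_le_iff order_trans[of _ 0])
  have "ennreal (heat s (heat t g) x)
     = (\<integral>\<^sup>+y. ennreal (gauss_density s (x - y)) * (\<integral>\<^sup>+w. ennreal (gauss_density t (y - w)) * ennreal (g w) \<partial>lborel) \<partial>lborel)"
    by (subst nn_integral_heat[where C=C]) (use b g s in \<open>auto simp: nn_integral_heat[where C=C]\<close>)
  also have "\<dots> = (\<integral>\<^sup>+y. \<integral>\<^sup>+w. ennreal (gauss_density s (x - y)) * (ennreal (gauss_density t (y - w)) * ennreal (g w)) \<partial>lborel \<partial>lborel)"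
    by (subst nn_integral_cmult) auto
  also have "\<dots> = (\<integral>\<^sup>+w. \<integral>\<^sup>+y. ennreal (gauss_density s (x - y)) * (ennreal (gauss_density t (y - w)) * ennreal (g w)) \<partial>lborel \<partial>lborel)"
    by (intro lborel_pair.Fubini') simp
  also have "\<dots> = (\<integral>\<^sup>+w. (\<integral>\<^sup>+y. ennreal (gauss_density s (x - y) * gauss_density t (y - w)) \<partial>lborel) * ennreal (g w) \<partial>lborel)"
    by (subst nn_integral_multc[symmetric]) (auto simp: ennreal_mult mult.assoc)
  also have "\<dots> = (\<integral>\<^sup>+w. ennreal (gauss_density (s + t) (x - w)) * ennreal (g w) \<partial>lborel)"
  proof (intro nn_integral_cong arg_cong2[where f="(*)"] refl)
    fix w
    have "(\<integral>\<^sup>+y. ennreal (gauss_density s (x - y) * gauss_density t (y - w)) \<partial>lborel)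
       = (\<integral>\<^sup>+y. ennreal (gauss_density s (x - w - y) * gauss_density t y) \<partial>lborel)"
      by (subst lborel_affine[of 1 "w"])
        (auto simp: nn_integral_density nn_integral_distr algebra_simps)
    also have "\<dots> = ennreal (gauss_density (s + t) (x - w))"
      by (rule gauss_density_convolution) (use s in auto)
    finally show "(\<integral>\<^sup>+y. ennreal (gauss_density s (x - y) * gauss_density t (y - w)) \<partial>lborel)
      = ennreal (gauss_density (s + t) (x - w))" .
  qed
  also have "\<dots> = ennreal (heat (s + t) g x)"
    by (subst nn_integral_heat[where C=C]) (use g s in auto)
  finally show ?thesis using g b by (simp add: heat_nonneg)
qed

text \<open>Chernoff bound with the weight
  \<open>exp ((1 - \<delta>) * (norm z)\<^sup>2 / 2)\<close>: it turns the standard density into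
  \<open>(1 / sqrt \<delta>) ^ DIM('v)\<close> times the density of variance
  \<open>1 / \<delta>\<close>, whose mass is 1. Giving up the factor \<open>1 - \<delta>\<close> in
  the exponent leaves a prefactor independent of \<open>R\<close>. The \<open>max 0 R\<close> keeps
  the bound true for negative radii.\<close>

lemma gauss_tail:
  fixes \<delta> :: real
  assumes \<delta>: "0 < \<delta>" "\<delta> < 1"
  shows "measure gauss {z::'v::euclidean_space. R < norm z}
    \<le> (1 / sqrt \<delta>) ^ DIM('v) * exp (- (1 - \<delta>) * (max 0 R)\<^sup>2 / 2)"
proof -
  let ?K = "(1 / sqrt \<delta>) ^ DIM('v)"
  have key: "gauss_density 1 z * exp ((1 - \<delta>) * (norm z)\<^sup>2 / 2) = ?K * gauss_density (1/\<delta>) z" for z :: 'v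
  proof -
    have "exp (- (norm z)\<^sup>2 / (2 * 1)) * exp ((1 - \<delta>) * (norm z)\<^sup>2 / 2) = exp (- (norm z)\<^sup>2 / (2 * (1 / \<delta>)))"
      by (subst exp_add[symmetric]) (simp add: field_simps)
    moreover have "1 / sqrt (2 * pi * 1) = 1 / sqrt \<delta> * (1 / sqrt (2 * pi * (1 / \<delta>)))"
      using \<delta> by (simp add: real_sqrt_mult real_sqrt_divide)
    ultimately show ?thesis using \<delta>
      by (simp only: gauss_density_eq zero_less_one zero_less_divide_1_iff mult.assoc
          power_mult_distrib)
  qed
  have "emeasure gauss {z::'v. R < norm z} =
     (\<integral>\<^sup>+z. ennreal (gauss_density 1 (z::'v)) * indicator {z. R < norm z} z \<partial>lborel)"
    by (simp add: gauss_def emeasure_density)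
  also have "\<dots> \<le> (\<integral>\<^sup>+z. ennreal (?K * exp (- (1 - \<delta>) * (max 0 R)\<^sup>2 / 2)) * ennreal (gauss_density (1/\<delta>) (z::'v)) \<partial>lborel)"
  proof (intro nn_integral_mono)
    fix z :: 'v
    show "ennreal (gauss_density 1 z) * indicator {z. R < norm z} z
      \<le> ennreal (?K * exp (- (1 - \<delta>) * (max 0 R)\<^sup>2 / 2)) * ennreal (gauss_density (1/\<delta>) z)"
    proof (cases "R < norm z")
      case True
      then have "(max 0 R)\<^sup>2 \<le> (norm z)\<^sup>2" by (intro power_mono) auto
      then have "(1 - \<delta>) * (max 0 R)\<^sup>2 \<le> (1 - \<delta>) * (norm z)\<^sup>2"
        using \<delta> by (intro mult_left_mono) auto
      then have "1 \<le> exp ((1 - \<delta>) * (norm z)\<^sup>2 / 2) * exp (- (1 - \<delta>) * (max 0 R)\<^sup>2 / 2)"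
        by (simp add: exp_add[symmetric] field_simps)
      then have "gauss_density 1 z * 1 \<le> gauss_density 1 z * (exp ((1 - \<delta>) * (norm z)\<^sup>2 / 2) * exp (- (1 - \<delta>) * (max 0 R)\<^sup>2 / 2))"
        by (intro mult_left_mono) auto
      also have "\<dots> = ?K * exp (- (1 - \<delta>) * (max 0 R)\<^sup>2 / 2) * gauss_density (1/\<delta>) z"
        using key[of z] by (simp add: mult_ac)
      finally show ?thesis using True \<delta> by (simp add: ennreal_mult[symmetric])
    qed simp
  qed
  also have "\<dots> = ennreal (?K * exp (- (1 - \<delta>) * (max 0 R)\<^sup>2 / 2))"
    using \<delta> by (subst nn_integral_cmult) (auto simp: nn_integral_gauss_density)
  finally show ?thesis using \<delta> by (simp add: gauss.emeasure_eq_measure)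
qed

lemma heat_tail:
  fixes x :: "'v::euclidean_space"
  assumes \<delta>: "0 < \<delta>" "\<delta> < 1" and s: "0 < s"
  shows "heat s (indicator {y. R < norm (y - x)}) x
    \<le> (1 / sqrt \<delta>) ^ DIM('v) * exp (- (1 - \<delta>) * (max 0 R)\<^sup>2 / (2 * s))"
proof -
  have "heat s (indicator {y. R < norm (y - x)}) x = measure gauss {z::'v. R / sqrt s < norm z}"
  proof -
    have "indicator {y. R < norm (y - x)} (x + sqrt s *\<^sub>R z) = (indicator {z::'v. R / sqrt s < norm z} z :: real)" for z
      using s by (auto simp: indicator_def field_simps)
    then show ?thesis unfolding heat_def by (simp add: Int_def)
  qed
  moreover have "max 0 (R / sqrt s) = max 0 R / sqrt s" using s by (auto simp: max_def field_simps)
  ultimately show ?thesis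
    using gauss_tail[OF \<delta>, of "R / sqrt s", where ?'v = 'v] s by (simp add: power_divide mult.commute)
qed

text \<open>No point of the ball is farther than \<open>d\<close> from \<open>x\<close>, so the
  kernel is at least its value at distance \<open>d\<close> there; integrating over the ball gives
  the volume factor.\<close>

lemma heat_ball_lower:
  fixes x y :: "'v::euclidean_space"
  assumes R: "0 < R" and s: "0 < s" and d: "norm (y - x) + R \<le> d"
  shows "(1 / sqrt (2 * pi * s)) ^ DIM('v) * exp (- d\<^sup>2 / (2 * s)) * measure lborel (ball (0::'v) R)
     \<le> heat s (indicator (ball y R)) x"
proof -
  let ?c = "(1 / sqrt (2 * pi * s)) ^ DIM('v) * exp (- d\<^sup>2 / (2 * s))"
  have "ennreal (?c * measure lborel (ball (0::'v) R)) = (\<integral>\<^sup>+w. ennreal ?c * indicator (ball y R) w \<partial>lborel)"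
  proof -
    have "emeasure lborel (ball y R) = ennreal (measure lborel (ball (0::'v) R))"
      using R content_ball[of R y] content_ball[of R "0::'v"] emeasure_lborel_ball_finite[of y R]
      by (subst emeasure_eq_ennreal_measure) auto
    then show ?thesis using s by (subst nn_integral_cmult_indicator) (auto simp: ennreal_mult)
  qed
  also have "\<dots> \<le> (\<integral>\<^sup>+w. ennreal (gauss_density s (x - w)) * ennreal (indicator (ball y R) w) \<partial>lborel)"
  proof (intro nn_integral_mono)
    fix w show "ennreal ?c * indicator (ball y R) w \<le> ennreal (gauss_density s (x - w)) * ennreal (indicator (ball y R) w)"
    proof (cases "w \<in> ball y R")
      case True
      then have "norm (x - w) \<le> d"
        using d norm_triangle_ineq[of "x - y" "y - w"] by (auto simp: dist_norm norm_minus_commute)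
      then have "(norm (x - w))\<^sup>2 \<le> d\<^sup>2" by (intro power_mono) auto
      then have "?c \<le> gauss_density s (x - w)"
        using s by (auto simp: gauss_density_eq divide_right_mono intro!: mult_left_mono)
      with True show ?thesis by (simp add: ennreal_leI)
    qed simp
  qed
  also have "\<dots> = ennreal (heat s (indicator (ball y R)) x)"
    using s by (subst nn_integral_heat[where C=1]) (auto intro!: borel_measurable_indicator simp: indicator_le_1)
  finally show ?thesis by (simp add: heat_nonneg)
qed

section \<open>Duhamel integrals\<close>

text \<open>For an exponential time \<open>T\<close> of rate \<beta> this is the expectation of
  \<open>F T\<close> on the event that \<open>T\<close> is at most \<open>t\<close>: the
  contribution of a first branching before \<open>t\<close>.\<close>

definition duhamel :: "real \<Rightarrow> real \<Rightarrow> (real \<Rightarrow> real) \<Rightarrow> real" where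
  "duhamel \<beta> t F = (LINT s:{0..t}|lborel. \<beta> * exp (- \<beta> * s) * F s)"

lemma duhamel_set_integrable:
  fixes F :: "real \<Rightarrow> real"
  assumes [measurable]: "F \<in> borel_measurable borel"
    and F: "\<And>s. 0 \<le> s \<Longrightarrow> s \<le> t \<Longrightarrow> \<bar>F s\<bar> \<le> C" and "0 \<le> \<beta>"
  shows "set_integrable lborel {0..t} (\<lambda>s. \<beta> * exp (- \<beta> * s) * F s)"
  unfolding set_integrable_def
proof (rule integrableI_bounded_set_indicator[where B="\<beta> * C"])
  show "AE s in lborel. s \<in> {0..t} \<longrightarrow> norm (\<beta> * exp (- \<beta> * s) * F s) \<le> \<beta> * C"
  proof (intro AE_I2 impI)
    fix s :: real assume "s \<in> {0..t}"
    with F[of s] assms(3) have "exp (- \<beta> * s) * \<bar>F s\<bar> \<le> 1 * C"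
      by (intro mult_mono) (auto simp: mult_nonneg_nonneg)
    then show "norm (\<beta> * exp (- \<beta> * s) * F s) \<le> \<beta> * C"
      using assms(3) by (auto simp: abs_mult mult.assoc intro!: mult_left_mono)
  qed
qed (auto simp: emeasure_lborel_Icc_eq)

lemma duhamel_mono:
  assumes "F \<in> borel_measurable borel" "G \<in> borel_measurable borel" "0 \<le> \<beta>"
    and "\<And>s. 0 \<le> s \<Longrightarrow> s \<le> t \<Longrightarrow> \<bar>F s\<bar> \<le> C" "\<And>s. 0 \<le> s \<Longrightarrow> s \<le> t \<Longrightarrow> \<bar>G s\<bar> \<le> C'"
    and "\<And>s. 0 \<le> s \<Longrightarrow> s \<le> t \<Longrightarrow> F s \<le> G s"
  shows "duhamel \<beta> t F \<le> duhamel \<beta> t G"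
  unfolding duhamel_def using assms
  by (intro set_integral_mono duhamel_set_integrable[of _ _ C] duhamel_set_integrable[of _ _ C'])
    (auto intro!: mult_left_mono)

lemma duhamel_cong:
  "(\<And>s. 0 \<le> s \<Longrightarrow> s \<le> t \<Longrightarrow> F s = G s) \<Longrightarrow> duhamel \<beta> t F = duhamel \<beta> t G"
  unfolding duhamel_def by (intro set_lebesgue_integral_cong) auto

lemma duhamel_cmult: "duhamel \<beta> t (\<lambda>s. c * F s) = c * duhamel \<beta> t F"
  unfolding duhamel_def by (subst set_integral_mult_right[symmetric]) (simp add: mult_ac)

lemma duhamel_add:
  assumes "F \<in> borel_measurable borel" "G \<in> borel_measurable borel" "0 \<le> \<beta>"
    and "\<And>s. 0 \<le> s \<Longrightarrow> s \<le> t \<Longrightarrow> \<bar>F s\<bar> \<le> C" "\<And>s. 0 \<le> s \<Longrightarrow> s \<le> t \<Longrightarrow> \<bar>G s\<bar> \<le> C'"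
  shows "duhamel \<beta> t (\<lambda>s. F s + G s) = duhamel \<beta> t F + duhamel \<beta> t G"
  unfolding duhamel_def distrib_left using assms
  by (intro set_integral_add duhamel_set_integrable[of _ _ C] duhamel_set_integrable[of _ _ C']) auto

lemma duhamel_diff:
  assumes "F \<in> borel_measurable borel" "G \<in> borel_measurable borel" "0 \<le> \<beta>"
    and "\<And>s. 0 \<le> s \<Longrightarrow> s \<le> t \<Longrightarrow> \<bar>F s\<bar> \<le> C" "\<And>s. 0 \<le> s \<Longrightarrow> s \<le> t \<Longrightarrow> \<bar>G s\<bar> \<le> C'"
  shows "duhamel \<beta> t (\<lambda>s. F s - G s) = duhamel \<beta> t F - duhamel \<beta> t G"
  unfolding duhamel_def right_diff_distrib using assms
  by (intro set_integral_diff duhamel_set_integrable[of _ _ C] duhamel_set_integrable[of _ _ C']) auto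

lemma duhamel_exp:
  assumes t: "0 \<le> t" and k: "\<beta> + k \<noteq> 0"
  shows "duhamel \<beta> t (\<lambda>s. exp (k * (t - s))) = \<beta> / (\<beta> + k) * (exp (k * t) - exp (- \<beta> * t))"
proof -
  define c where "c = - \<beta> / (\<beta> + k)"
  have c: "c * (\<beta> + k) = - \<beta>" using k by (simp add: c_def)
  let ?F = "\<lambda>s. c * exp (k * t - (\<beta> + k) * s)"
  have deriv: "(?F has_real_derivative \<beta> * exp (k * t - (\<beta> + k) * s)) (at s within {0..t})" for s
  proof -
    have "(?F has_real_derivative c * (exp (k * t - (\<beta> + k) * s) * (- (\<beta> + k)))) (at s within {0..t})"
      by (auto intro!: derivative_eq_intros)
    also have "c * (exp (k * t - (\<beta> + k) * s) * (- (\<beta> + k))) = - (c * (\<beta> + k)) * exp (k * t - (\<beta> + k) * s)"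
      by (simp only: mult_ac mult_minus_right mult_minus_left)
    finally show ?thesis unfolding c by simp
  qed
  have "(LINT s:{0..t}|lborel. \<beta> * exp (k * t - (\<beta> + k) * s)) = ?F t - ?F 0"
    unfolding set_lebesgue_integral_def by (rule integral_FTC_Icc[OF t])
      (use deriv in \<open>auto intro!: continuous_intros
        simp: has_real_derivative_iff_has_vector_derivative[symmetric]\<close>)
  moreover have "\<beta> * exp (- \<beta> * s) * exp (k * (t - s)) = \<beta> * exp (k * t - (\<beta> + k) * s)" for s
    by (simp add: exp_add[symmetric] algebra_simps)
  moreover have "?F t - ?F 0 = \<beta> / (\<beta> + k) * (exp (k * t) - exp (- \<beta> * t))"
    by (simp add: c_def algebra_simps diff_divide_distrib)
  ultimately show ?thesis unfolding duhamel_def by (simp only:)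
qed

lemma duhamel_const:
  assumes "0 \<le> t" "0 < \<beta>"
  shows "duhamel \<beta> t (\<lambda>s. c) = c * (1 - exp (- \<beta> * t))"
  using duhamel_exp[of t \<beta> 0] duhamel_cmult[of \<beta> t c "\<lambda>_. 1"] assms by simp

text \<open>The degenerate exponent \<open>k = - \<beta>\<close> of \<open>duhamel_exp\<close>, up
  to a factor constant in \<open>s\<close>: the exponentials cancel and the integral grows
  linearly.\<close>

lemma duhamel_exp_rate:
  assumes "0 \<le> t"
  shows "duhamel \<beta> t (\<lambda>s. exp (\<beta> * s)) = \<beta> * t"
proof -
  have "\<beta> * exp (- \<beta> * s) * exp (\<beta> * s) = \<beta>" for s by (simp add: mult.assoc exp_add[symmetric])
  then have "duhamel \<beta> t (\<lambda>s. exp (\<beta> * s)) = (LINT s:{0..t}|lborel. \<beta>)"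
    unfolding duhamel_def by (simp only:)
  then show ?thesis using assms by (simp add: set_lebesgue_integral_def)
qed

lemma duhamel_nonneg:
  assumes "0 \<le> \<beta>" "\<And>s. 0 \<le> s \<Longrightarrow> s \<le> t \<Longrightarrow> 0 \<le> F s"
  shows "0 \<le> duhamel \<beta> t F"
  unfolding duhamel_def set_lebesgue_integral_def using assms
  by (intro Bochner_Integration.integral_nonneg) (auto simp: indicator_def)

text \<open>Memorylessness of the exponential time: after survival up to \<open>s\<close>, which has
  probability \<open>exp (- \<beta> * s)\<close>, the rest is a Duhamel integral over the remaining
  time.\<close>

lemma duhamel_split:
  assumes [measurable]: "F \<in> borel_measurable borel"
    and F: "\<And>s. 0 \<le> s \<Longrightarrow> s \<le> t \<Longrightarrow> \<bar>F s\<bar> \<le> C" and "0 \<le> \<beta>" and s: "0 \<le> s" "s \<le> t"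
  shows "duhamel \<beta> t F = duhamel \<beta> s F + exp (- \<beta> * s) * duhamel \<beta> (t - s) (\<lambda>r. F (s + r))"
proof -
  let ?g = "\<lambda>s. \<beta> * exp (- \<beta> * s) * F s"
  have int: "set_integrable lborel {0..t} ?g"
    by (rule duhamel_set_integrable[of _ _ C]) (use assms in auto)
  have "{0..t} = {0..s} \<union> {s<..t}" using s by auto
  then have "duhamel \<beta> t F = (LINT r:{0..s} \<union> {s<..t}|lborel. ?g r)" by (simp only: duhamel_def)
  also have "\<dots> = duhamel \<beta> s F + (LINT r:{s<..t}|lborel. ?g r)"
    unfolding duhamel_def
  proof (rule set_integral_Un)
    show "set_integrable lborel {0..s} ?g" "set_integrable lborel {s<..t} ?g"
      by (rule set_integrable_subset[OF int]; use s in auto)+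
  qed auto
  also have "(LINT r:{s<..t}|lborel. ?g r) = (LINT r:{s..t}|lborel. ?g r)"
    unfolding set_lebesgue_integral_def
  proof (rule integral_cong_AE)
    show "AE r in lborel. indicator {s<..t} r *\<^sub>R ?g r = indicator {s..t} r *\<^sub>R ?g r"
      using AE_lborel_singleton[of s] by eventually_elim (simp add: indicator_def less_le)
  qed measurable
  also have "\<dots> = (\<integral>r. indicator {s..t} (s + r) *\<^sub>R ?g (s + r) \<partial>lborel)"
    unfolding set_lebesgue_integral_def by (subst lborel_integral_real_affine[of 1 _ s]) auto
  also have "\<dots> = (\<integral>r. exp (- \<beta> * s) * (indicator {0..t-s} r *\<^sub>R (\<beta> * exp (- \<beta> * r) * F (s + r))) \<partial>lborel)"
    by (intro Bochner_Integration.integral_cong refl)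
      (auto simp: indicator_def exp_add[symmetric] algebra_simps)
  also have "\<dots> = exp (- \<beta> * s) * duhamel \<beta> (t - s) (\<lambda>r. F (s + r))"
    unfolding duhamel_def set_lebesgue_integral_def by simp
  finally show ?thesis .
qed

lemma duhamel_measurable [measurable (raw)]:
  assumes [measurable]: "case_prod F \<in> borel_measurable (N \<Otimes>\<^sub>M borel)"
  shows "(\<lambda>w. duhamel \<beta> t (F w)) \<in> borel_measurable N"
  unfolding duhamel_def set_lebesgue_integral_def by measurable

lemma heat_duhamel:
  fixes F :: "real \<Rightarrow> 'v::euclidean_space \<Rightarrow> real"
  assumes [measurable]: "case_prod F \<in> borel_measurable (borel \<Otimes>\<^sub>M borel)"
    and F: "\<And>r y. 0 \<le> r \<Longrightarrow> r \<le> t \<Longrightarrow> \<bar>F r y\<bar> \<le> C" and "0 \<le> \<beta>" "0 \<le> t"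
  shows "heat s (\<lambda>y. duhamel \<beta> t (\<lambda>r. F r y)) x = duhamel \<beta> t (\<lambda>r. heat s (F r) x)"
proof -
  interpret G: pair_sigma_finite "gauss :: 'v measure" lborel by standard
  let ?A = "UNIV \<times> {0..t} :: ('v \<times> real) set"
  let ?g = "\<lambda>(z, r). indicator {0..t} r *\<^sub>R (\<beta> * exp (- \<beta> * r) * F r (x + sqrt s *\<^sub>R z))"
  have "integrable (gauss \<Otimes>\<^sub>M lborel)
      (\<lambda>p. indicator ?A p *\<^sub>R (\<beta> * exp (- \<beta> * snd p) * F (snd p) (x + sqrt s *\<^sub>R fst p)))"
  proof (rule integrableI_bounded_set_indicator[where B="\<beta> * C"])
    show "?A \<in> sets (gauss \<Otimes>\<^sub>M lborel)" by simp
    show "emeasure (gauss \<Otimes>\<^sub>M lborel) ?A < \<infinity>"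
      using \<open>0 \<le> t\<close>
      by (subst lborel.emeasure_pair_measure_Times) auto
    show "AE p in gauss \<Otimes>\<^sub>M lborel. p \<in> ?A \<longrightarrow>
      norm (\<beta> * exp (- \<beta> * snd p) * F (snd p) (x + sqrt s *\<^sub>R fst p)) \<le> \<beta> * C"
    proof (intro AE_I2 impI)
      fix p :: "'v \<times> real" assume "p \<in> ?A"
      with F[of "snd p" "x + sqrt s *\<^sub>R fst p"] \<open>0 \<le> \<beta>\<close>
      have "exp (- \<beta> * snd p) * \<bar>F (snd p) (x + sqrt s *\<^sub>R fst p)\<bar> \<le> 1 * C"
        by (intro mult_mono) (auto simp: mult_nonneg_nonneg)
      then show "norm (\<beta> * exp (- \<beta> * snd p) * F (snd p) (x + sqrt s *\<^sub>R fst p)) \<le> \<beta> * C"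
        using \<open>0 \<le> \<beta>\<close> by (auto simp: abs_mult mult.assoc intro!: mult_left_mono)
    qed
  qed measurable
  moreover have "(\<lambda>p. indicator ?A p *\<^sub>R (\<beta> * exp (- \<beta> * snd p) * F (snd p) (x + sqrt s *\<^sub>R fst p))) = ?g"
    by (auto simp: indicator_def)
  ultimately have int: "integrable (gauss \<Otimes>\<^sub>M lborel) ?g" by simp
  have "heat s (\<lambda>y. duhamel \<beta> t (\<lambda>r. F r y)) x = (\<integral>z. (\<integral>r. ?g (z, r) \<partial>lborel) \<partial>gauss)"
    by (simp add: heat_def duhamel_def set_lebesgue_integral_def)
  also have "\<dots> = (\<integral>r. (\<integral>z. ?g (z, r) \<partial>gauss) \<partial>lborel)"
    using G.Fubini_integral[of "\<lambda>z r. ?g (z, r)"] int by simp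
  also have "\<dots> = duhamel \<beta> t (\<lambda>r. heat s (F r) x)"
    by (simp add: heat_def duhamel_def set_lebesgue_integral_def)
  finally show ?thesis .
qed

text \<open>The function \<open>exp (k * t) * heat t u x\<close> solves the linear equation with
  growth rate \<open>k\<close>. Seen from a clock that kills at rate \<beta>, its source is
  \<open>\<beta> + k\<close> times itself; as \<open>duhamel\<close> already contains \<beta>, the
  coefficient is \<open>1 + k / \<beta>\<close>. The values used are \<open>k = \<beta>\<close> for
  a supersolution and \<open>k = \<beta> * (1 - \<delta>)\<close> for a subsolution.\<close>

lemma exp_heat_duhamel:
  fixes u :: "'v::euclidean_space \<Rightarrow> real"
  assumes [measurable]: "u \<in> borel_measurable borel"
    and u: "\<And>y. 0 \<le> u y" "\<And>y. u y \<le> C" and t: "0 \<le> t" and k: "0 < \<beta> + k" "0 < \<beta>"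
  shows "exp (k * t) * heat t u x = exp (- \<beta> * t) * heat t u x +
    (1 + k / \<beta>) * duhamel \<beta> t (\<lambda>r. heat r (\<lambda>y. exp (k * (t - r)) * heat (t - r) u y) x)"
proof -
  have "duhamel \<beta> t (\<lambda>r. heat r (\<lambda>y. exp (k * (t - r)) * heat (t - r) u y) x)
      = duhamel \<beta> t (\<lambda>r. heat t u x * exp (k * (t - r)))"
    using heat_heat_nonneg[of u C _ "t - _" x] u by (intro duhamel_cong) (simp add: heat_cmult)
  also have "\<dots> = heat t u x * (\<beta> / (\<beta> + k) * (exp (k * t) - exp (- \<beta> * t)))"
    using k by (simp add: duhamel_cmult duhamel_exp[OF t])
  finally have *: "(1 + k / \<beta>) * duhamel \<beta> t (\<lambda>r. heat r (\<lambda>y. exp (k * (t - r)) * heat (t - r) u y) x)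
      = (1 + k / \<beta>) * (heat t u x * (\<beta> / (\<beta> + k) * (exp (k * t) - exp (- \<beta> * t))))" by simp
  have "(1 + k / \<beta>) * (\<beta> / (\<beta> + k)) = 1"
  proof -
    have "1 + k / \<beta> = (\<beta> + k) / \<beta>" using k by (simp add: add_divide_distrib)
    then show ?thesis using k by simp
  qed
  then have "(1 + k / \<beta>) * (heat t u x * (\<beta> / (\<beta> + k) * (exp (k * t) - exp (- \<beta> * t))))
      = heat t u x * (exp (k * t) - exp (- \<beta> * t))"
    using mult.assoc[of "1 + k / \<beta>" "\<beta> / (\<beta> + k)" "heat t u x * (exp (k * t) - exp (- \<beta> * t))"]
    by (simp only: mult_ac)
  then show ?thesis unfolding * by (simp add: algebra_simps)
qed

text \<open>The supremum \<open>S\<close> of \<open>h\<close> over \<open>I\<close> is finite by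
  \<open>bdd\<close>, hence \<open>S \<le> A + \<theta> * S\<close> may be solved for
  \<open>S\<close>. It serves as a Gronwall lemma: the a priori bound enters only through finiteness
  and disappears from the conclusion.\<close>

lemma contraction_bound:
  fixes h :: "'i \<Rightarrow> real"
  assumes bdd: "\<And>j. j \<in> I \<Longrightarrow> h j \<le> M0" and \<theta>: "\<theta> < 1"
    and step: "\<And>M j. (\<And>i. i \<in> I \<Longrightarrow> h i \<le> M) \<Longrightarrow> j \<in> I \<Longrightarrow> h j \<le> A + \<theta> * M"
    and i: "i \<in> I"
  shows "h i \<le> A / (1 - \<theta>)"
proof -
  let ?S = "Sup (h ` I)"
  have bdd': "bdd_above (h ` I)" using bdd by (auto intro!: bdd_aboveI)
  have "h j \<le> ?S" if "j \<in> I" for j using bdd' that by (intro cSup_upper) auto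
  then have "h j \<le> A + \<theta> * ?S" if "j \<in> I" for j using step that by blast
  then have "?S \<le> A + \<theta> * ?S" using i by (intro cSup_least) auto
  then have "?S \<le> A / (1 - \<theta>)" using \<theta> by (simp add: field_simps)
  then show ?thesis using cSup_upper[OF imageI[OF i] bdd'] by simp
qed

text \<open>A one-sided maximum principle. The constant 2 is the Lipschitz constant of the logistic
  term, and the weight \<open>exp (- 2 * \<beta> * s)\<close> makes the right-hand side a
  contraction: \<open>2 * \<beta> / (\<beta> + 2 * \<beta>) = 2 / 3\<close>.\<close>

lemma duhamel_comparison:
  fixes z :: "real \<Rightarrow> 'v::euclidean_space \<Rightarrow> real"
  assumes \<beta>: "0 < \<beta>"
    and [measurable]: "case_prod z \<in> borel_measurable (borel \<Otimes>\<^sub>M borel)"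
    and bound: "\<And>s y. 0 \<le> s \<Longrightarrow> s \<le> T \<Longrightarrow> z s y \<le> Z"
    and ineq: "\<And>s x. 0 \<le> s \<Longrightarrow> s \<le> T \<Longrightarrow>
       z s x \<le> 2 * duhamel \<beta> s (\<lambda>r. heat r (\<lambda>y. max 0 (z (s - r) y)) x)"
    and t: "0 \<le> t" "t \<le> T"
  shows "z t x \<le> 0"
proof -
  let ?h = "\<lambda>(s, y). exp (- 2 * \<beta> * s) * max 0 (z s y)"
  \<comment> \<open>There is no inhomogeneous term, so \<open>A = 0\<close> and the contraction
    forces the weighted positive part to vanish.\<close>
  have "?h (t, x) \<le> 0 / (1 - 2 / 3)"
  proof (rule contraction_bound[where I="{0..T} \<times> UNIV" and ?M0.0="max 0 Z"])
    fix j :: "real \<times> 'v" assume "j \<in> {0..T} \<times> UNIV"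
    then show "?h j \<le> max 0 Z"
      using bound[of "fst j" "snd j"] \<beta>
        mult_mono[of "exp (- 2 * \<beta> * fst j)" 1 "max 0 (z (fst j) (snd j))" "max 0 Z"]
      by (auto simp: mult_nonneg_nonneg)
  next
    fix M and j :: "real \<times> 'v"
    assume M: "\<And>i :: real \<times> 'v. i \<in> {0..T} \<times> UNIV \<Longrightarrow> ?h i \<le> M" and "j \<in> {0..T} \<times> UNIV"
    then obtain s y where j: "j = (s, y)" and s: "0 \<le> s" "s \<le> T" by (cases j) auto
    have "0 \<le> ?h (t, x)" by simp
    also have "\<dots> \<le> M" using M[of "(t, x)"] t by simp
    finally have M0: "0 \<le> M" .
    have zM: "max 0 (z r w) \<le> M * exp (2 * \<beta> * r)" if "0 \<le> r" "r \<le> T" for r w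
    proof -
      have "max 0 (z r w) = exp (2 * \<beta> * r) * ?h (r, w)"
        by (simp add: mult.assoc[symmetric] exp_add[symmetric])
      also have "\<dots> \<le> exp (2 * \<beta> * r) * M" by (intro mult_left_mono M) (use that in auto)
      finally show ?thesis by (simp add: mult.commute)
    qed
    have hb: "heat r (\<lambda>y. max 0 (z (s - r) y)) y \<le> M * exp (2 * \<beta> * (s - r))" if "0 \<le> r" "r \<le> s" for r
      by (rule heat_le[of _ "M * exp (2 * \<beta> * (s - r))"])
        (use zM[of "s - r"] that s M0 in \<open>auto simp: abs_le_iff\<close>)
    have "z s y \<le> 2 * duhamel \<beta> s (\<lambda>r. heat r (\<lambda>y. max 0 (z (s - r) y)) y)"
      by (rule ineq) (use s in auto)
    also have "duhamel \<beta> s (\<lambda>r. heat r (\<lambda>y. max 0 (z (s - r) y)) y)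
        \<le> duhamel \<beta> s (\<lambda>r. M * exp (2 * \<beta> * (s - r)))"
    proof (rule duhamel_mono[of _ _ _ _ "M * exp (2 * \<beta> * s)" "M * exp (2 * \<beta> * s)"])
      fix r assume r: "0 \<le> r" "r \<le> s"
      have e: "M * exp (2 * \<beta> * (s - r)) \<le> M * exp (2 * \<beta> * s)"
        using r \<beta> M0 by (intro mult_left_mono) auto
      show "\<bar>M * exp (2 * \<beta> * (s - r))\<bar> \<le> M * exp (2 * \<beta> * s)" using e M0 by simp
      show "\<bar>heat r (\<lambda>y. max 0 (z (s - r) y)) y\<bar> \<le> M * exp (2 * \<beta> * s)"
        using hb[OF r] e heat_nonneg[of "\<lambda>y. max 0 (z (s - r) y)" r y] by simp
    qed (use \<beta> hb in auto)
    also have "2 * duhamel \<beta> s (\<lambda>r. M * exp (2 * \<beta> * (s - r))) \<le> exp (2 * \<beta> * s) * (2 / 3 * M)"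
    proof -
      have "duhamel \<beta> s (\<lambda>r. M * exp (2 * \<beta> * (s - r))) = M * (\<beta> / (\<beta> + 2 * \<beta>) * (exp (2 * \<beta> * s) - exp (- \<beta> * s)))"
        using \<beta> duhamel_exp[OF s(1), of \<beta> "2 * \<beta>"] by (simp only: duhamel_cmult)
      also have "\<dots> = M / 3 * (exp (2 * \<beta> * s) - exp (- \<beta> * s))" using \<beta> by simp
      also have "\<dots> \<le> M / 3 * exp (2 * \<beta> * s)" using M0 by (intro mult_left_mono) auto
      finally show ?thesis by (simp add: mult_ac)
    qed
    finally have "z s y \<le> exp (2 * \<beta> * s) * (2 / 3 * M)" by simp
    then have "max 0 (z s y) \<le> exp (2 * \<beta> * s) * (2 / 3 * M)" using M0 by (intro max.boundedI) auto
    then have "exp (- 2 * \<beta> * s) * max 0 (z s y) \<le> exp (- 2 * \<beta> * s) * (exp (2 * \<beta> * s) * (2 / 3 * M))"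
      by (rule mult_left_mono) simp
    then show "?h j \<le> 0 + 2 / 3 * M" by (simp add: j mult.assoc[symmetric] exp_add[symmetric])
  qed (use t in auto)
  then have "exp (- 2 * \<beta> * t) * max 0 (z t x) \<le> 0" by simp
  then have "max 0 (z t x) \<le> 0" by (simp add: mult_le_0_iff)
  then show ?thesis by simp
qed

section \<open>Mild solutions of the KPP equation\<close>

lemma heat_lincomb:
  fixes g :: "'v::euclidean_space \<Rightarrow> real"
  assumes [measurable]: "g \<in> borel_measurable borel" "g' \<in> borel_measurable borel"
    and g: "\<And>x. \<bar>g x\<bar> \<le> C" "\<And>x. \<bar>g' x\<bar> \<le> C'"
  shows "heat s (\<lambda>y. a * g y + b * g' y) x = a * heat s g x + b * heat s g' x"
proof -
  have "\<bar>a * g y\<bar> \<le> \<bar>a\<bar> * C" "\<bar>b * g' y\<bar> \<le> \<bar>b\<bar> * C'" for y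
    using g by (simp_all add: abs_mult mult_left_mono)
  then show ?thesis by (subst heat_add[of _ _ "\<bar>a\<bar> * C" "\<bar>b\<bar> * C'"]) (simp_all add: heat_cmult)
qed

lemma duhamel_lincomb:
  assumes [measurable]: "F \<in> borel_measurable borel" "G \<in> borel_measurable borel" and "0 \<le> \<beta>"
    and F: "\<And>s. 0 \<le> s \<Longrightarrow> s \<le> t \<Longrightarrow> \<bar>F s\<bar> \<le> C" and G: "\<And>s. 0 \<le> s \<Longrightarrow> s \<le> t \<Longrightarrow> \<bar>G s\<bar> \<le> C'"
  shows "duhamel \<beta> t (\<lambda>s. a * F s + b * G s) = a * duhamel \<beta> t F + b * duhamel \<beta> t G"
proof -
  have "\<bar>a * F s\<bar> \<le> \<bar>a\<bar> * C" "\<bar>b * G s\<bar> \<le> \<bar>b\<bar> * C'" if "0 \<le> s" "s \<le> t" for s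
    using F[OF that] G[OF that] by (simp_all add: abs_mult mult_left_mono)
  then show ?thesis
    using \<open>0 \<le> \<beta>\<close>
    by (subst duhamel_add[of _ _ _ _ "\<bar>a\<bar> * C" "\<bar>b\<bar> * C'"]) (simp_all add: duhamel_cmult)
qed

text \<open>The product is the difference of the logistic terms \<open>2 * a - a\<^sup>2\<close> and
  \<open>2 * b - b\<^sup>2\<close>; on the unit interval these increase with slope at most 2, which
  is the constant in \<open>duhamel_comparison\<close>.\<close>

lemma logistic_difference:
  fixes a b :: real
  assumes "0 \<le> a" "a \<le> 1" "0 \<le> b" "b \<le> 1"
  shows "(a - b) * (2 - a - b) \<le> 2 * max 0 (a - b)"
proof (cases "a \<le> b")
  case True
  then have "(a - b) * (2 - a - b) \<le> 0" using assms by (intro mult_nonpos_nonneg) auto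
  with True show ?thesis by simp
next
  case False
  then have "(a - b) * (2 - a - b) \<le> (a - b) * 2" using assms by (intro mult_left_mono) auto
  with False show ?thesis by simp
qed

text \<open>Bounds are demanded for all real times, negative ones included, so that integrands such
  as \<open>heat s (\<lambda>y. (\<phi> (t - s) y)\<^sup>2) x\<close> are bounded without side
  conditions on \<open>s\<close>.\<close>

locale kpp_solution =
  fixes \<beta> :: real and f :: "'v::euclidean_space \<Rightarrow> real" and \<phi> :: "real \<Rightarrow> 'v \<Rightarrow> real"
  assumes rate_pos: "0 < \<beta>"
    and initial_measurable [measurable]: "f \<in> borel_measurable borel"
    and initial_bounds: "\<And>y. 0 \<le> f y" "\<And>y. f y \<le> 1"
    and solution_measurable [measurable]: "case_prod \<phi> \<in> borel_measurable (borel \<Otimes>\<^sub>M borel)"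
    and solution_bounds: "\<And>t y. 0 \<le> \<phi> t y" "\<And>t y. \<phi> t y \<le> 1"
    and mild: "\<And>t x. 0 \<le> t \<Longrightarrow> \<phi> t x = exp (- \<beta> * t) * heat t f x +
      duhamel \<beta> t (\<lambda>s. heat s (\<lambda>y. (\<phi> (t - s) y)\<^sup>2) x)"
begin

lemma square_bounds: "0 \<le> (\<phi> t y)\<^sup>2" "(\<phi> t y)\<^sup>2 \<le> 1" "\<bar>(\<phi> t y)\<^sup>2\<bar> \<le> 1"
  using solution_bounds by (auto intro: power_le_one)

lemma abs_bounds: "\<bar>\<phi> t y\<bar> \<le> 1" "\<bar>1 - \<phi> t y\<bar> \<le> 1" "\<bar>1 - (\<phi> t y)\<^sup>2\<bar> \<le> 1"
  using solution_bounds[of t y] square_bounds[of t y] by (auto simp: abs_le_iff)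

lemma heat_square_bound: "\<bar>heat s (\<lambda>y. (\<phi> t y)\<^sup>2) x\<bar> \<le> 1"
  by (rule heat_abs_le) (auto simp: square_bounds)

lemma heat_deficit_square_bound: "\<bar>heat s (\<lambda>y. 1 - (\<phi> t y)\<^sup>2) x\<bar> \<le> 1"
  by (rule heat_abs_le) (auto simp: abs_bounds)

text \<open>Restarting at time \<open>s\<close> with datum \<open>\<phi> (t - s)\<close>. Apply the
  heat operator for time \<open>s\<close> to \<open>mild\<close> at \<open>t - s\<close>, use the
  semigroup law, and merge the two Duhamel integrals by \<open>duhamel_split\<close> into the one of
  \<open>mild\<close> at \<open>t\<close>.\<close>

lemma solution_shift:
  assumes s: "0 \<le> s" "s \<le> t"
  shows "\<phi> t x = exp (- \<beta> * s) * heat s (\<phi> (t - s)) x +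
    duhamel \<beta> s (\<lambda>r. heat r (\<lambda>y. (\<phi> (t - r) y)\<^sup>2) x)"
proof -
  have ts: "0 \<le> t - s" and t: "0 \<le> t" using s by auto
  let ?Q = "\<lambda>r. heat r (\<lambda>y. (\<phi> (t - r) y)\<^sup>2) x"
  let ?D = "\<lambda>y. duhamel \<beta> (t - s) (\<lambda>r. heat r (\<lambda>w. (\<phi> (t - s - r) w)\<^sup>2) y)"
  have Df: "?D y = \<phi> (t - s) y - exp (- \<beta> * (t - s)) * heat (t - s) f y" for y
    using mild[OF ts, of y] by simp
  have fb: "\<bar>f y\<bar> \<le> 1" for y using initial_bounds[of y] by simp
  have Db: "\<bar>?D y\<bar> \<le> 1" for y
  proof -
    have "0 \<le> ?D y" using rate_pos by (intro duhamel_nonneg heat_nonneg) auto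
    moreover have "?D y \<le> 1"
    proof -
      have "0 \<le> exp (- \<beta> * (t - s)) * heat (t - s) f y"
        using heat_nonneg[of f "t - s" y] initial_bounds by simp
      then show ?thesis unfolding Df using solution_bounds[of "t - s" y] by linarith
    qed
    ultimately show ?thesis by simp
  qed
  have hb: "\<bar>exp (- \<beta> * (t - s)) * heat (t - s) f y\<bar> \<le> 1" for y
    using heat_abs_le[of f 1 "t - s" y] fb ts rate_pos by (auto simp: abs_mult intro!: mult_le_one)
  have "heat s (\<phi> (t - s)) x = heat s (\<lambda>y. exp (- \<beta> * (t - s)) * heat (t - s) f y + ?D y) x"
    by (simp add: Df)
  also have "\<dots> = heat s (\<lambda>y. exp (- \<beta> * (t - s)) * heat (t - s) f y) x + heat s ?D x"
    by (rule heat_add[of _ _ 1 1]) (use Db hb in auto)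
  also have "heat s (\<lambda>y. exp (- \<beta> * (t - s)) * heat (t - s) f y) x = exp (- \<beta> * (t - s)) * heat t f x"
    using heat_heat_nonneg[of f 1 s "t - s" x] initial_bounds s by (simp add: heat_cmult)
  also have "heat s ?D x = duhamel \<beta> (t - s) (\<lambda>r. heat s (heat r (\<lambda>w. (\<phi> (t - s - r) w)\<^sup>2)) x)"
    by (rule heat_duhamel[of _ _ 1]) (use rate_pos ts heat_square_bound in auto)
  also have "\<dots> = duhamel \<beta> (t - s) (\<lambda>r. ?Q (s + r))"
  proof (rule duhamel_cong)
    fix r :: real assume "0 \<le> r"
    then show "heat s (heat r (\<lambda>w. (\<phi> (t - s - r) w)\<^sup>2)) x = ?Q (s + r)"
      unfolding diff_diff_eq by (intro heat_heat_nonneg[of _ 1]) (use square_bounds s in auto)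
  qed
  finally have "exp (- \<beta> * s) * heat s (\<phi> (t - s)) x = exp (- \<beta> * s) * exp (- \<beta> * (t - s)) * heat t f x
      + exp (- \<beta> * s) * duhamel \<beta> (t - s) (\<lambda>r. ?Q (s + r))" by (simp only: distrib_left mult.assoc)
  moreover have "exp (- \<beta> * s) * exp (- \<beta> * (t - s)) = exp (- \<beta> * t)"
    by (subst exp_add[symmetric]) (simp add: algebra_simps)
  moreover have "duhamel \<beta> t ?Q = duhamel \<beta> s ?Q + exp (- \<beta> * s) * duhamel \<beta> (t - s) (\<lambda>r. ?Q (s + r))"
    by (rule duhamel_split[of _ _ 1]) (use rate_pos s heat_square_bound in auto)
  ultimately show ?thesis using mild[OF t, of x] by simp
qed

text \<open>With \<open>w = 1 - \<phi>\<close> the source becomes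
  \<open>1 - \<phi>\<^sup>2 = 2 * w - w\<^sup>2\<close>. The constant 1 satisfies the same equation,
  by \<open>duhamel_const\<close>, and \<phi> is subtracted from it.\<close>

lemma deficit_shift:
  assumes s: "0 \<le> s" "s \<le> t"
  shows "1 - \<phi> t x = exp (- \<beta> * s) * heat s (\<lambda>y. 1 - \<phi> (t - s) y) x +
    duhamel \<beta> s (\<lambda>r. heat r (\<lambda>y. 1 - (\<phi> (t - r) y)\<^sup>2) x)"
proof -
  have e1: "heat s (\<lambda>y. 1 - \<phi> (t - s) y) x = 1 - heat s (\<phi> (t - s)) x"
    by (subst heat_diff[of _ _ 1 1]) (auto simp: abs_bounds)
  have e2: "heat r (\<lambda>y. 1 - (\<phi> (t - r) y)\<^sup>2) x = 1 - heat r (\<lambda>y. (\<phi> (t - r) y)\<^sup>2) x" for r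
    by (subst heat_diff[of _ _ 1 1]) (auto simp: square_bounds)
  have e3: "duhamel \<beta> s (\<lambda>r. 1 - heat r (\<lambda>y. (\<phi> (t - r) y)\<^sup>2) x)
      = (1 - exp (- \<beta> * s)) - duhamel \<beta> s (\<lambda>r. heat r (\<lambda>y. (\<phi> (t - r) y)\<^sup>2) x)"
    using duhamel_const[of s \<beta> 1] s rate_pos
    by (subst duhamel_diff[of _ _ _ _ 1 1]) (auto simp: heat_square_bound)
  show ?thesis unfolding e1 e2 e3 right_diff_distrib using solution_shift[OF s, of x] by simp
qed

lemma solution_0: "\<phi> 0 x = f x"
proof -
  \<comment> \<open>The integral runs over the single point 0.\<close>
  have "duhamel \<beta> 0 F = 0" for F :: "real \<Rightarrow> real"
    unfolding duhamel_def set_lebesgue_integral_def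
  proof (rule integral_eq_zero_AE)
    show "AE s in lborel. indicat_real {0..0} s *\<^sub>R (\<beta> * exp (- \<beta> * s) * F s) = 0"
      using AE_lborel_singleton[of 0] by eventually_elim simp
  qed
  then show ?thesis using mild[of 0 x] by (simp add: heat_0)
qed

text \<open>The bound \<open>1 - \<phi>\<^sup>2 \<le> 2 * (1 - \<phi>)\<close> makes the deficit a
  subsolution of the linear equation with growth rate \<beta>. For
  \<open>f y = exp (- \<theta> * indicator A y)\<close>, where
  \<open>1 - f y \<le> \<theta> * indicator A y\<close>, this is the analytic form of the first
  moment bound.\<close>

lemma deficit_upper:
  assumes t: "0 \<le> t"
  shows "1 - \<phi> t x \<le> exp (\<beta> * t) * heat t (\<lambda>y. 1 - f y) x"
proof -
  let ?g = "\<lambda>y. 1 - f y"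
  let ?v = "\<lambda>s y. exp (\<beta> * s) * heat s ?g y"
  let ?z = "\<lambda>s y. (1 - \<phi> s y) - ?v s y"
  have g: "0 \<le> ?g y" "?g y \<le> 1" "\<bar>?g y\<bar> \<le> 1" for y using initial_bounds[of y] by auto
  have hg: "0 \<le> heat s ?g y" "heat s ?g y \<le> 1" for s y
    using heat_nonneg[of ?g s y] heat_abs_le[of ?g 1 s y] g by auto
  have v0: "0 \<le> ?v s y" for s y using hg by simp
  have vb: "\<bar>?v s y\<bar> \<le> exp (\<beta> * t)" if "s \<le> t" for s y
  proof -
    have "?v s y \<le> exp (\<beta> * t) * 1" by (intro mult_mono) (use that hg rate_pos in auto)
    with v0[of s y] show ?thesis by simp
  qed
  have z1: "?z s y \<le> 1" for s y using v0[of s y] solution_bounds[of s y] by linarith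
  have "?z t x \<le> 0"
  proof (rule duhamel_comparison[OF rate_pos, where T=t and Z=1 and z="?z"])
    fix s x assume s: "0 \<le> s" "s \<le> t"
    let ?V = "\<lambda>r. heat r (\<lambda>y. ?v (s - r) y) x" and ?Z = "\<lambda>r. heat r (\<lambda>y. max 0 (?z (s - r) y)) x"
    let ?B = "exp (\<beta> * t)"
    have V: "\<bar>?V r\<bar> \<le> ?B" if "0 \<le> r" for r by (rule heat_abs_le) (use vb that s in auto)
    have m1: "\<bar>max 0 (?z r y)\<bar> \<le> 1" for r y using z1[of r y] by simp
    have Z: "\<bar>?Z r\<bar> \<le> 1" for r by (rule heat_abs_le) (use m1 in auto)
    have w: "1 - \<phi> s x = exp (- \<beta> * s) * heat s ?g x + duhamel \<beta> s (\<lambda>r. heat r (\<lambda>y. 1 - (\<phi> (s - r) y)\<^sup>2) x)"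
      using deficit_shift[of s s x] s by (simp add: solution_0)
    have d1: "duhamel \<beta> s (\<lambda>r. heat r (\<lambda>y. 1 - (\<phi> (s - r) y)\<^sup>2) x) \<le> duhamel \<beta> s (\<lambda>r. 2 * ?V r + 2 * ?Z r)"
    proof (rule duhamel_mono[of _ _ _ _ 1 "2 * ?B + 2"])
      fix r assume r: "0 \<le> r" "r \<le> s"
      have "heat r (\<lambda>y. 1 - (\<phi> (s - r) y)\<^sup>2) x \<le> heat r (\<lambda>y. 2 * ?v (s - r) y + 2 * max 0 (?z (s - r) y)) x"
      proof (rule heat_mono[of _ _ 1 "2 * ?B + 2"])
        fix y
        have "1 - (\<phi> (s - r) y)\<^sup>2 = (1 - \<phi> (s - r) y) * (1 + \<phi> (s - r) y)"
          by (simp add: power2_eq_square algebra_simps)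
        also have "\<dots> \<le> (1 - \<phi> (s - r) y) * 2"
          using solution_bounds[of "s - r" y] by (intro mult_left_mono) auto
        also have "\<dots> \<le> 2 * ?v (s - r) y + 2 * max 0 (?z (s - r) y)" by (simp add: max_def)
        finally show "1 - (\<phi> (s - r) y)\<^sup>2 \<le> 2 * ?v (s - r) y + 2 * max 0 (?z (s - r) y)" .
        show "\<bar>2 * ?v (s - r) y + 2 * max 0 (?z (s - r) y)\<bar> \<le> 2 * ?B + 2"
        proof -
          have "s - r \<le> t" using r s by simp
          have "\<bar>2 * a + 2 * b\<bar> \<le> 2 * B + 2" if "\<bar>a\<bar> \<le> B" "\<bar>b\<bar> \<le> 1" for a b B :: real
            using that by linarith
          from this[OF vb[OF \<open>s - r \<le> t\<close>, of y] m1[of "s - r" y]] show ?thesis .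
        qed
      qed (auto simp: abs_bounds)
      also have "\<dots> = 2 * ?V r + 2 * ?Z r"
        by (rule heat_lincomb[of _ _ ?B 1]) (use vb m1 r s in auto)
      finally show "heat r (\<lambda>y. 1 - (\<phi> (s - r) y)\<^sup>2) x \<le> 2 * ?V r + 2 * ?Z r" .
      show "\<bar>2 * ?V r + 2 * ?Z r\<bar> \<le> 2 * ?B + 2" using V[OF r(1)] Z[of r] by (simp add: abs_le_iff)
    qed (use rate_pos heat_deficit_square_bound in auto)
    have d2: "duhamel \<beta> s (\<lambda>r. 2 * ?V r + 2 * ?Z r) = 2 * duhamel \<beta> s ?V + 2 * duhamel \<beta> s ?Z"
    proof (rule duhamel_lincomb)
      show "\<bar>?V r\<bar> \<le> ?B" if "0 \<le> r" for r by (rule V[OF that])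
      show "\<bar>?Z r\<bar> \<le> 1" for r by (rule Z)
      show "0 \<le> \<beta>" using rate_pos by simp
      show "?V \<in> borel_measurable borel" by measurable
      show "?Z \<in> borel_measurable borel" by measurable
    qed
    have v: "?v s x = exp (- \<beta> * s) * heat s ?g x + (1 + \<beta> / \<beta>) * duhamel \<beta> s ?V"
      by (rule exp_heat_duhamel[of ?g 1]) (use g s rate_pos in auto)
    \<comment> \<open>Growth rate \<beta> makes the coefficient of \<open>?V\<close> equal to 2, so
      the linear parts cancel in \<open>?z\<close> and only \<open>?Z\<close> remains.\<close>
    have "1 + \<beta> / \<beta> = 2" using rate_pos by simp
    with w d1 d2 v show "?z s x \<le> 2 * duhamel \<beta> s ?Z" by simp
  qed (use t z1 in auto)
  then show ?thesis by simp
qed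

text \<open>
  Capping the datum at \<open>\<delta>'\<close> keeps the subsolution \<open>v\<close> below \<open>\<delta>\<close> up to time \<open>h\<close>, where the logistic
  term \<open>2v - v\<^sup>2\<close> is at least \<open>(2 - \<delta>)v\<close>.
\<close>

lemma deficit_lower_step:
  fixes u :: "'v \<Rightarrow> real"
  assumes [measurable]: "u \<in> borel_measurable borel"
    and t: "0 \<le> t" and h: "0 \<le> h" and \<delta>: "\<delta> \<le> 1" "\<delta>' * exp (\<beta> * h) \<le> \<delta>"
    and u: "\<And>y. 0 \<le> u y" "\<And>y. u y \<le> \<delta>'" "\<And>y. u y \<le> 1 - \<phi> t y"
  shows "exp (\<beta> * (1 - \<delta>) * h) * heat h u x \<le> 1 - \<phi> (t + h) x"
proof -
  let ?k = "\<beta> * (1 - \<delta>)"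
  let ?v = "\<lambda>s y. exp (?k * s) * heat s u y"
  let ?z = "\<lambda>s y. ?v s y - (1 - \<phi> (t + s) y)"
  have \<delta>'0: "0 \<le> \<delta>'" using u(1,2)[of 0] by linarith
  then have \<delta>0: "0 \<le> \<delta>" using \<delta>(2) by (smt (verit) exp_ge_zero mult_nonneg_nonneg)
  have ub: "\<bar>u y\<bar> \<le> \<delta>'" for y using u[of y] by simp
  have hu: "0 \<le> heat s u y" "heat s u y \<le> \<delta>'" for s y
    using heat_nonneg[of u s y] heat_abs_le[of u \<delta>' s y] u ub by auto
  have v0: "0 \<le> ?v s y" for s y using hu by simp
  have vd: "?v s y \<le> \<delta>" if "s \<le> h" "0 \<le> s" for s y
  proof -
    have "?k * s \<le> \<beta> * h" using that \<delta>(1) \<delta>0 rate_pos by (intro mult_mono) auto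
    then have "?v s y \<le> exp (\<beta> * h) * \<delta>'" by (intro mult_mono) (use hu in auto)
    with \<delta>(2) show ?thesis by (simp add: mult.commute)
  qed
  have "?z h x \<le> 0"
  proof (rule duhamel_comparison[OF rate_pos, where T=h and Z=1 and z="?z"])
    fix s y assume "0 \<le> s" "s \<le> h"
    then show "?z s y \<le> 1" using vd[of s y] \<delta>(1) solution_bounds[of "t + s" y] by linarith
  next
    fix s x assume s: "0 \<le> s" "s \<le> h"
    let ?V = "\<lambda>r. heat r (\<lambda>y. ?v (s - r) y) x" and ?Z = "\<lambda>r. heat r (\<lambda>y. max 0 (?z (s - r) y)) x"
    let ?Q = "\<lambda>r. heat r (\<lambda>y. 1 - (\<phi> (t + s - r) y)\<^sup>2) x"
    have vb: "\<bar>?v (s - r) y\<bar> \<le> 1" if "0 \<le> r" "r \<le> s" for r y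
      using v0[of "s - r" y] vd[of "s - r" y] that s \<delta>(1) by simp
    have mb: "\<bar>max 0 (?z (s - r) y)\<bar> \<le> 1" if "0 \<le> r" "r \<le> s" for r y
      using vb[OF that, of y] solution_bounds[of "t + (s - r)" y] by simp
    have V: "\<bar>?V r\<bar> \<le> 1" if "0 \<le> r" "r \<le> s" for r by (rule heat_abs_le) (use vb that in auto)
    have Z: "\<bar>?Z r\<bar> \<le> 1" if "0 \<le> r" "r \<le> s" for r by (rule heat_abs_le) (use mb that in auto)
    have b3: "\<bar>a + 2 * b\<bar> \<le> 3" if "\<bar>a\<bar> \<le> 1" "\<bar>b\<bar> \<le> 1" for a b :: real using that by linarith
    have "(2 - \<delta>) * duhamel \<beta> s ?V = duhamel \<beta> s (\<lambda>r. (2 - \<delta>) * ?V r)" by (simp add: duhamel_cmult)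
    also have "\<dots> \<le> duhamel \<beta> s (\<lambda>r. ?Q r + 2 * ?Z r)"
    proof (rule duhamel_mono[of _ _ _ _ 2 3])
      fix r assume r: "0 \<le> r" "r \<le> s"
      have "heat r (\<lambda>y. (2 - \<delta>) * ?v (s - r) y) x \<le> heat r (\<lambda>y. (1 - (\<phi> (t + s - r) y)\<^sup>2) + 2 * max 0 (?z (s - r) y)) x"
      proof (rule heat_mono[of _ _ 2 3])
        fix y
        let ?w = "1 - \<phi> (t + s - r) y" and ?V = "?v (s - r) y"
        have V01: "0 \<le> ?V" "?V \<le> \<delta>" using v0 vd[of "s - r" y] r s by auto
        have w01: "0 \<le> ?w" "?w \<le> 1" using solution_bounds[of "t + s - r" y] by auto
        have "(2 - \<delta>) * ?V \<le> (2 - ?V) * ?V" using V01 by (intro mult_right_mono) auto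
        \<comment> \<open>The source \<open>1 - \<phi>\<^sup>2\<close> is
          \<open>2 * ?w - ?w\<^sup>2\<close>, so the two logistic terms differ by the product to
          which \<open>logistic_difference\<close> applies.\<close>
        also have "\<dots> = (1 - (\<phi> (t + s - r) y)\<^sup>2) + (?V - ?w) * (2 - ?V - ?w)"
          by (simp add: power2_eq_square algebra_simps)
        also have "(?V - ?w) * (2 - ?V - ?w) \<le> 2 * max 0 (?V - ?w)"
          by (rule logistic_difference) (use V01 w01 \<delta>(1) in auto)
        finally show "(2 - \<delta>) * ?v (s - r) y \<le> (1 - (\<phi> (t + s - r) y)\<^sup>2) + 2 * max 0 (?z (s - r) y)"
          by (simp add: add_diff_eq)
        have "\<bar>(2 - \<delta>) * ?V\<bar> \<le> 2 * 1"
          unfolding abs_mult using \<delta>0 \<delta>(1) vb[OF r, of y] by (intro mult_mono) auto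
        then show "\<bar>(2 - \<delta>) * ?V\<bar> \<le> 2" by simp
        show "\<bar>(1 - (\<phi> (t + s - r) y)\<^sup>2) + 2 * max 0 (?z (s - r) y)\<bar> \<le> 3"
          by (rule b3) (rule abs_bounds mb[OF r])+
      qed auto
      also have "\<dots> = ?Q r + 2 * ?Z r"
        using heat_lincomb[of "\<lambda>y. 1 - (\<phi> (t + s - r) y)\<^sup>2" "\<lambda>y. max 0 (?z (s - r) y)" 1 1 r 1 2 x]
          mb[OF r] by (simp add: abs_bounds)
      finally show "(2 - \<delta>) * ?V r \<le> ?Q r + 2 * ?Z r" by (simp add: heat_cmult)
      show "\<bar>?Q r + 2 * ?Z r\<bar> \<le> 3" by (rule b3) (rule heat_deficit_square_bound Z[OF r])+
      have "\<bar>(2 - \<delta>) * ?V r\<bar> \<le> 2 * 1"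
        unfolding abs_mult using \<delta>0 \<delta>(1) V[OF r] by (intro mult_mono) auto
      then show "\<bar>(2 - \<delta>) * ?V r\<bar> \<le> 2" by simp
    qed (use rate_pos in auto)
    also have "\<dots> = duhamel \<beta> s ?Q + 2 * duhamel \<beta> s ?Z"
      using duhamel_lincomb[of ?Q ?Z \<beta> s 1 1 1 2] rate_pos Z heat_deficit_square_bound by simp
    finally have dV: "(2 - \<delta>) * duhamel \<beta> s ?V \<le> duhamel \<beta> s ?Q + 2 * duhamel \<beta> s ?Z" .
    have "?v s x = exp (- \<beta> * s) * heat s u x + (1 + ?k / \<beta>) * duhamel \<beta> s ?V"
      by (rule exp_heat_duhamel[of u \<delta>']) (use u s rate_pos \<delta> in \<open>auto intro!: add_pos_nonneg\<close>)
    also have "1 + ?k / \<beta> = 2 - \<delta>" using rate_pos by simp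
    also have "exp (- \<beta> * s) * heat s u x \<le> exp (- \<beta> * s) * heat s (\<lambda>y. 1 - \<phi> t y) x"
      by (intro mult_left_mono heat_mono[of _ _ \<delta>' 1]) (use u ub abs_bounds in auto)
    finally have "?v s x \<le> exp (- \<beta> * s) * heat s (\<lambda>y. 1 - \<phi> t y) x + duhamel \<beta> s ?Q + 2 * duhamel \<beta> s ?Z"
      using dV by simp
    moreover have "1 - \<phi> (t + s) x = exp (- \<beta> * s) * heat s (\<lambda>y. 1 - \<phi> t y) x + duhamel \<beta> s ?Q"
      using deficit_shift[of s "t + s" x] s t by simp
    ultimately show "?z s x \<le> 2 * duhamel \<beta> s ?Z" by simp
  qed (use h in auto)
  then show ?thesis by simp
qed

text \<open>
  On \<open>D\<close> the quadratic term is at most \<open>q\<phi>\<close>, so the effective killing rate there is \<open>\<beta>(1 - q)\<close>; off \<open>D\<close>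
  the term is bounded by 1 and paid for by \<open>k\<close>.
\<close>

lemma solution_gronwall:
  assumes S: "0 \<le> S" "S \<le> t" and q: "0 \<le> q" and b: "\<beta> * q < b" and k: "0 \<le> k"
    and D [measurable]: "\<And>r. D r \<in> sets borel"
    and small: "\<And>r y. 0 \<le> r \<Longrightarrow> r \<le> S \<Longrightarrow> y \<in> D r \<Longrightarrow> \<phi> (t - r) y \<le> q"
    and exit: "\<And>r. 0 \<le> r \<Longrightarrow> r \<le> S \<Longrightarrow> exp (- \<beta> * r) * heat r (indicator (- D r)) x \<le> k"
  shows "\<phi> t x \<le> exp (b * S) * (exp (- \<beta> * S) + \<beta> * k * S) / (1 - \<beta> * q / b)"
proof -
  have b0: "0 < b" using b q rate_pos by (smt (verit) mult_nonneg_nonneg)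
  let ?G = "\<lambda>s. exp (- \<beta> * s) * heat s (\<phi> (t - s)) x"
  let ?Q = "\<lambda>r. heat r (\<lambda>y. (\<phi> (t - r) y)\<^sup>2) x"
  let ?A = "exp (b * S) * (exp (- \<beta> * S) + \<beta> * k * S)"
  have hb: "0 \<le> heat s (\<phi> r) y" "heat s (\<phi> r) y \<le> 1" for s r y
    using heat_nonneg[of "\<phi> r" s y] heat_abs_le[of "\<phi> r" 1 s y] solution_bounds abs_bounds by auto
  have Gb: "0 \<le> ?G s" "?G s \<le> exp (- \<beta> * s)" for s using hb[of s "t - s" x] by auto
  have "exp (b * 0) * ?G 0 \<le> ?A / (1 - \<beta> * q / b)"
  \<comment> \<open>After weighting by \<open>exp (b * s)\<close> the quadratic term feeds back with
    the constant \<open>\<beta> * q / b\<close>, which is below 1 because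
    \<open>\<beta> * q < b\<close>; taking the supremum over \<open>s\<close> closes the
    estimate.\<close>
  proof (rule contraction_bound[where I="{0..S}" and h="\<lambda>s. exp (b * s) * ?G s" and ?M0.0="exp (b * S)"])
    fix s assume "s \<in> {0..S}"
    then have "exp (b * s) * ?G s \<le> exp (b * S) * 1"
      using Gb[of s] b0 rate_pos by (intro mult_mono order_trans[OF Gb(2)]) auto
    then show "exp (b * s) * ?G s \<le> exp (b * S)" by simp
  next
    fix M s assume M: "\<And>r. r \<in> {0..S} \<Longrightarrow> exp (b * r) * ?G r \<le> M" and "s \<in> {0..S}"
    then have s: "0 \<le> s" "s \<le> S" by auto
    have "0 \<le> exp (b * s) * ?G s" using Gb(1)[of s] by simp
    also have "\<dots> \<le> M" using M[of s] s by simp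
    finally have M0: "0 \<le> M" .
    have Q: "?Q r \<le> q * M * exp ((\<beta> - b) * r) + k * exp (\<beta> * r)" if r: "0 \<le> r" "r \<le> S" for r
    proof -
      have "?Q r \<le> heat r (\<lambda>y. q * \<phi> (t - r) y + indicator (- D r) y) x"
      proof (rule heat_mono[of _ _ 1 "q + 1"])
        fix y
        show "(\<phi> (t - r) y)\<^sup>2 \<le> q * \<phi> (t - r) y + indicator (- D r) y"
        proof (cases "y \<in> D r")
          case True
          then show ?thesis
            using small[OF r True] solution_bounds[of "t - r" y]
            by (simp add: power2_eq_square mult_right_mono)
        next
          case False
          then show ?thesis
            using square_bounds[of "t - r" y] mult_nonneg_nonneg[OF q solution_bounds(1), of "t - r" y] by simp
        qed
        show "\<bar>q * \<phi> (t - r) y + indicator (- D r) y\<bar> \<le> q + 1"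
          using q solution_bounds[of "t - r" y] mult_left_mono[of "\<phi> (t - r) y" 1 q]
            mult_nonneg_nonneg[of q "\<phi> (t - r) y"] by (auto simp: indicator_def)
      qed (auto simp: square_bounds)
      also have "\<dots> = q * heat r (\<phi> (t - r)) x + heat r (indicator (- D r)) x"
        using q by (subst heat_add[of _ _ q 1])
          (auto simp: heat_cmult abs_mult abs_bounds mult_left_le indicator_def)
      also have "heat r (\<phi> (t - r)) x \<le> M * exp ((\<beta> - b) * r)"
      proof -
        have "heat r (\<phi> (t - r)) x = exp ((\<beta> - b) * r) * (exp (b * r) * ?G r)"
        proof -
          have "exp ((\<beta> - b) * r) * exp (b * r) * exp (- \<beta> * r) = exp ((\<beta> - b) * r + b * r + - \<beta> * r)"
            by (simp only: exp_add)
          also have "\<dots> = 1" by (simp add: algebra_simps)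
          finally show ?thesis by (simp add: mult.assoc[symmetric])
        qed
        also have "\<dots> \<le> exp ((\<beta> - b) * r) * M" using M[of r] r by (intro mult_left_mono) auto
        finally show ?thesis by (simp add: mult.commute)
      qed
      also have "heat r (indicator (- D r)) x \<le> k * exp (\<beta> * r)"
      proof -
        have "heat r (indicator (- D r)) x = exp (\<beta> * r) * (exp (- \<beta> * r) * heat r (indicator (- D r)) x)"
          by (simp add: mult.assoc[symmetric] exp_add[symmetric])
        also have "\<dots> \<le> exp (\<beta> * r) * k" using exit[OF r] by (intro mult_left_mono) auto
        finally show ?thesis by (simp add: mult.commute)
      qed
      finally show ?thesis using q by (simp add: mult_left_mono mult.assoc)
    qed
    let ?F = "\<lambda>r. q * M * exp ((\<beta> - b) * r) + k * exp (\<beta> * r)"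
    \<comment> \<open>Both exponentials are rewritten in the time \<open>r\<close> elapsed since
      \<open>s\<close>, the first one relative to the remaining time \<open>S - s - r\<close>, so
      that \<open>duhamel_exp\<close> with \<open>k = b - \<beta>\<close> applies.\<close>
    have F: "?F (s + r) = q * M * exp ((\<beta> - b) * S) * exp ((b - \<beta>) * (S - s - r)) + k * exp (\<beta> * s) * exp (\<beta> * r)" for r
    proof -
      have "exp ((\<beta> - b) * (s + r)) = exp ((\<beta> - b) * S) * exp ((b - \<beta>) * (S - s - r))"
        by (subst exp_add[symmetric]) (simp add: algebra_simps)
      moreover have "exp (\<beta> * (s + r)) = exp (\<beta> * s) * exp (\<beta> * r)"
        by (simp add: distrib_left exp_add)
      ultimately show ?thesis by (simp only: mult.assoc)
    qed
    define C1 where "C1 = exp (\<bar>b - \<beta>\<bar> * S)"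
    have e1: "\<bar>exp ((b - \<beta>) * (S - s - r))\<bar> \<le> C1" if "0 \<le> r" "r \<le> S - s" for r
    proof -
      have "(b - \<beta>) * (S - s - r) \<le> \<bar>b - \<beta>\<bar> * S" using that s by (intro mult_mono) auto
      then show ?thesis by (simp add: C1_def)
    qed
    have e2: "\<bar>exp (\<beta> * r)\<bar> \<le> exp (\<beta> * S)" if "0 \<le> r" "r \<le> S - s" for r
      using that s rate_pos by simp
    have "duhamel \<beta> (S - s) (\<lambda>r. ?Q (s + r)) \<le> duhamel \<beta> (S - s) (\<lambda>r. ?F (s + r))"
    proof (rule duhamel_mono[of _ _ _ _ 1 "\<bar>q * M * exp ((\<beta> - b) * S)\<bar> * C1 + \<bar>k * exp (\<beta> * s)\<bar> * exp (\<beta> * S)"])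
      fix r assume r: "0 \<le> r" "r \<le> S - s"
      show "\<bar>?F (s + r)\<bar> \<le> \<bar>q * M * exp ((\<beta> - b) * S)\<bar> * C1 + \<bar>k * exp (\<beta> * s)\<bar> * exp (\<beta> * S)"
        unfolding F
        by (intro order_trans[OF abs_triangle_ineq] add_mono; unfold abs_mult[of _ "exp (_ * _)"];
            intro mult_left_mono e1 e2 r) auto
    qed (use rate_pos heat_square_bound Q s in auto)
    also have "\<dots> = q * M * exp ((\<beta> - b) * S) * duhamel \<beta> (S - s) (\<lambda>r. exp ((b - \<beta>) * (S - s - r)))
        + k * exp (\<beta> * s) * duhamel \<beta> (S - s) (\<lambda>r. exp (\<beta> * r))"
      unfolding F using rate_pos e1 e2
      by (subst duhamel_add[of _ _ _ _ "\<bar>q * M * exp ((\<beta> - b) * S)\<bar> * C1" "\<bar>k * exp (\<beta> * s)\<bar> * exp (\<beta> * S)"])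
        (auto simp: duhamel_cmult abs_mult intro!: mult_left_mono)
    also have "duhamel \<beta> (S - s) (\<lambda>r. exp (\<beta> * r)) = \<beta> * (S - s)"
      by (rule duhamel_exp_rate) (use s in auto)
    also have "duhamel \<beta> (S - s) (\<lambda>r. exp ((b - \<beta>) * (S - s - r)))
        = \<beta> / b * (exp ((b - \<beta>) * (S - s)) - exp (- \<beta> * (S - s)))"
      using duhamel_exp[of "S - s" \<beta> "b - \<beta>"] s b0 by simp
    finally have dQ: "duhamel \<beta> (S - s) (\<lambda>r. ?Q (s + r)) \<le>
        q * M * exp ((\<beta> - b) * S) * (\<beta> / b * (exp ((b - \<beta>) * (S - s)) - exp (- \<beta> * (S - s))))
        + k * exp (\<beta> * s) * (\<beta> * (S - s))" .
    also have "\<dots> \<le> q * M * exp ((\<beta> - b) * S) * (\<beta> / b * exp ((b - \<beta>) * (S - s)))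
        + k * exp (\<beta> * s) * (\<beta> * S)"
      using q M0 b0 rate_pos s k by (intro add_mono mult_left_mono) auto
    also have "\<dots> = exp (\<beta> * s) * (\<beta> * q / b * M * exp (- b * s) + \<beta> * k * S)"
    proof -
      have "exp ((\<beta> - b) * S) * exp ((b - \<beta>) * (S - s)) = exp (\<beta> * s) * exp (- b * s)"
        by (simp only: exp_add[symmetric]) (simp add: algebra_simps)
      then have "q * M * (\<beta> / b) * (exp ((\<beta> - b) * S) * exp ((b - \<beta>) * (S - s)))
          = q * M * (\<beta> / b) * (exp (\<beta> * s) * exp (- b * s))" by (simp only:)
      then show ?thesis by (simp only: distrib_left times_divide_eq_right times_divide_eq_left mult_ac)
    qed
    finally have dQ: "duhamel \<beta> (S - s) (\<lambda>r. ?Q (s + r)) \<le>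
        exp (\<beta> * s) * (\<beta> * q / b * M * exp (- b * s) + \<beta> * k * S)" .
    \<comment> \<open>Both sides equal \<open>\<phi> t x\<close>, by \<open>solution_shift\<close>
      at \<open>s\<close> and at \<open>S\<close>. Thus \<open>?G s\<close> is expressed through the
      terminal value \<open>?G S\<close>, for which the trivial bound
      \<open>exp (- \<beta> * S)\<close> suffices.\<close>
    have "?G s + duhamel \<beta> s ?Q = ?G S + duhamel \<beta> S ?Q"
      using solution_shift[of s t x] solution_shift[of S t x] s S by simp
    moreover have "duhamel \<beta> S ?Q = duhamel \<beta> s ?Q + exp (- \<beta> * s) * duhamel \<beta> (S - s) (\<lambda>r. ?Q (s + r))"
      by (rule duhamel_split[of _ _ 1]) (use rate_pos s heat_square_bound in auto)
    ultimately have "?G s = ?G S + exp (- \<beta> * s) * duhamel \<beta> (S - s) (\<lambda>r. ?Q (s + r))" by simp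
    also have "\<dots> \<le> exp (- \<beta> * S) + exp (- \<beta> * s) * (exp (\<beta> * s) * (\<beta> * q / b * M * exp (- b * s) + \<beta> * k * S))"
      by (intro add_mono mult_left_mono dQ Gb) auto
    also have "exp (- \<beta> * s) * (exp (\<beta> * s) * (\<beta> * q / b * M * exp (- b * s) + \<beta> * k * S))
        = \<beta> * q / b * M * exp (- b * s) + \<beta> * k * S"
      by (simp add: mult.assoc[symmetric] exp_add[symmetric])
    finally have "exp (b * s) * ?G s \<le> exp (b * s) * (exp (- \<beta> * S) + \<beta> * k * S + \<beta> * q / b * M * exp (- b * s))"
      by (intro mult_left_mono) auto
    also have "\<dots> = exp (b * s) * (exp (- \<beta> * S) + \<beta> * k * S) + \<beta> * q / b * M"
      by (simp add: distrib_left exp_minus)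
    also have "\<dots> \<le> ?A + \<beta> * q / b * M"
      using s b0 k rate_pos S by (intro add_right_mono mult_right_mono) auto
    finally show "exp (b * s) * ?G s \<le> ?A + \<beta> * q / b * M" .
  qed (use S b b0 in auto)
  then show ?thesis by (simp add: heat_0)
qed

end

section \<open>Decay of the solution where the expected mass is large\<close>

text \<open>
  Follow a ball moving with constant velocity: per step, the deficit on it grows by the factor \<open>E\<close> until
  it saturates at \<open>\<delta>'\<close>.
\<close>

lemma (in kpp_solution) deficit_tube:
  fixes c w :: 'v
  assumes h: "0 < h" and R: "0 < R" and \<delta>: "\<delta> \<le> 1" "\<delta>' * exp (\<beta> * h) \<le> \<delta>" "0 \<le> \<delta>'"
    and A: "0 \<le> A" "\<And>y. y \<in> ball c R \<Longrightarrow> A \<le> 1 - f y"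
    and E: "1 \<le> E"
      "E \<le> exp (\<beta> * (1 - \<delta>) * h) * ((1 / sqrt (2 * pi * h)) ^ DIM('v) *
        exp (- (norm w + 2 * R)\<^sup>2 / (2 * h)) * measure lborel (ball (0::'v) R))"
    and y: "y \<in> ball (c + real k *\<^sub>R w) R"
  shows "min \<delta>' (A * E ^ k) \<le> 1 - \<phi> (real k * h) y"
  using y
proof (induction k arbitrary: y)
  case 0
  then have "A \<le> 1 - f y" by (intro A) simp
  then show ?case by (simp add: solution_0 min.coboundedI2)
next
  case (Suc k)
  let ?m = "min \<delta>' (A * E ^ k)" and ?B = "ball (c + real k *\<^sub>R w) R"
  let ?q = "(1 / sqrt (2 * pi * h)) ^ DIM('v) *
        exp (- (norm w + 2 * R)\<^sup>2 / (2 * h)) * measure lborel (ball (0::'v) R)"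
  have m0: "0 \<le> ?m" using \<delta> A E by auto
  \<comment> \<open>One \<open>R\<close> is for the position of \<open>y\<close> in the next ball,
    the other for the radius that \<open>heat_ball_lower\<close> adds.\<close>
  have "norm (c + real k *\<^sub>R w - y) + R \<le> norm w + 2 * R"
  proof -
    have "norm (c + real (Suc k) *\<^sub>R w - y) < R" using Suc.prems by (simp add: dist_norm)
    moreover have "norm (c + real k *\<^sub>R w - y) = norm ((c + real (Suc k) *\<^sub>R w - y) - w)"
      by (rule arg_cong[where f=norm]) (simp add: algebra_simps)
    moreover note norm_triangle_ineq4[of "c + real (Suc k) *\<^sub>R w - y" w]
    ultimately show ?thesis by linarith
  qed
  from heat_ball_lower[OF R h this] have q: "?q \<le> heat h (indicator ?B) y" .
  \<comment> \<open>Since \<open>1 \<le> E\<close>, a step cannot push the saturation level below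
    \<open>\<delta>'\<close>.\<close>
  have "min \<delta>' (A * E ^ Suc k) \<le> E * ?m"
  proof -
    have "min \<delta>' (A * E ^ Suc k) \<le> min (E * \<delta>') (E * (A * E ^ k))"
      using E(1) \<delta>(3) mult_right_mono[of 1 E \<delta>'] by (intro min.mono) (auto simp: mult_ac)
    then show ?thesis using E(1) by (simp add: min_mult_distrib_left)
  qed
  also have "\<dots> \<le> exp (\<beta> * (1 - \<delta>) * h) * heat h (indicator ?B) y * ?m"
    using E(2) q m0 by (intro mult_right_mono order_trans[OF E(2)] mult_left_mono) auto
  also have "\<dots> = exp (\<beta> * (1 - \<delta>) * h) * heat h (\<lambda>x. ?m * indicator ?B x) y"
    by (simp add: heat_cmult mult_ac)
  also have "\<dots> \<le> 1 - \<phi> (real k * h + h) y"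
  proof (rule deficit_lower_step[OF _ _ _ \<delta>(1,2)])
    fix x
    show "?m * indicator ?B x \<le> 1 - \<phi> (real k * h) x"
      using Suc.IH[of x] solution_bounds[of "real k * h" x] by (simp add: indicator_def)
    show "?m * indicator ?B x \<le> \<delta>'" "0 \<le> ?m * indicator ?B x"
      using m0 \<delta> by (auto simp: indicator_def)
  qed (use h in \<open>auto intro!: borel_measurable_times borel_measurable_indicator\<close>)
  finally show ?case by (simp add: algebra_simps)
qed

text \<open>In the exponent the Gaussian prefactor is a logarithm of the time, hence negligible
  against any multiple of the time.\<close>

lemma gauss_normalization_eq_exp:
  assumes "0 < s"
  shows "(1 / sqrt (2 * pi * s)) ^ n = exp (- (n / 2 * ln (2 * pi * s)))"
proof -
  have "1 / sqrt (2 * pi * s) = exp (- (1 / 2 * ln (2 * pi * s)))"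
    using assms by (simp add: exp_minus powr_half_sqrt[symmetric] powr_def inverse_eq_divide)
  then show ?thesis by (simp add: exp_of_nat_mult[symmetric])
qed

text \<open>The hypothesis asks for a first moment of at least 1 on the exponential scale, so
  \<open>x\<close> lies behind the front, which moves with speed
  \<open>sqrt (2 * \<beta>)\<close>.\<close>

lemma norm_le_speed:
  fixes x :: "'v::real_normed_vector"
  assumes \<tau>: "0 < \<tau>" and "0 < \<beta>" and cond: "0 \<le> \<beta> * \<tau> - (norm x)\<^sup>2 / (2 * \<tau>)"
  shows "norm x \<le> sqrt (2 * \<beta>) * \<tau>"
proof -
  have "(norm x)\<^sup>2 \<le> 2 * \<beta> * \<tau>\<^sup>2" using cond \<tau> by (simp add: field_simps power2_eq_square)
  also have "\<dots> = (sqrt (2 * \<beta>) * \<tau>)\<^sup>2" using \<open>0 < \<beta>\<close> by (simp add: power_mult_distrib)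
  finally show ?thesis by (rule power2_le_imp_le) (use \<tau> \<open>0 < \<beta>\<close> in simp)
qed

text \<open>The line from \<open>c\<close> to \<open>x\<close> is cut into \<open>n\<close> steps of
  duration \<open>h\<close> between \<open>H\<close> and \<open>2 * H\<close>. A long step makes the
  fixed losses (volume of the ball, Gaussian normalisation, displacement inside the ball) small
  against \<open>h\<close>; a bounded step keeps \<open>\<delta>'\<close> independent of
  \<open>t\<close>. The reserve \<open>\<eta> * t\<close> is spent as \<open>\<eta> / 4\<close> on
  the factor \<open>1 - \<delta>\<close>, \<open>\<eta> / 4\<close> on the step losses, and
  \<open>\<eta> / 2\<close> on replacing \<open>norm (x - c)\<close> by \<open>norm x\<close> and on
  the factor 1/2 of the datum.\<close>

lemma uniform_deficit_bound:
  fixes c :: "'v::euclidean_space"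
  assumes \<beta>: "0 < \<beta>" and R: "0 < R" and \<eta>: "0 < \<eta>" and a: "0 \<le> a"
  shows "\<exists>\<delta>'>0. \<delta>' < 1 \<and> (\<exists>T. \<forall>t\<ge>T. \<forall>f \<phi>. kpp_solution \<beta> f \<phi> \<longrightarrow>
      (\<forall>y\<in>ball c R. exp (- \<beta> * a * t) / 2 \<le> 1 - f y) \<longrightarrow>
      (\<forall>\<tau> x. 0 < \<tau> \<longrightarrow> \<tau> \<le> t \<longrightarrow> (\<beta> * a + \<eta>) * t \<le> \<beta> * \<tau> - (norm x)\<^sup>2 / (2 * \<tau>) \<longrightarrow>
        \<phi> \<tau> x \<le> 1 - \<delta>'))"
proof -
  define \<delta> where "\<delta> = min (1 / 2) (\<eta> / (4 * \<beta>))"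
  have \<delta>: "0 < \<delta>" "\<delta> \<le> 1 / 2" "\<beta> * \<delta> \<le> \<eta> / 4"
  proof -
    have "\<beta> * \<delta> \<le> \<beta> * (\<eta> / (4 * \<beta>))" unfolding \<delta>_def using \<beta> by (intro mult_left_mono) auto
    then show "\<beta> * \<delta> \<le> \<eta> / 4" using \<beta> by simp
  qed (use \<eta> \<beta> in \<open>auto simp: \<delta>_def\<close>)
  \<comment> \<open>Bound for the speed \<open>norm w / h\<close> of the moving ball; the summand 1
    pays for \<open>norm c \<le> \<tau>\<close>.\<close>
  define V where "V = sqrt (2 * \<beta>) + 1"
  define vol where "vol = measure lborel (ball (0::'v) R)"
  have vol: "0 < vol" unfolding vol_def using R content_ball_pos[of R "0::'v"] by simp
  have V0: "0 < V" unfolding V_def using \<beta> by (simp add: add_nonneg_pos)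
  have "\<forall>\<^sub>F h in at_top. 1 \<le> h \<and> 2 * R * V + 2 * R\<^sup>2 + DIM('v) / 2 * ln (2 * pi * h) - ln vol \<le> \<eta> / 4 * h"
    using \<eta> by (intro eventually_conj eventually_ge_at_top) real_asymp
  then obtain H where "1 \<le> H" and H: "\<And>h. H \<le> h \<Longrightarrow>
      2 * R * V + 2 * R\<^sup>2 + DIM('v) / 2 * ln (2 * pi * h) - ln vol \<le> \<eta> / 4 * h"
    unfolding eventually_at_top_linorder by blast
  have step: "exp (- (\<eta> / 4) * h) \<le> (1 / sqrt (2 * pi * h)) ^ DIM('v) * vol * exp (- (2 * R * V + 2 * R\<^sup>2))"
    if h: "H \<le> h" for h
  proof -
    have h0: "0 < h" using h \<open>1 \<le> H\<close> by simp
    have "(1 / sqrt (2 * pi * h)) ^ DIM('v) * vol * exp (- (2 * R * V + 2 * R\<^sup>2))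
        = exp (- (DIM('v) / 2 * ln (2 * pi * h))) * exp (ln vol) * exp (- (2 * R * V + 2 * R\<^sup>2))"
      using vol gauss_normalization_eq_exp[OF h0, of "DIM('v)"] by simp
    also have "\<dots> = exp (- (DIM('v) / 2 * ln (2 * pi * h)) + ln vol + - (2 * R * V + 2 * R\<^sup>2))"
      by (simp only: exp_add)
    finally show ?thesis using H[OF h] by simp
  qed
  \<comment> \<open>Even after growth at rate \<beta> over the longest step \<open>2 * H\<close>, a
    deficit capped at \<open>\<delta>'\<close> does not exceed \<delta>.\<close>
  define \<delta>' where "\<delta>' = \<delta> * exp (- 2 * \<beta> * H)"
  have \<delta>': "0 < \<delta>'" "\<delta>' < 1"
  proof -
    show "0 < \<delta>'" using \<delta> by (simp add: \<delta>'_def)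
    have "\<delta>' \<le> \<delta>" unfolding \<delta>'_def using \<delta> \<beta> \<open>1 \<le> H\<close> by (intro mult_left_le) auto
    then show "\<delta>' < 1" using \<delta> by linarith
  qed
  \<comment> \<open>Cost of aiming at \<open>c\<close> instead of 0: the cross term of
    \<open>(norm x + norm c)\<^sup>2 / (2 * \<tau>)\<close>, where \<open>norm x / \<tau>\<close> is
    at most the front speed, and the square of \<open>norm c\<close>, where
    \<open>norm c / \<tau>\<close> is at most 1.\<close>
  define K where "K = sqrt (2 * \<beta>) * norm c + norm c / 2"
  define T where "T = max (max 1 (\<beta> / \<eta> * (H + norm c + 1))) (2 / \<eta> * (K + ln 2))"
  have main: "\<phi> \<tau> x \<le> 1 - \<delta>'"
    if t: "T \<le> t" and sol: "kpp_solution \<beta> f \<phi>"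
      and init: "\<And>y. y \<in> ball c R \<Longrightarrow> exp (- \<beta> * a * t) / 2 \<le> 1 - f y"
      and \<tau>: "0 < \<tau>" "\<tau> \<le> t" and cond: "(\<beta> * a + \<eta>) * t \<le> \<beta> * \<tau> - (norm x)\<^sup>2 / (2 * \<tau>)"
    for t f \<phi> \<tau> and x :: 'v
  proof -
    interpret kpp_solution \<beta> f \<phi> by fact
    have t1: "1 \<le> t" "H + norm c + 1 \<le> \<eta> / \<beta> * t" "K + ln 2 \<le> \<eta> / 2 * t"
      using t \<beta> \<eta> unfolding T_def by (auto simp: field_simps)
    have at0: "0 \<le> \<beta> * a * t" using \<beta> a t1 by simp
    have "\<eta> * t \<le> \<beta> * \<tau>"
    proof -
      have "0 \<le> (norm x)\<^sup>2 / (2 * \<tau>)" using \<tau> by simp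
      then show ?thesis using cond at0 by (simp add: distrib_right)
    qed
    then have "\<eta> / \<beta> * t \<le> \<tau>" using \<beta> by (simp add: field_simps)
    then have \<tau>H: "H \<le> \<tau>" "norm c \<le> \<tau>" "1 \<le> \<tau>" using t1(2) \<open>1 \<le> H\<close> norm_ge_zero[of c] by linarith+
    have x: "norm x \<le> sqrt (2 * \<beta>) * \<tau>"
    proof (rule norm_le_speed[OF \<tau>(1) \<beta>])
      have "0 \<le> (\<beta> * a + \<eta>) * t" using \<beta> a \<eta> t1 by simp
      then show "0 \<le> \<beta> * \<tau> - (norm x)\<^sup>2 / (2 * \<tau>)" using cond by linarith
    qed
    have xc: "norm (x - c) \<le> norm x + norm c" by (rule norm_triangle_ineq4)
    have xcV: "norm (x - c) \<le> V * \<tau>" using xc x \<tau>H(2) by (simp add: V_def distrib_right)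
    define n where "n = nat \<lfloor>\<tau> / H\<rfloor>"
    have n1: "1 \<le> \<tau> / H" using \<tau>H \<open>1 \<le> H\<close> by simp
    have n: "1 \<le> real n" "real n \<le> \<tau> / H" "\<tau> / H < real n + 1"
      unfolding n_def using n1 by (auto simp: of_nat_nat le_floor_iff)
    define h where "h = \<tau> / n"
    have nh: "real n * h = \<tau>" using n by (simp add: h_def)
    have h: "H \<le> h" "h \<le> 2 * H"
    proof -
      show "H \<le> h" using n \<open>1 \<le> H\<close> unfolding h_def by (simp add: field_simps)
      have "\<tau> / H \<le> 2 * real n" using n by linarith
      then show "h \<le> 2 * H" using n \<open>1 \<le> H\<close> unfolding h_def by (simp add: field_simps)
    qed
    have h0: "0 < h" using h \<open>1 \<le> H\<close> by simp
    define w where "w = (1 / n) *\<^sub>R (x - c)"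
    have nw: "c + real n *\<^sub>R w = x" using n by (simp add: w_def)
    have w: "norm w = norm (x - c) / n" unfolding w_def using n by simp
    have wV: "norm w \<le> V * h" using xcV n unfolding w h_def by (simp add: divide_right_mono)
    \<comment> \<open>Net growth rate of the deficit along the tube; \<open>exp (h * g)\<close>
      plays the role of \<open>E\<close>.\<close>
    define g where "g = \<beta> * (1 - \<delta>) - (norm w)\<^sup>2 / (2 * h\<^sup>2) - \<eta> / 4"
    have \<tau>g: "\<beta> * a * t + ln 2 \<le> \<tau> * g"
    proof -
      have "\<tau> * ((norm w)\<^sup>2 / (2 * h\<^sup>2)) = (norm (x - c))\<^sup>2 / (2 * \<tau>)"
        using n \<tau>(1) unfolding w h_def by (simp add: field_simps power2_eq_square)
      also have "\<dots> \<le> (norm x + norm c)\<^sup>2 / (2 * \<tau>)"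
        using xc \<tau>(1) by (intro divide_right_mono power_mono) auto
      also have "\<dots> = (norm x)\<^sup>2 / (2 * \<tau>) + (norm x / \<tau>) * norm c + (norm c / \<tau>) * norm c / 2"
        using \<tau>(1) by (simp add: field_simps power2_eq_square)
      also have "\<dots> \<le> (norm x)\<^sup>2 / (2 * \<tau>) + sqrt (2 * \<beta>) * norm c + 1 * norm c / 2"
        using \<tau>(1) x \<tau>H(2)
        by (intro add_mono divide_right_mono mult_right_mono) (auto simp: divide_le_eq)
      finally have "\<tau> * ((norm w)\<^sup>2 / (2 * h\<^sup>2)) \<le> (norm x)\<^sup>2 / (2 * \<tau>) + K" by (simp add: K_def)
      moreover have "\<tau> * (\<beta> * \<delta>) \<le> t * (\<eta> / 4)" "\<tau> * (\<eta> / 4) \<le> t * (\<eta> / 4)"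
        by (rule mult_mono; use \<delta> \<beta> \<eta> \<tau> in simp)+
      moreover have "\<tau> * g = \<beta> * \<tau> - \<tau> * (\<beta> * \<delta>) - \<tau> * ((norm w)\<^sup>2 / (2 * h\<^sup>2)) - \<tau> * (\<eta> / 4)"
        by (simp add: g_def algebra_simps)
      moreover have "(\<beta> * a + \<eta>) * t = \<beta> * a * t + t * (\<eta> / 4) + t * (\<eta> / 4) + \<eta> / 2 * t"
        by (simp add: algebra_simps)
      ultimately show ?thesis using cond t1(3) by linarith
    qed
    have "0 \<le> \<tau> * g" using \<tau>g at0 ln_ge_zero[of 2] by linarith
    then have g0: "0 \<le> g" using \<tau> by (simp add: zero_le_mult_iff)
    have "min \<delta>' (exp (- \<beta> * a * t) / 2 * exp (h * g) ^ n) \<le> 1 - \<phi> (real n * h) x"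
    proof (rule deficit_tube[OF h0 R, where \<delta>=\<delta>])
      show "\<delta> \<le> 1" "0 \<le> \<delta>'" "0 \<le> exp (- \<beta> * a * t) / 2" using \<delta> \<delta>' by auto
      have "exp (- 2 * \<beta> * H) * exp (\<beta> * h) \<le> 1" using h \<beta> by (simp add: exp_add[symmetric])
      then show "\<delta>' * exp (\<beta> * h) \<le> \<delta>" using \<delta> by (simp add: \<delta>'_def mult.assoc mult_left_le)
      show "1 \<le> exp (h * g)" using h0 g0 by simp
      show "x \<in> ball (c + real n *\<^sub>R w) R" using nw R by simp
      have ex: "- ((norm w)\<^sup>2 / (2 * h)) - (2 * R * V + 2 * R\<^sup>2) \<le> - (norm w + 2 * R)\<^sup>2 / (2 * h)"
      proof -
        have "(norm w + 2 * R)\<^sup>2 / (2 * h) = (norm w)\<^sup>2 / (2 * h) + 2 * R * (norm w / h) + 2 * R\<^sup>2 / h"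
          using h0 by (simp add: field_simps power2_eq_square)
        moreover have "2 * R * (norm w / h) \<le> 2 * R * V"
          using wV h0 R by (intro mult_left_mono) (auto simp: divide_le_eq)
        moreover have "2 * R\<^sup>2 / h \<le> 2 * R\<^sup>2"
        proof -
          have "2 * R\<^sup>2 * 1 \<le> 2 * R\<^sup>2 * h" using h \<open>1 \<le> H\<close> by (intro mult_left_mono) auto
          then show ?thesis using h0 by (simp add: divide_le_eq)
        qed
        ultimately show ?thesis by simp
      qed
      have "h * g = \<beta> * (1 - \<delta>) * h + - ((norm w)\<^sup>2 / (2 * h)) + - (\<eta> / 4) * h"
        using h0 by (simp add: g_def field_simps power2_eq_square)
      then have "exp (h * g) = exp (\<beta> * (1 - \<delta>) * h) * exp (- ((norm w)\<^sup>2 / (2 * h))) * exp (- (\<eta> / 4) * h)"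
        by (simp only: exp_add)
      also have "\<dots> \<le> exp (\<beta> * (1 - \<delta>) * h) * exp (- ((norm w)\<^sup>2 / (2 * h))) *
          ((1 / sqrt (2 * pi * h)) ^ DIM('v) * vol * exp (- (2 * R * V + 2 * R\<^sup>2)))"
        by (intro mult_left_mono step h) auto
      also have "\<dots> = exp (\<beta> * (1 - \<delta>) * h) * ((1 / sqrt (2 * pi * h)) ^ DIM('v) *
          exp (- ((norm w)\<^sup>2 / (2 * h)) - (2 * R * V + 2 * R\<^sup>2)) * vol)"
        unfolding exp_diff exp_minus by (simp add: field_simps)
      also have "\<dots> \<le> exp (\<beta> * (1 - \<delta>) * h) * ((1 / sqrt (2 * pi * h)) ^ DIM('v) *
          exp (- (norm w + 2 * R)\<^sup>2 / (2 * h)) * vol)"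
        using vol ex h0 by (intro mult_left_mono mult_right_mono) auto
      finally show "exp (h * g) \<le> exp (\<beta> * (1 - \<delta>) * h) * ((1 / sqrt (2 * pi * h)) ^ DIM('v) *
          exp (- (norm w + 2 * R)\<^sup>2 / (2 * h)) * measure lborel (ball (0::'v) R))"
        by (simp add: vol_def)
    qed (use init in auto)
    \<comment> \<open>The accumulated growth makes up for the small initial deficit, so the minimum
      equals \<open>\<delta>'\<close>.\<close>
    moreover have "1 \<le> exp (- \<beta> * a * t) / 2 * exp (h * g) ^ n"
    proof -
      have "exp (- \<beta> * a * t) / 2 * exp (h * g) ^ n = exp (- \<beta> * a * t) * exp (- ln 2) * exp (\<tau> * g)"
        using nh by (simp add: exp_of_nat_mult[symmetric] exp_minus[of "ln 2"] mult.assoc[symmetric])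
      also have "\<dots> = exp (- \<beta> * a * t + - ln 2 + \<tau> * g)" by (simp only: exp_add)
      finally show ?thesis using \<tau>g by simp
    qed
    ultimately show ?thesis using \<delta>' nh by simp
  qed
  show ?thesis using \<delta>' main by blast
qed

text \<open>
  The gap \<open>\<delta>'\<close> already gives killing at rate \<open>\<beta>\<delta>'\<close>; running the equation backwards for a further bounded
  time, during which the region is rarely left, makes \<open>\<phi>\<close> small.
\<close>

lemma kpp_decay:
  fixes c :: "'v::euclidean_space"
  assumes \<beta>: "0 < \<beta>" and R: "0 < R" and \<eta>: "0 < \<eta>" and a: "0 \<le> a" and \<epsilon>: "0 < \<epsilon>"
  shows "\<exists>T. \<forall>t\<ge>T. \<forall>f \<phi>. kpp_solution \<beta> f \<phi> \<longrightarrow>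
      (\<forall>y\<in>ball c R. exp (- \<beta> * a * t) / 2 \<le> 1 - f y) \<longrightarrow>
      (\<forall>\<tau> x. 0 < \<tau> \<longrightarrow> \<tau> \<le> t \<longrightarrow> (\<beta> * a + \<eta>) * t \<le> \<beta> * \<tau> - (norm x)\<^sup>2 / (2 * \<tau>) \<longrightarrow>
        \<phi> \<tau> x \<le> \<epsilon>)"
proof -
  obtain \<delta>' T1 where \<delta>': "0 < \<delta>'" "\<delta>' < 1" and T1: "\<And>t f \<phi> \<tau> (x::'v). T1 \<le> t \<Longrightarrow> kpp_solution \<beta> f \<phi> \<Longrightarrow>
      (\<forall>y\<in>ball c R. exp (- \<beta> * a * t) / 2 \<le> 1 - f y) \<Longrightarrow>
      0 < \<tau> \<Longrightarrow> \<tau> \<le> t \<Longrightarrow> (\<beta> * a + \<eta> / 2) * t \<le> \<beta> * \<tau> - (norm x)\<^sup>2 / (2 * \<tau>) \<Longrightarrow> \<phi> \<tau> x \<le> 1 - \<delta>'"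
    using uniform_deficit_bound[OF \<beta> R half_gt_zero[OF \<eta>] a, of c] by metis
  \<comment> \<open>Midway between \<open>\<beta> * (1 - \<delta>')\<close> and \<beta>: above the
    first, so the feedback ratio stays below 1 by \<open>\<delta>' / 2\<close>; below the second, so
    \<open>exp (b * S) * exp (- \<beta> * S)\<close> decays in \<open>S\<close>.\<close>
  define b where "b = \<beta> * (1 - \<delta>' / 2)"
  have b0: "0 < b" using \<beta> \<delta>' by (simp add: b_def)
  have "((\<lambda>S. 2 / \<delta>' * exp (- (\<beta> * \<delta>' / 2) * S)) \<longlongrightarrow> 0) at_top" using \<beta> \<delta>' by real_asymp
  then have "\<forall>\<^sub>F S in at_top. 2 / \<delta>' * exp (- (\<beta> * \<delta>' / 2) * S) < \<epsilon> / 2"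
    using \<epsilon> by (intro order_tendstoD) auto
  then have "\<forall>\<^sub>F S in at_top. 1 \<le> S \<and> 2 / \<delta>' * exp (- (\<beta> * \<delta>' / 2) * S) < \<epsilon> / 2"
    by (intro eventually_conj eventually_ge_at_top)
  then obtain S where S: "1 \<le> S" "2 / \<delta>' * exp (- (\<beta> * \<delta>' / 2) * S) < \<epsilon> / 2"
    using eventually_happens'[OF trivial_limit_at_top_linorder] by blast
  define C where "C = (1 / sqrt (1 / 2)) ^ DIM('v)"
  have C0: "0 < C" by (simp add: C_def)
  \<comment> \<open>\<open>S\<close> is fixed before \<open>L\<close>: the probability of being
    outside \<open>cball x L\<close> at a time up to \<open>S\<close> must beat the factor
    \<open>exp (b * S)\<close>.\<close>
  have "((\<lambda>L. 2 / \<delta>' * exp (b * S) * (\<beta> * (C * exp (- (L\<^sup>2) / (4 * S))) * S)) \<longlongrightarrow> 0) at_top"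
    using S C0 by real_asymp
  then have "\<forall>\<^sub>F L in at_top. 2 / \<delta>' * exp (b * S) * (\<beta> * (C * exp (- (L\<^sup>2) / (4 * S))) * S) < \<epsilon> / 2"
    using \<epsilon> by (intro order_tendstoD) auto
  then have "\<forall>\<^sub>F L in at_top. 1 \<le> L \<and> 2 / \<delta>' * exp (b * S) * (\<beta> * (C * exp (- (L\<^sup>2) / (4 * S))) * S) < \<epsilon> / 2"
    by (intro eventually_conj eventually_ge_at_top)
  then obtain L where L: "1 \<le> L" "2 / \<delta>' * exp (b * S) * (\<beta> * (C * exp (- (L\<^sup>2) / (4 * S))) * S) < \<epsilon> / 2"
    using eventually_happens'[OF trivial_limit_at_top_linorder] by blast
  define m where "m = sqrt (2 * \<beta>)"
  have m0: "0 \<le> m" using \<beta> by (simp add: m_def)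
  \<comment> \<open>Over a time lag of at most \<open>S\<close> and a distance of at most
    \<open>L\<close>, the exponent \<open>\<beta> * \<tau> - (norm x)\<^sup>2 / (2 * \<tau>)\<close>
    drops by at most \<open>K\<close>, which the reserve \<open>\<eta> / 2 * t\<close>
    covers.\<close>
  define K where "K = m\<^sup>2 * S + 2 * m * L + L\<^sup>2 + \<beta> * S"
  define T where "T = max (max T1 (\<beta> / \<eta> * (2 * S + 1))) (max 1 (2 / \<eta> * K))"
  have main: "\<phi> \<tau> x \<le> \<epsilon>"
    if t: "T \<le> t" and sol: "kpp_solution \<beta> f \<phi>"
      and init: "\<forall>y\<in>ball c R. exp (- \<beta> * a * t) / 2 \<le> 1 - f y"
      and \<tau>: "0 < \<tau>" "\<tau> \<le> t" and cond: "(\<beta> * a + \<eta>) * t \<le> \<beta> * \<tau> - (norm x)\<^sup>2 / (2 * \<tau>)"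
    for t f \<phi> \<tau> and x :: 'v
  proof -
    interpret kpp_solution \<beta> f \<phi> by fact
    have t1: "1 \<le> t" "T1 \<le> t" "2 * S + 1 \<le> \<eta> / \<beta> * t" "K \<le> \<eta> / 2 * t"
      using t \<beta> \<eta> unfolding T_def by (auto simp: field_simps)
    have at0: "0 \<le> \<beta> * a * t" using \<beta> a t1 by simp
    have "\<eta> * t \<le> \<beta> * \<tau>"
    proof -
      have "0 \<le> (norm x)\<^sup>2 / (2 * \<tau>)" using \<tau> by simp
      then show ?thesis using cond at0 by (simp add: distrib_right)
    qed
    then have "\<eta> / \<beta> * t \<le> \<tau>" using \<beta> by (simp add: field_simps)
    then have \<tau>S: "2 * S \<le> \<tau>" "1 \<le> \<tau>" using t1(3) S by linarith+
    have x: "norm x \<le> m * \<tau>"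
      unfolding m_def
    proof (rule norm_le_speed[OF \<tau>(1) \<beta>])
      have "0 \<le> (\<beta> * a + \<eta>) * t" using \<beta> a \<eta> t1 by simp
      then show "0 \<le> \<beta> * \<tau> - (norm x)\<^sup>2 / (2 * \<tau>)" using cond by linarith
    qed
    let ?k = "C * exp (- (L\<^sup>2) / (4 * S))"
    have ratio: "\<delta>' / 2 \<le> 1 - \<beta> * (1 - \<delta>') / b"
    proof -
      have "\<beta> * (1 - \<delta>') / b = (1 - \<delta>') / (1 - \<delta>' / 2)" using \<beta> by (simp add: b_def)
      also have "\<dots> \<le> 1 - \<delta>' / 2"
      proof -
        have "1 - \<delta>' \<le> (1 - \<delta>' / 2) * (1 - \<delta>' / 2)" by (simp add: algebra_simps)
        then show ?thesis using \<delta>' by (simp add: divide_le_eq)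
      qed
      finally show ?thesis by simp
    qed
    have "\<phi> \<tau> x \<le> exp (b * S) * (exp (- \<beta> * S) + \<beta> * ?k * S) / (1 - \<beta> * (1 - \<delta>') / b)"
    proof (rule solution_gronwall[where D="\<lambda>_. cball x L"])
      show "\<beta> * (1 - \<delta>') < b" using \<beta> \<delta>' by (simp add: b_def)
      fix r assume r: "0 \<le> r" "r \<le> S"
      have \<tau>r: "0 < \<tau> - r" "\<tau> / 2 \<le> \<tau> - r" using r \<tau>S \<tau> by auto
      show "\<phi> (\<tau> - r) y \<le> 1 - \<delta>'" if y: "y \<in> cball x L" for y
      proof (rule T1[OF t1(2) sol init])
        show "0 < \<tau> - r" "\<tau> - r \<le> t" using \<tau>r r \<tau> by auto
        have "norm y \<le> norm x + L"
          using y norm_triangle_ineq[of x "y - x"] by (auto simp: dist_norm norm_minus_commute)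
        then have "(norm y)\<^sup>2 \<le> (norm x + L)\<^sup>2" by (intro power_mono) auto
        also have "\<dots> = (norm x)\<^sup>2 + 2 * norm x * L + L\<^sup>2" by (simp add: power2_sum)
        also have "\<dots> \<le> (norm x)\<^sup>2 + 2 * (m * \<tau>) * L + L\<^sup>2 * \<tau>"
          using x L \<tau>S by (intro add_mono mult_right_mono mult_left_mono) auto
        finally have "(norm y)\<^sup>2 / (2 * (\<tau> - r)) \<le> ((norm x)\<^sup>2 + 2 * (m * \<tau>) * L + L\<^sup>2 * \<tau>) / (2 * (\<tau> - r))"
          using \<tau>r by (intro divide_right_mono) auto
        also have "\<dots> = (norm x)\<^sup>2 / (2 * (\<tau> - r)) + (2 * m * L + L\<^sup>2) * \<tau> / (2 * (\<tau> - r))"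
          by (simp add: add_divide_distrib algebra_simps)
        also have "(2 * m * L + L\<^sup>2) * \<tau> / (2 * (\<tau> - r)) \<le> (2 * m * L + L\<^sup>2) * 1"
          unfolding times_divide_eq_right[symmetric]
          using \<tau>r m0 L by (intro mult_left_mono) (auto simp: divide_le_eq)
        also have "(norm x)\<^sup>2 / (2 * (\<tau> - r)) \<le> (norm x)\<^sup>2 / (2 * \<tau>) + m\<^sup>2 * S"
        proof -
          have "(norm x)\<^sup>2 / (2 * (\<tau> - r)) = (norm x)\<^sup>2 / (2 * \<tau>) + (norm x)\<^sup>2 * r / (2 * \<tau> * (\<tau> - r))"
            using \<tau>r \<tau> by (simp add: field_simps)
          moreover have "(norm x)\<^sup>2 * r / (2 * \<tau> * (\<tau> - r)) \<le> (m * \<tau>)\<^sup>2 * S / (2 * \<tau> * (\<tau> / 2))"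
            using x r \<tau>r \<tau> S by (intro frac_le mult_mono power_mono mult_left_mono) auto
          moreover have "(m * \<tau>)\<^sup>2 * S / (2 * \<tau> * (\<tau> / 2)) = m\<^sup>2 * S"
            using \<tau> by (simp add: power2_eq_square)
          ultimately show ?thesis by simp
        qed
        finally have "(norm y)\<^sup>2 / (2 * (\<tau> - r)) \<le> (norm x)\<^sup>2 / (2 * \<tau>) + m\<^sup>2 * S + (2 * m * L + L\<^sup>2)"
          by simp
        moreover have "\<beta> * r \<le> \<beta> * S" using r \<beta> by simp
        moreover have "(\<beta> * a + \<eta>) * t = (\<beta> * a + \<eta> / 2) * t + \<eta> / 2 * t"
          by (simp add: algebra_simps)
        moreover have "\<beta> * (\<tau> - r) = \<beta> * \<tau> - \<beta> * r" by (simp add: algebra_simps)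
        ultimately show "(\<beta> * a + \<eta> / 2) * t \<le> \<beta> * (\<tau> - r) - (norm y)\<^sup>2 / (2 * (\<tau> - r))"
          using cond t1(4) unfolding K_def by linarith
      qed
      show "exp (- \<beta> * r) * heat r (indicator (- cball x L)) x \<le> ?k"
      proof (cases "r = 0")
        case True
        then show ?thesis using C0 L by (simp add: heat_0)
      next
        case False
        with r have r0: "0 < r" by simp
        have "- cball x L = {y. L < norm (y - x)}" by (auto simp: dist_norm norm_minus_commute)
        then have "heat r (indicator (- cball x L)) x \<le> C * exp (- (1 - 1 / 2) * (max 0 L)\<^sup>2 / (2 * r))"
          using heat_tail[of "1 / 2" r L x] r0 by (simp add: C_def)
        also have "\<dots> \<le> ?k"
        proof -
          have "L\<^sup>2 / (4 * S) \<le> L\<^sup>2 / (4 * r)" using r r0 by (intro divide_left_mono) auto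
          then show ?thesis using C0 L by (simp add: max_def)
        qed
        finally have "heat r (indicator (- cball x L)) x \<le> ?k" .
        moreover have "exp (- \<beta> * r) * heat r (indicator (- cball x L)) x \<le> 1 * heat r (indicator (- cball x L)) x"
          using r \<beta> by (intro mult_right_mono heat_nonneg) auto
        ultimately show ?thesis by simp
      qed
    qed (use \<delta>' C0 S \<tau>S in auto)
    also have "\<dots> \<le> exp (b * S) * (exp (- \<beta> * S) + \<beta> * ?k * S) / (\<delta>' / 2)"
      using ratio \<delta>' \<beta> C0 S by (intro divide_left_mono mult_pos_pos) auto
    also have "\<dots> = 2 / \<delta>' * (exp (b * S) * exp (- \<beta> * S)) + 2 / \<delta>' * exp (b * S) * (\<beta> * ?k * S)"
      by (simp add: distrib_left add_divide_distrib mult_ac)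
    also have "exp (b * S) * exp (- \<beta> * S) = exp (- (\<beta> * \<delta>' / 2) * S)"
      unfolding b_def by (subst exp_add[symmetric]) (simp add: algebra_simps)
    finally show ?thesis using S L by linarith
  qed
  show ?thesis using main by blast
qed

section \<open>Logarithmic asymptotics at the origin\<close>

text \<open>Measured in units of \<beta>. The cost
  \<open>\<kappa> + (1 - \<kappa>) * (1 - \<kappa> - a) / \<kappa>\<close> has its free minimum at
  \<open>\<kappa> = sqrt ((1 - a) / 2)\<close>, which for \<open>a < 1\<close> respects the
  constraint \<open>\<kappa> \<le> 1 - a\<close> exactly when \<open>a \<le> 1 / 2\<close>. Beyond
  that the endpoint \<open>\<kappa> = 1 - a\<close> is optimal: the initial particle only delays
  branching, and no displacement is charged.\<close>

definition decay_rate :: "real \<Rightarrow> real" where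
  "decay_rate a = (if a < 1 / 2 then 2 * sqrt (2 * (1 - a)) - 2 + a else 1 - a)"

text \<open>The right side is the cost of the endpoint \<open>\<kappa> = 1 - a\<close>. In the first
  branch the difference is the square of \<open>sqrt (2 * (1 - a)) - 1\<close>, which vanishes at
  \<open>a = 1 / 2\<close>, where the branches meet.\<close>

lemma decay_rate_le: "a \<le> 1 \<Longrightarrow> decay_rate a \<le> 1 - a"
proof -
  assume a: "a \<le> 1"
  have "0 \<le> (sqrt (2 * (1 - a)) - 1)\<^sup>2" by simp
  also have "\<dots> = 2 * (1 - a) - 2 * sqrt (2 * (1 - a)) + 1" using a by (simp add: power2_diff)
  finally show ?thesis by (simp add: decay_rate_def)
qed

text \<open>Up to the constant \<open>a - 2\<close> the cost is
  \<open>2 * \<kappa> + (1 - a) / \<kappa>\<close>, and completing the square gives the first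
  branch. When \<open>1 / 2 \<le> a\<close>, the constraint forces
  \<open>\<kappa> \<le> 1 / 2\<close>, so \<open>(1 - \<kappa>) / \<kappa>\<close> is at least 1 and
  displacement costs at least the waiting time \<open>1 - a - \<kappa>\<close> that it
  saves.\<close>

lemma decay_rate_le_cost:
  assumes a: "a < 1" and \<kappa>: "0 < \<kappa>" "\<kappa> \<le> 1 - a"
  shows "decay_rate a \<le> \<kappa> + (1 - \<kappa>) * (1 - \<kappa> - a) / \<kappa>"
proof (cases "a < 1 / 2")
  case True
  define q where "q = sqrt (2 * (1 - a))"
  have q: "q\<^sup>2 = 2 * (1 - a)" using a by (simp add: q_def)
  have "0 \<le> (2 * \<kappa> - q)\<^sup>2" by simp
  also have "\<dots> = 4 * \<kappa>\<^sup>2 - 4 * (q * \<kappa>) + 2 * (1 - a)"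
    unfolding q[symmetric] by (simp add: power2_eq_square algebra_simps)
  finally have "2 * (q * \<kappa>) \<le> 2 * \<kappa>\<^sup>2 + (1 - a)" by simp
  then have "2 * q \<le> (2 * \<kappa>\<^sup>2 + (1 - a)) / \<kappa>" using \<kappa> by (simp add: pos_le_divide_eq mult.assoc)
  also have "\<dots> = \<kappa> + (1 - \<kappa>) * (1 - \<kappa> - a) / \<kappa> + 2 - a"
    using \<kappa> by (simp add: field_simps power2_eq_square)
  finally show ?thesis using True by (simp add: decay_rate_def q_def)
next
  case False
  have "(1 - a - \<kappa>) * \<kappa> \<le> (1 - a - \<kappa>) * (1 - \<kappa>)" using \<kappa> False by (intro mult_left_mono) auto
  then have "1 - a - \<kappa> \<le> (1 - a - \<kappa>) * (1 - \<kappa>) / \<kappa>" using \<kappa> by (simp add: pos_le_divide_eq)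
  also have "\<dots> = (1 - \<kappa>) * (1 - \<kappa> - a) / \<kappa>" by (simp add: mult.commute)
  finally show ?thesis using False by (simp add: decay_rate_def)
qed

lemma decay_rate_attained:
  assumes a: "0 \<le> a" "a < 1"
  obtains \<kappa> where "0 < \<kappa>" "\<kappa> < 1" "\<kappa> \<le> 1 - a"
    "decay_rate a = \<kappa> + (1 - \<kappa>) * (1 - \<kappa> - a) / \<kappa>"
proof (cases "a < 1 / 2")
  case True
  define \<kappa> where "\<kappa> = sqrt (2 * (1 - a)) / 2"
  have sq: "\<kappa> * \<kappa> = (1 - a) / 2" using a by (simp add: \<kappa>_def)
  have \<kappa>0: "0 < \<kappa>" using a by (simp add: \<kappa>_def)
  have le: "\<kappa> \<le> 1 - a"
  proof -
    have "2 * (1 - a) * 1 \<le> 2 * (1 - a) * (2 * (1 - a))" using a True by (intro mult_left_mono) auto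
    then have "sqrt (2 * (1 - a)) \<le> sqrt ((2 * (1 - a))\<^sup>2)"
      unfolding power2_eq_square by (intro real_sqrt_le_mono) simp
    then show ?thesis using a by (simp add: \<kappa>_def)
  qed
  have lt: "\<kappa> < 1"
  proof -
    have "sqrt (2 * (1 - a)) < sqrt 4" using a by (intro real_sqrt_less_mono) auto
    then show ?thesis by (simp add: \<kappa>_def)
  qed
  have "(1 - \<kappa>) * (1 - \<kappa> - a) = (1 - a) - \<kappa> - \<kappa> * (1 - a) + \<kappa> * \<kappa>" by (simp add: field_simps)
  also have "\<dots> = \<kappa> * (3 * \<kappa> - 1 - (1 - a))" using sq by (simp add: algebra_simps)
  finally have "(1 - \<kappa>) * (1 - \<kappa> - a) / \<kappa> = 3 * \<kappa> - 1 - (1 - a)"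
    using \<kappa>0 by (metis less_irrefl nonzero_mult_div_cancel_left)
  moreover have "2 * sqrt (2 * (1 - a)) = 4 * \<kappa>" by (simp add: \<kappa>_def)
  ultimately show ?thesis using that[OF \<kappa>0 lt le] True by (simp add: decay_rate_def)
next
  case False
  then show ?thesis using that[of "1 - a"] a by (simp add: decay_rate_def)
qed

text \<open>The upper bound is first obtained for the enlarged threshold
  \<open>a + \<epsilon>\<close>; this limit removes the enlargement.\<close>

lemma decay_rate_right_continuous: "((\<lambda>s. decay_rate (a + s)) \<longlongrightarrow> decay_rate a) (at_right 0)"
proof (cases "a < 1 / 2")
  case True
  have "((\<lambda>s. 2 * sqrt (2 * (1 - (a + s))) - 2 + (a + s)) \<longlongrightarrow> 2 * sqrt (2 * (1 - (a + 0))) - 2 + (a + 0)) (at_right 0)"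
    by (intro tendsto_intros)
  moreover have "\<forall>\<^sub>F s in at_right 0. 2 * sqrt (2 * (1 - (a + s))) - 2 + (a + s) = decay_rate (a + s)"
    using eventually_at_right_less[of 0] eventually_at_right_real[of 0 "1 / 2 - a"] True
    by (auto elim!: eventually_mono simp: decay_rate_def)
  ultimately show ?thesis
    using True by (auto simp: decay_rate_def[of a] intro: Lim_transform_eventually)
next
  case False
  have "((\<lambda>s. 1 - (a + s)) \<longlongrightarrow> 1 - (a + 0)) (at_right 0)" by (intro tendsto_intros)
  moreover have "\<forall>\<^sub>F s in at_right 0. 1 - (a + s) = decay_rate (a + s)"
    using eventually_at_right_less[of 0] False by (auto elim!: eventually_mono simp: decay_rate_def)
  ultimately show ?thesis
    using False by (auto simp: decay_rate_def[of a] intro: Lim_transform_eventually)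
qed

text \<open>One parameter \<epsilon> controls three losses at once: the enlargement of
  \<open>a\<close>, the level below which \<phi> counts as small, and the factor given up in the
  Gaussian tail. The horizon in \<open>solution_gronwall\<close> is the whole of \<open>t\<close>,
  so the exit estimate is checked for every lag \<open>s\<close> and the worst lag yields
  \<open>decay_rate\<close>.\<close>

lemma kpp_upper_asymptotics:
  fixes c :: "'v::euclidean_space"
  assumes \<beta>: "0 < \<beta>" and R: "0 < R" and a: "0 \<le> a" "a < 1" and e: "0 < e"
  shows "\<forall>\<^sub>F t in at_top. \<forall>f \<phi>. kpp_solution \<beta> f \<phi> \<longrightarrow>
    (\<forall>y\<in>ball c R. exp (- \<beta> * a * t) / 2 \<le> 1 - f y) \<longrightarrow> \<phi> t 0 \<le> exp (- (\<beta> * decay_rate a - e) * t)"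
proof -
  have "((\<lambda>s. (1 - s) * \<beta> * decay_rate (a + s) - 2 * \<beta> * s) \<longlongrightarrow> (1 - 0) * \<beta> * decay_rate a - 2 * \<beta> * 0) (at_right 0)"
    by (intro tendsto_intros decay_rate_right_continuous)
  then have "\<forall>\<^sub>F s in at_right 0. \<beta> * decay_rate a - e / 2 < (1 - s) * \<beta> * decay_rate (a + s) - 2 * \<beta> * s"
    using e by (intro order_tendstoD) auto
  moreover have "\<forall>\<^sub>F s in at_right 0. s \<in> {0<..<1 - a}"
    using a by (intro eventually_at_right_real) auto
  ultimately have "\<forall>\<^sub>F s in at_right 0. s \<in> {0<..<1 - a} \<and>
      \<beta> * decay_rate a - e / 2 < (1 - s) * \<beta> * decay_rate (a + s) - 2 * \<beta> * s"
    by eventually_elim simp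
  then obtain \<epsilon> where \<epsilon>: "0 < \<epsilon>" "\<epsilon> < 1 - a"
      and rate: "\<beta> * decay_rate a - e / 2 < (1 - \<epsilon>) * \<beta> * decay_rate (a + \<epsilon>) - 2 * \<beta> * \<epsilon>"
    using eventually_happens'[OF trivial_limit_at_right_real] by auto
  have \<epsilon>1: "\<epsilon> < 1" using \<epsilon> a by simp
  define a' where "a' = a + \<epsilon>"
  have a': "0 < a'" "a' < 1" using a \<epsilon> by (auto simp: a'_def)
  define I where "I = decay_rate a'"
  have I: "I \<le> 1 - a'" "I \<le> 1" using decay_rate_le[of a'] a' by (auto simp: I_def)
  define C where "C = (1 / sqrt \<epsilon>) ^ DIM('v)"
  have C1: "1 \<le> C" unfolding C_def using \<epsilon> \<epsilon>1 by (intro one_le_power) auto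
  obtain T where T: "\<And>t f \<phi> \<tau> (x::'v). T \<le> t \<Longrightarrow> kpp_solution \<beta> f \<phi> \<Longrightarrow>
      (\<forall>y\<in>ball c R. exp (- \<beta> * a * t) / 2 \<le> 1 - f y) \<Longrightarrow>
      0 < \<tau> \<Longrightarrow> \<tau> \<le> t \<Longrightarrow> (\<beta> * a + \<beta> * \<epsilon>) * t \<le> \<beta> * \<tau> - (norm x)\<^sup>2 / (2 * \<tau>) \<Longrightarrow> \<phi> \<tau> x \<le> \<epsilon>"
    using kpp_decay[OF \<beta> R mult_pos_pos[OF \<beta> \<epsilon>(1)] a(1) \<epsilon>(1), of c] by metis
  have "\<forall>\<^sub>F t in at_top. 2 * C * (1 + \<beta> * t) \<le> exp (e / 2 * t)" using e \<beta> by real_asymp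
  moreover have "\<forall>\<^sub>F t in at_top. max T 1 \<le> t" by (rule eventually_ge_at_top)
  ultimately show ?thesis
  proof (eventually_elim, safe)
    fix t f and \<phi> :: "real \<Rightarrow> 'v \<Rightarrow> real"
    assume poly: "2 * C * (1 + \<beta> * t) \<le> exp (e / 2 * t)" and t: "max T 1 \<le> t"
      and sol: "kpp_solution \<beta> f \<phi>" and init: "\<forall>y\<in>ball c R. exp (- \<beta> * a * t) / 2 \<le> 1 - f y"
    interpret kpp_solution \<beta> f \<phi> by fact
    have t1: "1 \<le> t" "T \<le> t" using t by auto
    have eq': "(\<beta> * a + \<beta> * \<epsilon>) * t = \<beta> * (a' * t)" by (simp add: a'_def algebra_simps)
    define k where "k = C * exp (- ((1 - \<epsilon>) * \<beta> * I * t))"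
    \<comment> \<open>The condition \<open>s < t\<close> keeps the remaining time positive, as
      \<open>T\<close> requires.\<close>
    let ?D = "\<lambda>s. {y::'v. s < t \<and> \<beta> * (a' * t) \<le> \<beta> * (t - s) - (norm y)\<^sup>2 / (2 * (t - s))}"
    \<comment> \<open>With \<open>q = \<epsilon>\<close> and
      \<open>b = 2 * \<beta> * \<epsilon>\<close> the denominator is 1/2, and the weight costs only
      \<open>exp (2 * \<beta> * \<epsilon> * t)\<close>.\<close>
    have "\<phi> t 0 \<le> exp (2 * \<beta> * \<epsilon> * t) * (exp (- \<beta> * t) + \<beta> * k * t) / (1 - \<beta> * \<epsilon> / (2 * \<beta> * \<epsilon>))"
    proof (rule solution_gronwall[where D="?D"])
      show "?D s \<in> sets borel" for s by measurable
      show "\<beta> * \<epsilon> < 2 * \<beta> * \<epsilon>" "0 \<le> k" using \<beta> \<epsilon> C1 by (auto simp: k_def)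
      show "\<phi> (t - s) y \<le> \<epsilon>" if "0 \<le> s" "s \<le> t" "y \<in> ?D s" for s y
        by (rule T[OF t1(2) sol init]) (use that eq' in auto)
    next
      fix s assume s: "0 \<le> s" "s \<le> t"
      show "exp (- \<beta> * s) * heat s (indicator (- ?D s)) 0 \<le> k"
      proof (cases "s = 0")
        case True
        have "a' * t \<le> t" using a' t1 by simp
        then have "0 \<in> ?D 0" using t1 \<beta> by simp
        then show ?thesis using True C1 by (simp add: heat_0 k_def)
      next
        case False
        with s have s0: "0 < s" by simp
        have hb: "heat s (indicator (- ?D s)) 0 \<le> (1::real)"
          by (rule heat_le[of _ 1]) (auto simp: indicator_def intro!: borel_measurable_indicator)
        show ?thesis
        \<comment> \<open>Once \<open>s\<close> exceeds \<open>(1 - a') * t\<close> the region is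
          empty, and survival without branching up to \<open>s\<close> must pay alone; this is where
          \<open>I \<le> 1 - a'\<close> enters.\<close>
        proof (cases "s \<le> (1 - a') * t")
          case False
          have "(1 - \<epsilon>) * (\<beta> * (I * t)) \<le> 1 * (\<beta> * s)"
          proof -
            have "I * t \<le> (1 - a') * t" using I t1 by (intro mult_right_mono) auto
            then have "\<beta> * (I * t) \<le> \<beta> * s" using False \<beta> by (intro mult_left_mono) auto
            then have "(1 - \<epsilon>) * (\<beta> * (I * t)) \<le> (1 - \<epsilon>) * (\<beta> * s)"
              by (rule mult_left_mono) (use \<epsilon>1 in simp)
            also have "\<dots> \<le> 1 * (\<beta> * s)" using \<epsilon> \<beta> s by (intro mult_right_mono) auto
            finally show ?thesis .
          qed
          then have "exp (- \<beta> * s) \<le> exp (- ((1 - \<epsilon>) * \<beta> * I * t))" by (simp add: mult.assoc)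
          then have "exp (- \<beta> * s) * heat s (indicator (- ?D s)) 0 \<le> exp (- ((1 - \<epsilon>) * \<beta> * I * t)) * C"
            using hb C1 by (intro mult_mono heat_nonneg) auto
          then show ?thesis by (simp add: k_def mult.commute)
        next
          case True
          have st: "s < t"
          proof -
            have "0 < a' * t" using a' t1 by simp
            then show ?thesis using True by (simp add: algebra_simps)
          qed
          have gap: "0 \<le> t - s - a' * t" using True by (simp add: algebra_simps)
          \<comment> \<open>Radius of the region at lag \<open>s\<close>, the solution of
            \<open>\<beta> * (t - s) - \<rho>\<^sup>2 / (2 * (t - s)) = \<beta> * (a' *
            t)\<close>.\<close>
          define \<rho> where "\<rho> = sqrt (2 * (t - s) * (\<beta> * (t - s - a' * t)))"
          have \<rho>: "0 \<le> \<rho>" "\<rho>\<^sup>2 = 2 * (t - s) * (\<beta> * (t - s - a' * t))"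
            using gap st \<beta> by (auto simp: \<rho>_def)
          have "- ?D s \<subseteq> {y. \<rho> < norm (y - 0)}"
          proof (rule subsetI)
            fix y assume "y \<in> - ?D s"
            then have "\<beta> * (t - s) - (norm y)\<^sup>2 / (2 * (t - s)) < \<beta> * (a' * t)" using st by auto
            then have "\<beta> * (t - s - a' * t) < (norm y)\<^sup>2 / (2 * (t - s))" by (simp add: right_diff_distrib)
            then have "\<rho>\<^sup>2 < (norm y)\<^sup>2"
              unfolding \<rho>(2) using st by (simp add: pos_less_divide_eq mult_ac)
            then show "y \<in> {y. \<rho> < norm (y - 0)}" by (simp add: power2_less_imp_less)
          qed
          then have "heat s (indicator (- ?D s)) 0 \<le> heat s (indicator {y::'v. \<rho> < norm (y - 0)}) 0"
            by (intro heat_mono[of _ _ 1 1]) (auto simp: indicator_def intro!: borel_measurable_indicator)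
          also have "\<dots> \<le> C * exp (- (1 - \<epsilon>) * (max 0 \<rho>)\<^sup>2 / (2 * s))"
            unfolding C_def by (rule heat_tail[OF \<epsilon>(1) \<epsilon>1 s0])
          also have "max 0 \<rho> = \<rho>" using \<rho> by simp
          finally have "exp (- \<beta> * s) * heat s (indicator (- ?D s)) 0 \<le> exp (- \<beta> * s) * (C * exp (- (1 - \<epsilon>) * \<rho>\<^sup>2 / (2 * s)))"
            by (intro mult_left_mono) auto
          also have "\<dots> = C * exp (- (\<beta> * s + (1 - \<epsilon>) * \<rho>\<^sup>2 / (2 * s)))"
          proof -
            have "exp (- \<beta> * s) * exp (- (1 - \<epsilon>) * \<rho>\<^sup>2 / (2 * s)) = exp (- (\<beta> * s + (1 - \<epsilon>) * \<rho>\<^sup>2 / (2 * s)))"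
              by (simp only: exp_add[symmetric] mult_minus_left minus_divide_left minus_add_distrib)
            then show ?thesis by (simp only: mult.left_commute[of _ C])
          qed
          also have "\<dots> \<le> k"
          proof -
            \<comment> \<open>In terms of the proportion \<open>s / t\<close> the exponent is, up to
              the factor \<open>1 - \<epsilon>\<close>, the product of \<beta>, \<open>t\<close> and
              the cost function.\<close>
            define \<kappa> where "\<kappa> = s / t"
            have \<kappa>: "0 < \<kappa>" "\<kappa> \<le> 1 - a'" "s = \<kappa> * t"
              using s0 t1 True by (auto simp: \<kappa>_def pos_divide_le_eq)
            have "\<rho>\<^sup>2 / (2 * s) = \<beta> * (t * ((1 - \<kappa>) * (1 - \<kappa> - a') / \<kappa>))"
              unfolding \<rho>(2) \<kappa>(3) using \<kappa>(1) t1 by (simp add: field_simps)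
            then have "(1 - \<epsilon>) * (\<beta> * s) + (1 - \<epsilon>) * (\<rho>\<^sup>2 / (2 * s))
                = (1 - \<epsilon>) * \<beta> * (t * (\<kappa> + (1 - \<kappa>) * (1 - \<kappa> - a') / \<kappa>))"
              unfolding \<kappa>(3) by (simp add: distrib_left mult_ac)
            moreover have "(1 - \<epsilon>) * \<beta> * (t * I) \<le> (1 - \<epsilon>) * \<beta> * (t * (\<kappa> + (1 - \<kappa>) * (1 - \<kappa> - a') / \<kappa>))"
              unfolding I_def using decay_rate_le_cost[OF a'(2) \<kappa>(1,2)] \<epsilon>1 \<beta> t1
              by (intro mult_left_mono) auto
            moreover have "(1 - \<epsilon>) * (\<beta> * s) \<le> 1 * (\<beta> * s)"
              using \<epsilon> \<beta> s by (intro mult_right_mono) auto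
            ultimately have "(1 - \<epsilon>) * \<beta> * I * t \<le> \<beta> * s + (1 - \<epsilon>) * \<rho>\<^sup>2 / (2 * s)"
              by (simp add: mult_ac)
            then show ?thesis unfolding k_def using C1 by (intro mult_left_mono) auto
          qed
          finally show ?thesis .
        qed
      qed
    qed (use t1 \<epsilon> in auto)
    also have "1 - \<beta> * \<epsilon> / (2 * \<beta> * \<epsilon>) = 1 / 2" using \<beta> \<epsilon> by simp
    finally have "\<phi> t 0 \<le> 2 * (exp (2 * \<beta> * \<epsilon> * t) * (exp (- \<beta> * t) + \<beta> * k * t))" by simp
    also have "\<dots> \<le> 2 * (exp (2 * \<beta> * \<epsilon> * t) * (k + \<beta> * k * t))"
    proof -
      have "(1 - \<epsilon>) * \<beta> * I * t \<le> \<beta> * t"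
      proof -
        have "(1 - \<epsilon>) * I \<le> 1"
        proof (cases "0 \<le> I")
          case True then show ?thesis using I \<epsilon> \<epsilon>1 by (intro mult_le_one) auto
        next
          case False then have "(1 - \<epsilon>) * I \<le> 0" using \<epsilon>1 by (simp add: mult_nonneg_nonpos)
          then show ?thesis by simp
        qed
        then have "(1 - \<epsilon>) * I * (\<beta> * t) \<le> 1 * (\<beta> * t)" using \<beta> t1 by (intro mult_right_mono) auto
        then show ?thesis by (simp add: mult_ac)
      qed
      then have "1 * exp (- \<beta> * t) \<le> k" unfolding k_def using C1 by (intro mult_mono) auto
      then show ?thesis by simp
    qed
    also have "\<dots> = 2 * C * (1 + \<beta> * t) * exp (- ((1 - \<epsilon>) * \<beta> * I * t) + 2 * \<beta> * \<epsilon> * t)"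
      unfolding k_def exp_add by (simp add: algebra_simps)
    also have "\<dots> \<le> exp (e / 2 * t) * exp (- (\<beta> * decay_rate a - e / 2) * t)"
    proof (intro mult_mono poly)
      have "(\<beta> * decay_rate a - e / 2) * t \<le> ((1 - \<epsilon>) * \<beta> * I - 2 * \<beta> * \<epsilon>) * t"
        using rate t1 unfolding I_def a'_def by (intro mult_right_mono) auto
      then show "exp (- ((1 - \<epsilon>) * \<beta> * I * t) + 2 * \<beta> * \<epsilon> * t) \<le> exp (- (\<beta> * decay_rate a - e / 2) * t)"
        by (simp add: left_diff_distrib)
    qed auto
    also have "\<dots> = exp (- (\<beta> * decay_rate a - e) * t)"
      by (subst exp_add[symmetric]) (simp add: algebra_simps)
    finally show "\<phi> t 0 \<le> exp (- (\<beta> * decay_rate a - e) * t)" .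
  qed
qed

text \<open>The first moment must fall below the threshold with room to spare, so the particle is
  sent slightly beyond the edge of the region, to distance \<open>\<rho> * t\<close> with \<rho>
  above \<open>\<rho>0\<close>. The rate \<gamma> gained there absorbs the factor
  \<open>t\<^sup>2\<close> of the datum, and by continuity the extra distance costs less than
  \<open>e / 2\<close>.\<close>

lemma kpp_lower_asymptotics:
  fixes c :: "'v::euclidean_space"
  assumes \<beta>: "0 < \<beta>" and R: "0 < R" and a: "0 \<le> a" "a < 1" and e: "0 < e"
  shows "\<forall>\<^sub>F t in at_top. \<forall>f \<phi>. kpp_solution \<beta> f \<phi> \<longrightarrow>
    (\<forall>y. 1 - f y \<le> t\<^sup>2 * exp (- \<beta> * a * t) * indicator (ball c R) y) \<longrightarrow>
    exp (- (\<beta> * decay_rate a + e) * t) \<le> \<phi> t 0"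
proof -
  obtain \<kappa> where \<kappa>: "0 < \<kappa>" "\<kappa> < 1" "\<kappa> \<le> 1 - a"
    and rate: "decay_rate a = \<kappa> + (1 - \<kappa>) * (1 - \<kappa> - a) / \<kappa>"
    using decay_rate_attained[OF a] .
  \<comment> \<open>At time \<open>\<kappa> * t\<close> the region has radius
    \<open>\<rho>0 * t\<close>, since \<open>\<rho>0\<^sup>2 / (2 * (1 - \<kappa>)) = \<beta> * (1 -
    \<kappa> - a)\<close>.\<close>
  define \<rho>0 where "\<rho>0 = sqrt (2 * \<beta> * (1 - \<kappa>) * (1 - \<kappa> - a))"
  have \<rho>0: "0 \<le> \<rho>0" "\<rho>0\<^sup>2 = 2 * \<beta> * (1 - \<kappa>) * (1 - \<kappa> - a)" using \<beta> \<kappa> by (auto simp: \<rho>0_def)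
  have cost0: "\<beta> * \<kappa> + \<rho>0\<^sup>2 / (2 * \<kappa>) = \<beta> * decay_rate a"
    unfolding \<rho>0(2) rate using \<kappa> by (simp add: field_simps)
  have "((\<lambda>s. \<beta> * \<kappa> + (\<rho>0 + s)\<^sup>2 / (2 * \<kappa>)) \<longlongrightarrow> \<beta> * \<kappa> + (\<rho>0 + 0)\<^sup>2 / (2 * \<kappa>)) (at_right 0)"
    using \<kappa> by (intro tendsto_intros) auto
  then have "\<forall>\<^sub>F s in at_right 0. \<beta> * \<kappa> + (\<rho>0 + s)\<^sup>2 / (2 * \<kappa>) < \<beta> * decay_rate a + e / 2"
    using e cost0 by (intro order_tendstoD) auto
  then have "\<forall>\<^sub>F s in at_right 0. 0 < s \<and> \<beta> * \<kappa> + (\<rho>0 + s)\<^sup>2 / (2 * \<kappa>) < \<beta> * decay_rate a + e / 2"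
    using eventually_at_right_less[of 0] by (auto elim: eventually_elim2)
  then obtain s0 where s0: "0 < s0" "\<beta> * \<kappa> + (\<rho>0 + s0)\<^sup>2 / (2 * \<kappa>) < \<beta> * decay_rate a + e / 2"
    using eventually_happens'[OF trivial_limit_at_right_real] by auto
  define \<rho> where "\<rho> = \<rho>0 + s0"
  have \<rho>: "0 < \<rho>" "\<rho>0\<^sup>2 < \<rho>\<^sup>2" "\<beta> * \<kappa> + \<rho>\<^sup>2 / (2 * \<kappa>) < \<beta> * decay_rate a + e / 2"
  proof -
    show "\<rho>0\<^sup>2 < \<rho>\<^sup>2" unfolding \<rho>_def by (rule power_strict_mono) (use \<rho>0(1) s0 in auto)
  qed (use \<rho>0(1) s0 in \<open>auto simp: \<rho>_def\<close>)
  have gap0: "\<beta> * (1 - \<kappa> - a) < \<rho>\<^sup>2 / (2 * (1 - \<kappa>))"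
    using \<rho>(2) \<kappa> unfolding \<rho>0(2) by (simp add: pos_less_divide_eq mult_ac)
  have "((\<lambda>s. (1 - s) * \<rho>\<^sup>2 / (2 * (1 - \<kappa>))) \<longlongrightarrow> (1 - 0) * \<rho>\<^sup>2 / (2 * (1 - \<kappa>))) (at_right 0)"
    using \<kappa> by (intro tendsto_intros) auto
  then have "\<forall>\<^sub>F s in at_right 0. \<beta> * (1 - \<kappa> - a) < (1 - s) * \<rho>\<^sup>2 / (2 * (1 - \<kappa>))"
    using gap0 by (intro order_tendstoD) auto
  then have "\<forall>\<^sub>F s in at_right 0. s \<in> {0<..<1} \<and> \<beta> * (1 - \<kappa> - a) < (1 - s) * \<rho>\<^sup>2 / (2 * (1 - \<kappa>))"
    using eventually_at_right_real[of 0 1] by (auto elim: eventually_elim2)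
  then obtain \<epsilon> where \<epsilon>: "0 < \<epsilon>" "\<epsilon> < 1" and gap: "\<beta> * (1 - \<kappa> - a) < (1 - \<epsilon>) * \<rho>\<^sup>2 / (2 * (1 - \<kappa>))"
    using eventually_happens'[OF trivial_limit_at_right_real] by auto
  define \<gamma> where "\<gamma> = (1 - \<epsilon>) * \<rho>\<^sup>2 / (2 * (1 - \<kappa>)) - \<beta> * (1 - \<kappa> - a)"
  have \<gamma>: "0 < \<gamma>" using gap by (simp add: \<gamma>_def)
  define m where "m = norm c + R"
  have m0: "0 < m" using R by (simp add: m_def add_nonneg_pos)
  \<comment> \<open>Contribution of the cross term of \<open>(\<rho> * t - m)\<^sup>2\<close>
    divided by \<open>2 * (1 - \<kappa>) * t\<close>. It is constant in \<open>t\<close>, so centre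
    and radius of the ball are invisible on the exponential scale.\<close>
  define K where "K = (1 - \<epsilon>) * \<rho> * m / (1 - \<kappa>)"
  define C where "C = (1 / sqrt \<epsilon>) ^ DIM('v)"
  have C0: "0 < C" using \<epsilon> by (simp add: C_def)
  define vol where "vol = measure lborel (ball (0::'v) 1)"
  have vol: "0 < vol" unfolding vol_def using content_ball_pos[of 1 "0::'v"] by simp
  have "((\<lambda>t. t\<^sup>2 * C * exp K * exp (- \<gamma> * t)) \<longlongrightarrow> 0) at_top" using \<gamma> by real_asymp
  then have "\<forall>\<^sub>F t in at_top. t\<^sup>2 * C * exp K * exp (- \<gamma> * t) < 1 / 2"
    by (intro order_tendstoD) auto
  moreover have "\<forall>\<^sub>F t in at_top. DIM('v) / 2 * ln (2 * pi * (\<kappa> * t)) + 2 * \<rho> / \<kappa> + 2 / \<kappa> - ln (vol / 2) \<le> e / 2 * t"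
    using \<kappa> e by real_asymp
  moreover have "\<forall>\<^sub>F t in at_top. max 1 (m / \<rho>) \<le> t" by (rule eventually_ge_at_top)
  ultimately show ?thesis
  proof (eventually_elim, safe)
    fix t f and \<phi> :: "real \<Rightarrow> 'v \<Rightarrow> real"
    assume small: "t\<^sup>2 * C * exp K * exp (- \<gamma> * t) < 1 / 2"
      and ln_le: "DIM('v) / 2 * ln (2 * pi * (\<kappa> * t)) + 2 * \<rho> / \<kappa> + 2 / \<kappa> - ln (vol / 2) \<le> e / 2 * t"
      and t: "max 1 (m / \<rho>) \<le> t"
      and sol: "kpp_solution \<beta> f \<phi>"
      and init: "\<forall>y. 1 - f y \<le> t\<^sup>2 * exp (- \<beta> * a * t) * indicator (ball c R) y"
    interpret kpp_solution \<beta> f \<phi> by fact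
    have t1: "1 \<le> t" "m \<le> \<rho> * t" using t \<rho> by (auto simp: pos_divide_le_eq mult.commute)
    define s where "s = \<kappa> * t"
    have s: "0 < s" "s < t" using \<kappa> t1 by (auto simp: s_def)
    have ts: "t - s = (1 - \<kappa>) * t" by (simp add: s_def algebra_simps)
    \<comment> \<open>Beyond distance \<open>\<rho> * t\<close> the first moment bound leaves a
      deficit of at most 1/2; a constant lower bound on \<phi> is all that the exponential scale
      sees.\<close>
    have far: "1 / 2 \<le> \<phi> (t - s) y" if y: "\<rho> * t \<le> norm y" for y
    proof -
      have "1 - \<phi> (t - s) y \<le> exp (\<beta> * (t - s)) * heat (t - s) (\<lambda>z. 1 - f z) y"
        by (rule deficit_upper) (use s in simp)
      also have "heat (t - s) (\<lambda>z. 1 - f z) y \<le> heat (t - s) (\<lambda>z. t\<^sup>2 * exp (- \<beta> * a * t) * indicator {z. \<rho> * t - m < norm (z - y)} z) y"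
      proof (rule heat_mono[of _ _ 1 "t\<^sup>2 * exp (- \<beta> * a * t)"])
        fix z
        have "indicator (ball c R) z \<le> (indicator {z. \<rho> * t - m < norm (z - y)} z :: real)"
        proof (cases "z \<in> ball c R")
          case True
          then have "norm z < m"
            using norm_triangle_ineq[of c "z - c"] by (simp add: m_def dist_norm norm_minus_commute)
          moreover have "norm y \<le> norm (z - y) + norm z"
            using norm_triangle_ineq4[of z "z - y"] by simp
          ultimately show ?thesis using y by (simp add: indicator_def)
        qed simp
        then have "t\<^sup>2 * exp (- \<beta> * a * t) * indicator (ball c R) z
           \<le> t\<^sup>2 * exp (- \<beta> * a * t) * indicator {z. \<rho> * t - m < norm (z - y)} z"
          by (intro mult_left_mono) auto
        then show "1 - f z \<le> t\<^sup>2 * exp (- \<beta> * a * t) * indicator {z. \<rho> * t - m < norm (z - y)} z"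
          using init by (meson order_trans)
        show "\<bar>1 - f z\<bar> \<le> 1" using initial_bounds[of z] by simp
        show "\<bar>t\<^sup>2 * exp (- \<beta> * a * t) * indicator {z. \<rho> * t - m < norm (z - y)} z\<bar> \<le> t\<^sup>2 * exp (- \<beta> * a * t)"
          by (simp add: indicator_def)
      qed auto
      also have "\<dots> = t\<^sup>2 * exp (- \<beta> * a * t) * heat (t - s) (indicator {z. \<rho> * t - m < norm (z - y)}) y"
        by (simp add: heat_cmult)
      also have "heat (t - s) (indicator {z. \<rho> * t - m < norm (z - y)}) y
          \<le> C * exp (- (1 - \<epsilon>) * (max 0 (\<rho> * t - m))\<^sup>2 / (2 * (t - s)))"
        unfolding C_def by (rule heat_tail) (use \<epsilon> s in auto)
      also have "max 0 (\<rho> * t - m) = \<rho> * t - m" using t1 by simp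
      also have "- (1 - \<epsilon>) * (\<rho> * t - m)\<^sup>2 / (2 * (t - s)) \<le> K - (1 - \<epsilon>) * \<rho>\<^sup>2 / (2 * (1 - \<kappa>)) * t"
      proof -
        have "(\<rho> * t)\<^sup>2 - 2 * (\<rho> * t) * m \<le> (\<rho> * t - m)\<^sup>2" by (simp add: power2_diff)
        then have "(1 - \<epsilon>) * ((\<rho> * t)\<^sup>2 - 2 * (\<rho> * t) * m) / (2 * (t - s)) \<le> (1 - \<epsilon>) * (\<rho> * t - m)\<^sup>2 / (2 * (t - s))"
          using \<epsilon> s by (intro divide_right_mono mult_left_mono) auto
        moreover have "(1 - \<epsilon>) * ((\<rho> * t)\<^sup>2 - 2 * (\<rho> * t) * m) / (2 * (t - s)) = (1 - \<epsilon>) * \<rho>\<^sup>2 / (2 * (1 - \<kappa>)) * t - K"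
        proof -
          have "(1 - \<epsilon>) * ((\<rho> * t)\<^sup>2 - 2 * (\<rho> * t) * m) / (2 * (u * t)) = (1 - \<epsilon>) * \<rho>\<^sup>2 / (2 * u) * t - (1 - \<epsilon>) * \<rho> * m / u"
            if "0 < u" for u using that t1 by (simp add: field_simps power2_eq_square)
          from this[of "1 - \<kappa>"] show ?thesis unfolding ts K_def using \<kappa> by simp
        qed
        moreover have "- (1 - \<epsilon>) * (\<rho> * t - m)\<^sup>2 / (2 * (t - s)) = - ((1 - \<epsilon>) * (\<rho> * t - m)\<^sup>2 / (2 * (t - s)))"
          by (simp only: mult_minus_left minus_divide_left)
        ultimately show ?thesis by linarith
      qed
      finally have "1 - \<phi> (t - s) y \<le> exp (\<beta> * (t - s)) * (t\<^sup>2 * exp (- \<beta> * a * t) * (C * exp (K - (1 - \<epsilon>) * \<rho>\<^sup>2 / (2 * (1 - \<kappa>)) * t)))"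
        using C0 by (simp add: mult_left_mono)
      also have "\<dots> = t\<^sup>2 * C * (exp (\<beta> * (t - s)) * exp (- \<beta> * a * t) * exp (K - (1 - \<epsilon>) * \<rho>\<^sup>2 / (2 * (1 - \<kappa>)) * t))"
        by simp
      also have "exp (\<beta> * (t - s)) * exp (- \<beta> * a * t) * exp (K - (1 - \<epsilon>) * \<rho>\<^sup>2 / (2 * (1 - \<kappa>)) * t) = exp K * exp (- \<gamma> * t)"
        unfolding ts by (simp only: exp_add[symmetric]) (simp add: \<gamma>_def algebra_simps)
      finally show ?thesis using small by (simp add: mult.assoc)
    qed
    obtain b :: 'v where b: "b \<in> Basis" using nonempty_Basis by blast
    \<comment> \<open>Radius 1 and a centre at distance \<open>\<rho> * t + 1\<close> place the
      whole ball beyond \<open>\<rho> * t\<close>; its points are within distance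
      \<open>\<rho> * t + 2\<close> of the origin, hence the exponent below.\<close>
    let ?y = "(\<rho> * t + 1) *\<^sub>R b"
    have ny: "norm ?y = \<rho> * t + 1" using b \<rho> t1 by simp
    have "(1 / sqrt (2 * pi * s)) ^ DIM('v) * exp (- (\<rho> * t + 2)\<^sup>2 / (2 * s)) * vol \<le> heat s (indicator (ball ?y 1)) 0"
      unfolding vol_def by (rule heat_ball_lower) (use s ny in auto)
    also have "\<dots> \<le> heat s (\<lambda>z. 2 * \<phi> (t - s) z) 0"
    proof (rule heat_mono[of _ _ 1 2])
      fix z
      show "indicator (ball ?y 1) z \<le> 2 * \<phi> (t - s) z"
      proof (cases "z \<in> ball ?y 1")
        case True
        then have "\<rho> * t \<le> norm z"
          using norm_triangle_ineq[of z "?y - z"] ny by (simp add: dist_norm)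
        then show ?thesis using far[of z] by (simp add: indicator_def)
      next
        case False
        then show ?thesis using solution_bounds(1)[of "t - s" z] by simp
      qed
      show "\<bar>2 * \<phi> (t - s) z\<bar> \<le> 2" using abs_bounds(1)[of "t - s" z] by simp
    qed (auto simp: indicator_def intro!: borel_measurable_indicator)
    finally have hl: "vol / 2 * (1 / sqrt (2 * pi * s)) ^ DIM('v) * exp (- (\<rho> * t + 2)\<^sup>2 / (2 * s)) \<le> heat s (\<phi> (t - s)) 0"
      by (simp add: heat_cmult mult_ac)
    have "exp (- (\<beta> * decay_rate a + e) * t) \<le> exp (- \<beta> * s) * (vol / 2 * (1 / sqrt (2 * pi * s)) ^ DIM('v) * exp (- (\<rho> * t + 2)\<^sup>2 / (2 * s)))"
    proof -
      have sq: "(\<rho> * t + 2)\<^sup>2 / (2 * s) \<le> \<rho>\<^sup>2 / (2 * \<kappa>) * t + 2 * \<rho> / \<kappa> + 2 / \<kappa>"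
      proof -
        have "(\<rho> * t + 2)\<^sup>2 / (2 * s) = \<rho>\<^sup>2 / (2 * \<kappa>) * t + 2 * \<rho> / \<kappa> + 2 / (\<kappa> * t)"
          unfolding s_def using \<kappa> t1 by (simp add: field_simps power2_eq_square)
        moreover have "2 / (\<kappa> * t) \<le> 2 / (\<kappa> * 1)"
          using \<kappa> t1 by (intro divide_left_mono mult_left_mono) auto
        ultimately show ?thesis by simp
      qed
      have "(\<beta> * \<kappa> + \<rho>\<^sup>2 / (2 * \<kappa>)) * t \<le> (\<beta> * decay_rate a + e / 2) * t"
        using \<rho>(3) t1 by (intro mult_right_mono) auto
      then have "- (\<beta> * decay_rate a + e) * t \<le> - \<beta> * s + ln (vol / 2) + - (DIM('v) / 2 * ln (2 * pi * s)) + - (\<rho> * t + 2)\<^sup>2 / (2 * s)"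
        using sq ln_le unfolding s_def by (simp add: distrib_right left_diff_distrib)
      then have "exp (- (\<beta> * decay_rate a + e) * t) \<le> exp (- \<beta> * s + ln (vol / 2) + - (DIM('v) / 2 * ln (2 * pi * s)) + - (\<rho> * t + 2)\<^sup>2 / (2 * s))"
        by simp
      also have "\<dots> = exp (- \<beta> * s) * (vol / 2) * (1 / sqrt (2 * pi * s)) ^ DIM('v) * exp (- (\<rho> * t + 2)\<^sup>2 / (2 * s))"
        unfolding exp_add gauss_normalization_eq_exp[OF s(1)] using vol by simp
      finally show ?thesis by (simp only: mult.assoc)
    qed
    also have "\<dots> \<le> exp (- \<beta> * s) * heat s (\<phi> (t - s)) 0" by (intro mult_left_mono hl) auto
    also have "\<dots> \<le> \<phi> t 0"
    proof -
      \<comment> \<open>Dropping the Duhamel term keeps only the event that the initial particle has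
        not branched by time \<open>s\<close>.\<close>
      have "0 \<le> duhamel \<beta> s (\<lambda>r. heat r (\<lambda>y. (\<phi> (t - r) y)\<^sup>2) 0)"
        using \<beta> by (intro duhamel_nonneg heat_nonneg) auto
      then show ?thesis using solution_shift[of s t 0] s by simp
    qed
    finally show "exp (- (\<beta> * decay_rate a + e) * t) \<le> \<phi> t 0" .
  qed
qed

section \<open>First branching and the KPP equation\<close>

lemma (in standard_brownian_motion) distr_motion:
  assumes "0 \<le> s"
  shows "distr M borel (W s) = distr gauss borel (\<lambda>z. sqrt s *\<^sub>R z)"
\<comment> \<open>Time 0 has no density and is settled by \<open>start\<close>;
  \<open>gaussian_increments\<close> covers the rest.\<close>
proof (cases "s = 0")
  case True
  have "distr M borel (W s) = distr M borel (\<lambda>_. 0)" using start True by (intro distr_cong) auto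
  also have "\<dots> = return borel 0" by (rule distr_const) simp
  also have "\<dots> = distr gauss borel (\<lambda>z. sqrt s *\<^sub>R z)" using True by (simp add: gauss.distr_const)
  finally show ?thesis .
next
  case False
  then have s: "0 < s" using assms by simp
  have "distr M borel (W s) = distr M lborel (\<lambda>\<omega>. W s \<omega> - W 0 \<omega>)"
    using start by (intro distr_cong) auto
  also have "\<dots> = density lborel (\<lambda>x. ennreal (gauss_density s x))"
    using gaussian_increments[of 0 s] s
    by (simp add: distributed_distr_eq_density gauss_density_def)
  finally show ?thesis by (simp add: distr_gauss_scale[OF s])
qed

lemma (in standard_brownian_motion) expectation_motion:
  fixes g :: "'v \<Rightarrow> real"
  assumes [measurable]: "g \<in> borel_measurable borel" and s: "0 \<le> s"
  shows "(\<integral>\<omega>. g (x + W s \<omega>) \<partial>M) = heat s g x"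
proof -
  have [measurable]: "W s \<in> borel_measurable M" using rv s by simp
  have "(\<integral>\<omega>. g (x + W s \<omega>) \<partial>M) = (\<integral>y. g (x + y) \<partial>distr M borel (W s))"
    by (subst integral_distr) auto
  also have "\<dots> = heat s g x" unfolding distr_motion[OF s] heat_def by (subst integral_distr) auto
  finally show ?thesis .
qed

text \<open>Time is rounded down to the grid of mesh \<open>1 / (n + 1)\<close>: each approximation
  uses countably many times and is measurable piece by piece, and path continuity passes to the
  limit. Clipping at 0 is due to the hypotheses speaking of nonnegative times only.\<close>

lemma continuous_path_evaluation_measurable:
  fixes W :: "real \<Rightarrow> 'w \<Rightarrow> 'v::euclidean_space"
  assumes W: "\<And>t. 0 \<le> t \<Longrightarrow> W t \<in> borel_measurable N"
    and cont: "\<And>\<omega>. \<omega> \<in> space N \<Longrightarrow> continuous_on {0..} (\<lambda>t. W t \<omega>)"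
  shows "(\<lambda>p. W (max 0 (fst p)) (snd p)) \<in> borel_measurable (borel \<Otimes>\<^sub>M N)"
proof -
  define k where "k n s = nat \<lfloor>max 0 s * (real n + 1)\<rfloor>" for n :: nat and s :: real
  define a where "a n s = real (k n s) / (real n + 1)" for n s
  have a_nonneg: "0 \<le> a n s" for n s by (simp add: a_def)
  have a_lim: "(\<lambda>n. a n s) \<longlonglongrightarrow> max 0 s" for s
  proof (rule tendsto_sandwich[where f="\<lambda>n. max 0 s - 1 / (real n + 1)" and h="\<lambda>_. max 0 s"])
    have k: "real (k n s) \<le> max 0 s * (real n + 1)" "max 0 s * (real n + 1) < real (k n s) + 1" for n
      unfolding k_def by (simp_all add: of_nat_floor)
    show "\<forall>\<^sub>F n in sequentially. a n s \<le> max 0 s" using k(1) by (simp add: a_def divide_le_eq)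
    show "\<forall>\<^sub>F n in sequentially. max 0 s - 1 / (real n + 1) \<le> a n s"
    proof (intro always_eventually allI)
      fix n
      have "max 0 s - 1 / (real n + 1) = (max 0 s * (real n + 1) - 1) / (real n + 1)"
        by (simp add: diff_divide_distrib)
      also have "\<dots> \<le> a n s" unfolding a_def using k(2)[of n] by (intro divide_right_mono) auto
      finally show "max 0 s - 1 / (real n + 1) \<le> a n s" .
    qed
    show "(\<lambda>n. max 0 s - 1 / (real n + 1)) \<longlonglongrightarrow> max 0 s"
      using tendsto_diff[OF tendsto_const[of "max 0 s"] LIMSEQ_inverse_real_of_nat]
      by (simp add: inverse_eq_divide add.commute)
  qed simp
  show ?thesis
  proof (rule borel_measurable_LIMSEQ_metric)
    fix n
    have [measurable]: "W (real i / (real n + 1)) \<in> borel_measurable N" for i by (rule W) simp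
    have [measurable]: "(\<lambda>p. k n (fst p)) \<in> measurable (borel \<Otimes>\<^sub>M N) (count_space UNIV)"
      unfolding k_def by measurable
    show "(\<lambda>p. W (a n (fst p)) (snd p)) \<in> borel_measurable (borel \<Otimes>\<^sub>M N)"
      unfolding a_def
      by (rule measurable_compose_countable[where f="\<lambda>i p. W (real i / (real n + 1)) (snd p)"]) measurable
  next
    fix p :: "real \<times> 'w" assume "p \<in> space (borel \<Otimes>\<^sub>M N)"
    then have "snd p \<in> space N" by (auto simp: space_pair_measure)
    from continuous_on_tendsto_compose[OF cont[OF this] a_lim[of "fst p"]]
    show "(\<lambda>n. W (a n (fst p)) (snd p)) \<longlonglongrightarrow> W (max 0 (fst p)) (snd p)" using a_nonneg by simp
  qed
qed

text \<open>Truncation at generation \<open>n\<close> makes this a finite product whatever the size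
  of the population, and it allows induction on \<open>n\<close>. Labels not alive contribute 1, as
  do all generations from \<open>n\<close> on.\<close>

definition tree_product ::
  "(bool list \<Rightarrow> 'w \<Rightarrow> real) \<Rightarrow> (bool list \<Rightarrow> real \<Rightarrow> 'w \<Rightarrow> 'v::euclidean_space) \<Rightarrow>
    ('v \<Rightarrow> real) \<Rightarrow> nat \<Rightarrow> real \<Rightarrow> 'v \<Rightarrow> 'w \<Rightarrow> real" where
  "tree_product \<tau> W f n t x \<omega> =
    (\<Prod>u\<in>{u. length u < n}. if u \<in> alive \<tau> t \<omega> then f (x + position \<tau> W u t \<omega>) else 1)"

lemma finite_labels [simp]: "finite {u::bool list. length u < n}"
  by (rule finite_subset[OF _ finite_lists_length_le[of "UNIV::bool set" n]]) auto

text \<open>Measurability is separated from probability so that \<open>N\<close> may be the full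
  space or a sigma-algebra generated by the labels of subtrees; the latter is what the independence
  arguments require.\<close>

locale branching_paths =
  fixes N :: "'w measure"
    and \<tau> :: "bool list \<Rightarrow> 'w \<Rightarrow> real"
    and W :: "bool list \<Rightarrow> real \<Rightarrow> 'w \<Rightarrow> 'v::euclidean_space"
  assumes lifetime_measurable [measurable]: "\<And>u. \<tau> u \<in> borel_measurable N"
    and lifetime_positive: "\<And>u \<omega>. \<omega> \<in> space N \<Longrightarrow> 0 < \<tau> u \<omega>"
    and motion_measurable: "\<And>u t. 0 \<le> t \<Longrightarrow> W u t \<in> borel_measurable N"
    and motion_continuous: "\<And>u \<omega>. \<omega> \<in> space N \<Longrightarrow> continuous_on {0..} (\<lambda>t. W u t \<omega>)"
begin

lemma evaluation_measurable [measurable (raw)]: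
  assumes [measurable]: "s \<in> borel_measurable K" "w \<in> measurable K N"
  shows "(\<lambda>k. W u (max 0 (s k)) (w k)) \<in> borel_measurable K"
  using measurable_compose[OF measurable_Pair[OF assms]
      continuous_path_evaluation_measurable[of "W u" N, OF motion_measurable motion_continuous]]
  by simp

lemma birth_time_measurable [measurable (raw)]:
  assumes [measurable]: "w \<in> measurable K N"
  shows "(\<lambda>k. birth_time \<tau> u (w k)) \<in> borel_measurable K" unfolding birth_time_def by measurable

lemma birth_place_measurable [measurable (raw)]:
  assumes [measurable]: "w \<in> measurable K N"
  shows "(\<lambda>k. birth_place \<tau> W u (w k)) \<in> borel_measurable K"
proof -
  have "(\<lambda>k. \<Sum>j<length u. W (take j u) (max 0 (\<tau> (take j u) (w k))) (w k)) \<in> borel_measurable K"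
    by measurable
  moreover have "(\<Sum>j<length u. W (take j u) (max 0 (\<tau> (take j u) (w k))) (w k)) = birth_place \<tau> W u (w k)"
    if "k \<in> space K" for k
    using lifetime_positive[OF measurable_space[OF assms that]]
    unfolding birth_place_def by (intro sum.cong refl) (auto simp: max_def less_imp_le)
  ultimately show ?thesis by (simp cong: measurable_cong)
qed

lemma alive_measurable [measurable (raw)]:
  assumes [measurable]: "t \<in> borel_measurable K" "w \<in> measurable K N"
  shows "Measurable.pred K (\<lambda>k. u \<in> alive \<tau> (t k) (w k))"
  unfolding alive_def mem_Collect_eq by measurable

lemma tree_factor_measurable:
  fixes f :: "'v \<Rightarrow> real"
  assumes [measurable]: "f \<in> borel_measurable borel"
    "t \<in> borel_measurable K" "x \<in> borel_measurable K" "w \<in> measurable K N"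
  shows "(\<lambda>k. if u \<in> alive \<tau> (t k) (w k) then f (x k + position \<tau> W u (t k) (w k)) else 1)
    \<in> borel_measurable K"
proof -
  \<comment> \<open>Clipping changes nothing: an alive label has been born, so its age is
    nonnegative.\<close>
  have "(\<lambda>k. if u \<in> alive \<tau> (t k) (w k) then
        f (x k + (birth_place \<tau> W u (w k) + W u (max 0 (t k - birth_time \<tau> u (w k))) (w k))) else 1)
      \<in> borel_measurable K" by measurable
  moreover have "(\<lambda>k. if u \<in> alive \<tau> (t k) (w k) then
        f (x k + (birth_place \<tau> W u (w k) + W u (max 0 (t k - birth_time \<tau> u (w k))) (w k))) else 1)
     = (\<lambda>k. if u \<in> alive \<tau> (t k) (w k) then f (x k + position \<tau> W u (t k) (w k)) else 1)"
    by (auto simp: alive_def position_def max_def)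
  ultimately show ?thesis by simp
qed

lemma tree_product_measurable [measurable (raw)]:
  fixes f :: "'v \<Rightarrow> real"
  assumes [measurable]: "f \<in> borel_measurable borel"
    "t \<in> borel_measurable K" "x \<in> borel_measurable K" "w \<in> measurable K N"
  shows "(\<lambda>k. tree_product \<tau> W f n (t k) (x k) (w k)) \<in> borel_measurable K"
  unfolding tree_product_def by (intro borel_measurable_prod tree_factor_measurable assms)

end

text \<open>Labels are peeled from the front: the subtree of the child \<open>b\<close> consists of
  all \<open>b # u\<close>, and it carries the original process with \<tau> and \<open>W\<close>
  precomposed with \<open>Cons b\<close>.\<close>

lemma birth_time_Cons:
  "birth_time \<tau> (b # u) \<omega> = \<tau> [] \<omega> + birth_time (\<lambda>u. \<tau> (b # u)) u \<omega>"
  by (simp add: birth_time_def sum.lessThan_Suc_shift del: sum.lessThan_Suc)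

lemma birth_place_Cons:
  "birth_place \<tau> W (b # u) \<omega> = W [] (\<tau> [] \<omega>) \<omega> + birth_place (\<lambda>u. \<tau> (b # u)) (\<lambda>u. W (b # u)) u \<omega>"
  by (simp add: birth_place_def sum.lessThan_Suc_shift del: sum.lessThan_Suc)

lemma alive_Cons:
  "b # u \<in> alive \<tau> t \<omega> \<longleftrightarrow> u \<in> alive (\<lambda>u. \<tau> (b # u)) (t - \<tau> [] \<omega>) \<omega>"
  by (auto simp: alive_def birth_time_Cons)

lemma position_Cons:
  "position \<tau> W (b # u) t \<omega> =
    W [] (\<tau> [] \<omega>) \<omega> + position (\<lambda>u. \<tau> (b # u)) (\<lambda>u. W (b # u)) u (t - \<tau> [] \<omega>) \<omega>"
  by (simp add: position_def birth_time_Cons birth_place_Cons algebra_simps)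

text \<open>Nobody is alive at a negative time. In \<open>tree_product_Suc\<close> this makes both
  subtree factors 1 as long as the root lives.\<close>

lemma tree_product_before_birth:
  assumes "\<And>u. 0 < \<tau> u \<omega>" "t < 0"
  shows "tree_product \<tau> W f n t x \<omega> = 1"
proof -
  have "u \<notin> alive \<tau> t \<omega>" for u
    using assms sum_nonneg[of "{..<length u}" "\<lambda>k. \<tau> (take k u) \<omega>"]
    by (auto simp: alive_def birth_time_def less_imp_le not_le intro: less_le_trans)
  then show ?thesis by (simp add: tree_product_def)
qed

lemma tree_product_Suc:
  assumes pos: "\<And>u. 0 < \<tau> u \<omega>" and t: "0 \<le> t"
  shows "tree_product \<tau> W f (Suc n) t x \<omega> =
    (if t < \<tau> [] \<omega> then f (x + W [] t \<omega>)
     else tree_product (\<lambda>u. \<tau> (False # u)) (\<lambda>u. W (False # u)) f n (t - \<tau> [] \<omega>) (x + W [] (\<tau> [] \<omega>) \<omega>) \<omega>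
        * tree_product (\<lambda>u. \<tau> (True # u)) (\<lambda>u. W (True # u)) f n (t - \<tau> [] \<omega>) (x + W [] (\<tau> [] \<omega>) \<omega>) \<omega>)"
proof -
  define g where "g u = (if u \<in> alive \<tau> t \<omega> then f (x + position \<tau> W u t \<omega>) else 1)" for u
  let ?L = "{u::bool list. length u < n}"
  have "{u::bool list. length u < Suc n} = insert [] (Cons False ` ?L \<union> Cons True ` ?L)"
  proof (intro set_eqI)
    fix u :: "bool list"
    show "u \<in> {u. length u < Suc n} \<longleftrightarrow> u \<in> insert [] (Cons False ` ?L \<union> Cons True ` ?L)"
      by (cases u) auto
  qed
  then have "tree_product \<tau> W f (Suc n) t x \<omega> = prod g (insert [] (Cons False ` ?L \<union> Cons True ` ?L))"
    unfolding tree_product_def g_def by (simp only:)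
  also have "\<dots> = g [] * prod g (Cons False ` ?L \<union> Cons True ` ?L)" by (intro prod.insert) auto
  also have "prod g (Cons False ` ?L \<union> Cons True ` ?L) = prod g (Cons False ` ?L) * prod g (Cons True ` ?L)"
    by (intro prod.union_disjoint) auto
  finally have "tree_product \<tau> W f (Suc n) t x \<omega> = g [] * (prod g (Cons False ` ?L) * prod g (Cons True ` ?L))" .
  moreover have "prod g (Cons b ` ?L) =
      tree_product (\<lambda>u. \<tau> (b # u)) (\<lambda>u. W (b # u)) f n (t - \<tau> [] \<omega>) (x + W [] (\<tau> [] \<omega>) \<omega>) \<omega>" for b
    unfolding tree_product_def
    by (subst prod.reindex) (simp_all add: g_def alive_Cons position_Cons o_def add.assoc cong: if_cong)
  moreover have "[] \<in> alive \<tau> t \<omega> \<longleftrightarrow> t < \<tau> [] \<omega>" using t by (simp add: alive_def birth_time_def)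
  moreover have "position \<tau> W [] t \<omega> = W [] t \<omega>"
    by (simp add: position_def birth_time_def birth_place_def)
  ultimately show ?thesis using pos by (auto simp: g_def tree_product_before_birth)
qed

section \<open>Independence and freezing of one component\<close>

lemma (in prob_space) indep_set_mono:
  assumes "indep_set A B" "A' \<subseteq> A" "B' \<subseteq> B"
  shows "indep_set A' B'" using assms unfolding indep_sets2_eq by blast

lemma (in prob_space) indep_sets_reindex:
  assumes F: "indep_sets F UNIV" and h: "inj h"
  shows "indep_sets (\<lambda>i. F (h i)) UNIV"
proof (rule indep_setsI)
  show "F (h i) \<subseteq> events" for i using F by (auto simp: indep_sets_def)
next
  fix A and J :: "'c set"
  assume J: "J \<noteq> {}" "J \<subseteq> UNIV" "finite J" and A: "\<forall>j\<in>J. A j \<in> F (h j)"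
  have "prob (\<Inter>k\<in>h ` J. A (inv h k)) = (\<Prod>k\<in>h ` J. prob (A (inv h k)))"
    using J A h by (intro indep_setsD[OF F]) auto
  then show "prob (\<Inter>j\<in>J. A j) = (\<Prod>j\<in>J. prob (A j))"
    using h by (simp add: prod.reindex[OF inj_on_subset[OF h]])
qed

lemma (in prob_space) indep_var_of_indep_set:
  assumes indep: "indep_set (sets G) (sets F)"
    and sp: "space G = space M" "space F = space M"
    and X: "X \<in> measurable G S" and Y: "Y \<in> measurable F T"
  shows "indep_var S X T Y"
proof -
  have id: "(\<lambda>\<omega>. \<omega>) \<in> measurable M G" "(\<lambda>\<omega>. \<omega>) \<in> measurable M F"
    using indep_setD_ev1[OF indep] indep_setD_ev2[OF indep] sp by (auto intro!: measurableI)
  have "{X -` A \<inter> space M |A. A \<in> sets S} \<subseteq> sets G" "{Y -` A \<inter> space M |A. A \<in> sets T} \<subseteq> sets F"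
    using measurable_sets[OF X] measurable_sets[OF Y] sp by auto
  from this[THEN sets.sigma_sets_subset] have
    "indep_set (sigma_sets (space M) {X -` A \<inter> space M |A. A \<in> sets S})
      (sigma_sets (space M) {Y -` A \<inter> space M |A. A \<in> sets T})"
    unfolding sp by (rule indep_set_mono[OF indep])
  then show ?thesis
    using measurable_compose[OF id(1) X] measurable_compose[OF id(2) Y] by (simp add: indep_var_eq)
qed

text \<open>By independence the pair of \<open>S\<close> and the identity into \<open>F\<close> has
  a product law, so Fubini allows \<open>S\<close> to be frozen while the rest is averaged. The
  outcome itself, seen through the sigma-algebra \<open>F\<close>, serves as the second
  component.\<close>

lemma (in prob_space) expectation_freeze:
  fixes Y :: "'b \<Rightarrow> 'a \<Rightarrow> real"
  assumes indep: "indep_set (sets G) (sets F)"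
    and sp: "space G = space M" "space F = space M"
    and S: "S \<in> measurable G N'"
    and Y: "case_prod Y \<in> borel_measurable (N' \<Otimes>\<^sub>M F)"
    and bound: "\<And>s \<omega>. \<omega> \<in> space M \<Longrightarrow> \<bar>Y s \<omega>\<bar> \<le> C"
  shows "(\<integral>\<omega>. Y (S \<omega>) \<omega> \<partial>M) = (\<integral>s. (\<integral>\<omega>'. Y s \<omega>' \<partial>M) \<partial>distr M N' S)"
proof -
  have idG: "(\<lambda>\<omega>. \<omega>) \<in> measurable M G" and idF: "(\<lambda>\<omega>. \<omega>) \<in> measurable M F"
    using indep_setD_ev1[OF indep] indep_setD_ev2[OF indep] sp by (auto intro!: measurableI)
  have SM: "S \<in> measurable M N'" by (rule measurable_compose[OF idG S])
  interpret S: prob_space "distr M N' S" by (rule prob_space_distr[OF SM])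
  interpret F: prob_space "distr M F (\<lambda>\<omega>. \<omega>)" by (rule prob_space_distr[OF idF])
  interpret SF: pair_prob_space "distr M N' S" "distr M F (\<lambda>\<omega>. \<omega>)" ..
  have Y': "case_prod Y \<in> borel_measurable (distr M N' S \<Otimes>\<^sub>M distr M F (\<lambda>\<omega>. \<omega>))"
    using Y by (simp cong: measurable_cong_sets)
  have int: "integrable (distr M N' S \<Otimes>\<^sub>M distr M F (\<lambda>\<omega>. \<omega>)) (case_prod Y)"
    by (rule SF.P.integrable_const_bound[of _ C]) (use Y' bound sp in \<open>auto simp: space_pair_measure\<close>)
  have "(\<integral>\<omega>. Y (S \<omega>) \<omega> \<partial>M) = (\<integral>p. case_prod Y p \<partial>distr M (N' \<Otimes>\<^sub>M F) (\<lambda>\<omega>. (S \<omega>, \<omega>)))"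
    by (subst integral_distr) (use SM idF Y in auto)
  also have "distr M (N' \<Otimes>\<^sub>M F) (\<lambda>\<omega>. (S \<omega>, \<omega>)) = distr M N' S \<Otimes>\<^sub>M distr M F (\<lambda>\<omega>. \<omega>)"
  proof (rule pair_measure_eqI[symmetric])
    fix A B assume A: "A \<in> sets (distr M N' S)" and B: "B \<in> sets (distr M F (\<lambda>\<omega>. \<omega>))"
    have "S -` A \<inter> space M \<in> sets G" "B \<in> sets F" using A B measurable_sets[OF S, of A] sp by auto
    moreover from this have "B \<subseteq> space M" using sets.sets_into_space[of B F] sp by auto
    moreover have "(\<lambda>\<omega>. (S \<omega>, \<omega>)) -` (A \<times> B) \<inter> space M = (S -` A \<inter> space M) \<inter> B"
      using calculation by auto
    moreover have "B \<inter> space M = B" using calculation by auto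
    ultimately show "emeasure (distr M N' S) A * emeasure (distr M F (\<lambda>\<omega>. \<omega>)) B =
        emeasure (distr M (N' \<Otimes>\<^sub>M F) (\<lambda>\<omega>. (S \<omega>, \<omega>))) (A \<times> B)"
      using A B SM idF indep_setD[OF indep, of "S -` A \<inter> space M" B]
      by (simp add: emeasure_distr emeasure_eq_measure ennreal_mult)
  qed (use S.sigma_finite_measure_axioms F.sigma_finite_measure_axioms in auto)
  also have "(\<integral>p. case_prod Y p \<partial>(distr M N' S \<Otimes>\<^sub>M distr M F (\<lambda>\<omega>. \<omega>)))
      = (\<integral>s. (\<integral>\<omega>'. Y s \<omega>' \<partial>distr M F (\<lambda>\<omega>. \<omega>)) \<partial>distr M N' S)" using SF.integral_fst'[OF int] by simp
  also have "\<dots> = (\<integral>s. (\<integral>\<omega>'. Y s \<omega>' \<partial>M) \<partial>distr M N' S)"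
  proof (rule Bochner_Integration.integral_cong[OF refl])
    fix s assume "s \<in> space (distr M N' S)"
    then have "Y s \<in> borel_measurable F" using measurable_Pair2[OF Y, of s] by simp
    then show "(\<integral>\<omega>'. Y s \<omega>' \<partial>distr M F (\<lambda>\<omega>. \<omega>)) = (\<integral>\<omega>'. Y s \<omega>' \<partial>M)"
      using idF by (subst integral_distr) auto
  qed
  finally show ?thesis .
qed

lemma Int_stable_vimage_sets: "Int_stable {X -` A \<inter> \<Omega> |A. A \<in> sets S}"
proof (rule Int_stableI, safe)
  fix A B assume "A \<in> sets S" "B \<in> sets S"
  then show "\<exists>C. X -` A \<inter> \<Omega> \<inter> (X -` B \<inter> \<Omega>) = X -` C \<inter> \<Omega> \<and> C \<in> sets S"
    by (intro exI[of _ "A \<inter> B"]) auto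
qed

lemma tree_product_bounds:
  assumes "\<And>y. 0 \<le> f y" "\<And>y. f y \<le> 1"
  shows "0 \<le> tree_product \<tau> W f n t x \<omega>" "tree_product \<tau> W f n t x \<omega> \<le> 1"
  using assms by (auto simp: tree_product_def intro!: prod_nonneg prod_le_1)

text \<open>Picard iterates of the mild equation, started at 1. They depend on \<beta> and
  \<open>f\<close> only, so they serve as a common value for different processes: a subtree and the
  whole tree have equal expectations of \<open>tree_product\<close> because both equal the same
  iterate.\<close>

primrec kpp_iterate :: "real \<Rightarrow> ('v::euclidean_space \<Rightarrow> real) \<Rightarrow> nat \<Rightarrow> real \<Rightarrow> 'v \<Rightarrow> real" where
  "kpp_iterate \<beta> f 0 = (\<lambda>t x. 1)"
| "kpp_iterate \<beta> f (Suc n) = (\<lambda>t x. exp (- \<beta> * t) * heat t f x +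
     duhamel \<beta> t (\<lambda>s. heat s (\<lambda>y. (kpp_iterate \<beta> f n (t - s) y)\<^sup>2) x))"

section \<open>Sigma-algebras generated by sets of labels, and the recursion at the first
  branching\<close>

context dyadic_branching_brownian_motion
begin

definition label_events :: "bool list + bool list \<Rightarrow> 'w set set" where
  "label_events i = (case i of
      Inl u \<Rightarrow> {\<tau> u -` A \<inter> space M | A. A \<in> sets borel}
    | Inr u \<Rightarrow> {(\<lambda>\<omega>. \<lambda>t\<in>{0..}. W u t \<omega>) -` A \<inter> space M | A. A \<in> sets (Pi\<^sub>M {0..} (\<lambda>_. borel))})"

definition label_algebra :: "(bool list + bool list) set \<Rightarrow> 'w measure" where
  "label_algebra L = sigma (space M) (\<Union>i\<in>L. label_events i)"

lemma label_events_Pow: "(\<Union>i\<in>L. label_events i) \<subseteq> Pow (space M)"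
  by (auto simp: label_events_def split: sum.splits)

lemma space_label_algebra [simp]: "space (label_algebra L) = space M"
  unfolding label_algebra_def by (rule space_measure_of[OF label_events_Pow])

lemma sets_label_algebra: "sets (label_algebra L) = sigma_sets (space M) (\<Union>i\<in>L. label_events i)"
  unfolding label_algebra_def by (rule sets_measure_of[OF label_events_Pow])

lemma Int_stable_label_events: "Int_stable (label_events i)"
  by (cases i) (simp_all add: label_events_def Int_stable_vimage_sets)

text \<open>The events of a single label form a generator stable under intersections, so
  independence of labels passes to the sigma-algebras of disjoint groups.\<close>

lemma indep_label_algebra:
  assumes "A \<inter> B = {}"
  shows "indep_set (sets (label_algebra A)) (sets (label_algebra B))"
proof -
  have "indep_sets label_events UNIV"
    using independence unfolding label_events_def[abs_def] .
  then have "indep_sets label_events (\<Union>j. case_bool A B j)"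
    by (rule indep_sets_mono_index[rotated]) auto
  then have "indep_sets (\<lambda>j. sigma_sets (space M) (\<Union>i\<in>case_bool A B j. label_events i)) UNIV"
    using assms by (intro indep_sets_collect_sigma)
      (auto simp: disjoint_family_on_def Int_stable_label_events split: bool.splits)
  moreover have "(\<lambda>j. sigma_sets (space M) (\<Union>i\<in>case_bool A B j. label_events i))
     = case_bool (sets (label_algebra A)) (sets (label_algebra B))"
    by (auto simp: fun_eq_iff sets_label_algebra split: bool.splits)
  ultimately show ?thesis by (simp add: indep_set_def)
qed

lemma lifetime_label_measurable:
  assumes "Inl u \<in> L"
  shows "\<tau> u \<in> borel_measurable (label_algebra L)"
proof (intro measurableI)
  fix A :: "real set" assume "A \<in> sets borel"
  then have "\<tau> u -` A \<inter> space M \<in> label_events (Inl u)" unfolding label_events_def sum.case by blast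
  then show "\<tau> u -` A \<inter> space (label_algebra L) \<in> sets (label_algebra L)"
    using assms by (auto simp: sets_label_algebra intro!: sigma_sets.Basic)
qed simp

lemma motion_label_measurable:
  assumes "Inr u \<in> L" "0 \<le> t"
  shows "W u t \<in> borel_measurable (label_algebra L)"
proof (intro measurableI)
  fix A :: "'v set" assume A: "A \<in> sets borel"
  let ?P = "Pi\<^sub>M {0..} (\<lambda>_. borel) :: (real \<Rightarrow> 'v) measure"
  have "(\<lambda>p. p t) -` A \<inter> space ?P \<in> sets ?P"
    using assms A by (intro measurable_sets[OF measurable_component_singleton]) auto
  moreover have "W u t -` A \<inter> space M
      = (\<lambda>\<omega>. \<lambda>t\<in>{0..}. W u t \<omega>) -` ((\<lambda>p. p t) -` A \<inter> space ?P) \<inter> space M"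
    using assms by (auto simp: space_PiM)
  ultimately have "W u t -` A \<inter> space M \<in> label_events (Inr u)"
    unfolding label_events_def sum.case by blast
  then show "W u t -` A \<inter> space (label_algebra L) \<in> sets (label_algebra L)"
    using assms by (auto simp: sets_label_algebra intro!: sigma_sets.Basic)
qed simp

lemma motion_continuous_on: "\<omega> \<in> space M \<Longrightarrow> continuous_on {0..} (\<lambda>t. W u t \<omega>)"
  using motion[of u] by (simp add: standard_brownian_motion_def standard_brownian_motion_axioms_def)

lemma motion_random_variable: "0 \<le> t \<Longrightarrow> random_variable borel (W u t)"
  using motion[of u] by (simp add: standard_brownian_motion_def standard_brownian_motion_axioms_def)

lemma branching_paths: "branching_paths M \<tau> W"
  using distributed_measurable[OF lifetime]
  by unfold_locales (auto simp: lifetime_pos motion_random_variable motion_continuous_on)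

lemma subtree: "dyadic_branching_brownian_motion M \<beta> (\<lambda>u. \<tau> (b # u)) (\<lambda>u. W (b # u))"
proof (intro dyadic_branching_brownian_motion.intro dyadic_branching_brownian_motion_axioms.intro)
  have "inj (map_sum (Cons b) (Cons b))" by (intro sum.inj_map) auto
  from indep_sets_reindex[OF independence this]
  show "indep_sets
      (\<lambda>i. case i of
          Inl u \<Rightarrow> {\<tau> (b # u) -` A \<inter> space M | A. A \<in> sets borel}
        | Inr u \<Rightarrow> {(\<lambda>\<omega>. \<lambda>t\<in>{0..}. W (b # u) t \<omega>) -` A \<inter> space M | A.
                     A \<in> sets (Pi\<^sub>M {0..} (\<lambda>_. borel))})
      (UNIV :: (bool list + bool list) set)"
    by (rule arg_cong[where f="\<lambda>F. indep_sets F UNIV", THEN iffD1, rotated])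
      (auto simp: fun_eq_iff split: sum.splits)
qed (use rate_pos lifetime_pos lifetime motion prob_space_axioms in auto)

definition subtree_labels :: "bool \<Rightarrow> (bool list + bool list) set" where
  "subtree_labels b = range (\<lambda>u. Inl (b # u)) \<union> range (\<lambda>u. Inr (b # u))"

lemma branching_paths_subtree:
  assumes "subtree_labels b \<subseteq> L"
  shows "branching_paths (label_algebra L) (\<lambda>u. \<tau> (b # u)) (\<lambda>u. W (b # u))"
  using assms by unfold_locales
    (auto simp: lifetime_pos motion_continuous_on subtree_labels_def
      intro!: lifetime_label_measurable motion_label_measurable)

text \<open>Two freezings: first the lifetime and motion of the root together, against both
  subtrees, whose independence of each other produces the square; then the lifetime of the root
  against its motion. The common expectation \<open>h\<close> of the subtrees stays abstract
  here.\<close>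

lemma expectation_first_branching:
  fixes f :: "'v \<Rightarrow> real"
  assumes [measurable]: "f \<in> borel_measurable borel" and f: "\<And>y. 0 \<le> f y" "\<And>y. f y \<le> 1"
    and h [measurable]: "case_prod h \<in> borel_measurable (borel \<Otimes>\<^sub>M borel)"
    and h01: "\<And>s y. 0 \<le> h s y" "\<And>s y. h s y \<le> 1"
    and h_eq: "\<And>b s y. 0 \<le> s \<Longrightarrow>
       (\<integral>\<omega>. tree_product (\<lambda>u. \<tau> (b # u)) (\<lambda>u. W (b # u)) f n s y \<omega> \<partial>M) = h s y"
    and t: "0 \<le> t"
  shows "(\<integral>\<omega>. tree_product \<tau> W f (Suc n) t x \<omega> \<partial>M) =
    exp (- \<beta> * t) * heat t f x + duhamel \<beta> t (\<lambda>s. heat s (\<lambda>y. (h (t - s) y)\<^sup>2) x)"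
proof -
  let ?T = "\<lambda>b. tree_product (\<lambda>u. \<tau> (b # u)) (\<lambda>u. W (b # u)) f n"
  let ?R = "{Inl [], Inr []} :: (bool list + bool list) set"
  let ?L = "subtree_labels False \<union> subtree_labels True"
  have disj: "?R \<inter> ?L = {}" "subtree_labels False \<inter> subtree_labels True = {}"
    "{Inl []} \<inter> {Inr []} = ({} :: (bool list + bool list) set)" by (auto simp: subtree_labels_def)
  interpret L: branching_paths "label_algebra ?L" "\<lambda>u. \<tau> (b # u)" "\<lambda>u. W (b # u)" for b
    by (rule branching_paths_subtree) (cases b; auto)
  interpret P: branching_paths M \<tau> W by (rule branching_paths)
  have W_R: "(\<lambda>p. W [] (max 0 (fst p)) (snd p)) \<in> borel_measurable (borel \<Otimes>\<^sub>M label_algebra K)"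
    if "Inr [] \<in> K" for K using that by (intro continuous_path_evaluation_measurable)
      (auto intro!: motion_label_measurable motion_continuous_on)
  have [measurable]: "\<tau> [] \<in> borel_measurable (label_algebra ?R)"
    "W [] t \<in> borel_measurable (label_algebra ?R)"
    using t by (auto intro!: lifetime_label_measurable motion_label_measurable)
  have [measurable]: "(\<lambda>\<omega>. W [] (max 0 (\<tau> [] \<omega>)) \<omega>) \<in> borel_measurable (label_algebra ?R)"
    using measurable_compose[OF _ W_R[of ?R], of "\<lambda>\<omega>. (\<tau> [] \<omega>, \<omega>)" "label_algebra ?R"] by simp
  \<comment> \<open>The position at \<open>t\<close> is used if the root outlives \<open>t\<close>,
    the position at its death otherwise; recording both makes \<open>S\<close> a single variable
    measurable with respect to the root.\<close>
  define S where "S \<omega> = (\<tau> [] \<omega>, W [] t \<omega>, W [] (max 0 (\<tau> [] \<omega>)) \<omega>)" for \<omega>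
  have S [measurable]: "S \<in> measurable (label_algebra ?R) (borel \<Otimes>\<^sub>M borel \<Otimes>\<^sub>M borel)"
    unfolding S_def by measurable
  define Y where "Y p \<omega> = (case p of (s, y, y') \<Rightarrow> if t < s then f (x + y)
      else ?T False (t - s) (x + y') \<omega> * ?T True (t - s) (x + y') \<omega>)" for p \<omega>
  have Y [measurable]: "case_prod Y \<in> borel_measurable ((borel \<Otimes>\<^sub>M borel \<Otimes>\<^sub>M borel) \<Otimes>\<^sub>M label_algebra ?L)"
    unfolding Y_def by measurable
  define H where "H p = (case p of (s, y, y') \<Rightarrow> if t < s then f (x + y) else (h (t - s) (x + y'))\<^sup>2)" for p
  have [measurable]: "H \<in> borel_measurable (borel \<Otimes>\<^sub>M borel \<Otimes>\<^sub>M borel)"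
    unfolding H_def by measurable
  have T01: "0 \<le> ?T b s y \<omega>" "?T b s y \<omega> \<le> 1" for b s y \<omega> by (rule tree_product_bounds; rule f)+
  have YH: "(\<integral>\<omega>. Y p \<omega> \<partial>M) = H p" for p
  proof -
    obtain s y y' where p: "p = (s, y, y')" by (cases p) auto
    have "(\<integral>\<omega>. ?T False (t - s) (x + y') \<omega> * ?T True (t - s) (x + y') \<omega> \<partial>M) = (h (t - s) (x + y'))\<^sup>2"
      if "s \<le> t"
    proof -
      interpret sub: branching_paths "label_algebra (subtree_labels b)" "\<lambda>u. \<tau> (b # u)" "\<lambda>u. W (b # u)" for b
        by (rule branching_paths_subtree) simp
      have m: "?T b (t - s) (x + y') \<in> borel_measurable (label_algebra (subtree_labels b))" for b
        by measurable
      have ind: "indep_var borel (?T False (t - s) (x + y')) borel (?T True (t - s) (x + y'))"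
        by (rule indep_var_of_indep_set[OF indep_label_algebra[OF disj(2)] _ _ m m]) auto
      have int: "integrable M (?T b (t - s) (x + y'))" for b
        using T01 indep_var_rv1[OF ind] indep_var_rv2[OF ind]
        by (cases b) (auto intro!: integrable_const_bound[of _ 1])
      show ?thesis
        using that by (subst indep_var_lebesgue_integral[OF ind int int]) (simp add: h_eq power2_eq_square)
    qed
    then show ?thesis by (auto simp: p Y_def H_def prob_space)
  qed
  have "(\<integral>\<omega>. tree_product \<tau> W f (Suc n) t x \<omega> \<partial>M) = (\<integral>\<omega>. Y (S \<omega>) \<omega> \<partial>M)"
    using t lifetime_pos by (intro Bochner_Integration.integral_cong refl)
      (auto simp: tree_product_Suc Y_def S_def max_def less_imp_le)
  also have "\<dots> = (\<integral>p. H p \<partial>distr M (borel \<Otimes>\<^sub>M borel \<Otimes>\<^sub>M borel) S)"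
    by (subst expectation_freeze[OF indep_label_algebra[OF disj(1)] _ _ S Y, of 1])
      (auto simp: YH, auto simp: Y_def f T01 mult_le_one)
  also have "\<dots> = (\<integral>\<omega>. H (S \<omega>) \<partial>M)"
    using P.evaluation_measurable[of "\<tau> []" M "\<lambda>\<omega>. \<omega>" "[]"] motion_random_variable[OF t]
    unfolding S_def by (subst integral_distr) auto
  also have "\<dots> = (\<integral>\<omega>. (\<lambda>s \<omega>. H (s, W [] t \<omega>, W [] (max 0 s) \<omega>)) (\<tau> [] \<omega>) \<omega> \<partial>M)" by (simp add: S_def)
  also have "\<dots> = (\<integral>s. (\<integral>\<omega>. H (s, W [] t \<omega>, W [] (max 0 s) \<omega>) \<partial>M) \<partial>distr M borel (\<tau> []))"
  proof (rule expectation_freeze[OF indep_label_algebra[OF disj(3)], where C=1])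
    show "\<tau> [] \<in> borel_measurable (label_algebra {Inl []})" by (rule lifetime_label_measurable) simp
    have [measurable]: "W [] t \<in> borel_measurable (label_algebra {Inr []})"
      using t by (intro motion_label_measurable) auto
    note [measurable] = W_R[of "{Inr []}"]
    show "(\<lambda>(s, \<omega>). H (s, W [] t \<omega>, W [] (max 0 s) \<omega>)) \<in> borel_measurable (borel \<Otimes>\<^sub>M label_algebra {Inr []})"
      unfolding split_beta' by measurable
  qed (auto simp: H_def f h01 power_le_one)
  also have "\<dots> = (\<integral>s. exponential_density \<beta> s * (\<integral>\<omega>. H (s, W [] t \<omega>, W [] (max 0 s) \<omega>) \<partial>M) \<partial>lborel)"
  proof -
    have [measurable]: "(\<lambda>s. \<integral>\<omega>. H (s, W [] t \<omega>, W [] (max 0 s) \<omega>) \<partial>M) \<in> borel_measurable borel"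
    proof -
      note [measurable] = motion_random_variable[OF t]
      show ?thesis by measurable
    qed
    have "distr M borel (\<tau> []) = density lborel (\<lambda>x. ennreal (exponential_density \<beta> x))"
      using distributed_distr_eq_density[OF lifetime[of "[]"]] by (simp cong: distr_cong)
    then show ?thesis using rate_pos by (simp add: integral_density exponential_density_nonneg)
  qed
  \<comment> \<open>Lifetimes beyond \<open>t\<close> give the survival term, lifetimes up to
    \<open>t\<close> the Duhamel integral; negative values have density 0.\<close>
  also have "\<dots> = (\<integral>s. heat t f x * (indicator {t<..} s * exponential_density \<beta> s) +
      indicator {0..t} s *\<^sub>R (\<beta> * exp (- \<beta> * s) * heat s (\<lambda>y. (h (t - s) y)\<^sup>2) x) \<partial>lborel)"
  proof (intro Bochner_Integration.integral_cong refl)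
    fix s :: real
    interpret B: standard_brownian_motion M "W []" by (rule motion)
    show "exponential_density \<beta> s * (\<integral>\<omega>. H (s, W [] t \<omega>, W [] (max 0 s) \<omega>) \<partial>M) =
      heat t f x * (indicator {t<..} s * exponential_density \<beta> s) +
      indicator {0..t} s *\<^sub>R (\<beta> * exp (- \<beta> * s) * heat s (\<lambda>y. (h (t - s) y)\<^sup>2) x)"
    proof (cases "s < 0")
      case True
      then show ?thesis using t by (simp add: exponential_density_def)
    next
      case False
      have "(\<integral>\<omega>. f (x + W [] t \<omega>) \<partial>M) = heat t f x" by (rule B.expectation_motion) (use t in auto)
      moreover have "(\<integral>\<omega>. (h (t - s) (x + W [] s \<omega>))\<^sup>2 \<partial>M) = heat s (\<lambda>y. (h (t - s) y)\<^sup>2) x"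
        by (rule B.expectation_motion[of "\<lambda>y. (h (t - s) y)\<^sup>2"]) (use False in auto)
      ultimately show ?thesis
        using False by (auto simp: H_def exponential_density_def max_def mult_ac indicator_def)
    qed
  qed
  also have "\<dots> = (\<integral>s. heat t f x * (indicator {t<..} s * exponential_density \<beta> s) \<partial>lborel) +
      (LINT s:{0..t}|lborel. \<beta> * exp (- \<beta> * s) * heat s (\<lambda>y. (h (t - s) y)\<^sup>2) x)"
    unfolding set_lebesgue_integral_def
  proof (rule Bochner_Integration.integral_add)
    have "integrable lborel (exponential_density \<beta>)"
      using rate_pos nn_integral_erlang_ith_moment[of \<beta> 0 0]
      by (intro integrableI_nonneg) (auto simp: exponential_density_nonneg)
    then show "integrable lborel (\<lambda>s. heat t f x * (indicator {t<..} s * exponential_density \<beta> s))"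
      using integrable_mult_indicator[of "{t<..}" lborel "exponential_density \<beta>"] by simp
    show "integrable lborel (\<lambda>s. indicat_real {0..t} s *\<^sub>R (\<beta> * exp (- \<beta> * s) * heat s (\<lambda>y. (h (t - s) y)\<^sup>2) x))"
    proof (rule integrableI_bounded_set_indicator[where B=\<beta>])
      show "(\<lambda>s. \<beta> * exp (- \<beta> * s) * heat s (\<lambda>y. (h (t - s) y)\<^sup>2) x) \<in> borel_measurable lborel"
        by measurable
      have "\<bar>heat s (\<lambda>y. (h (t - s) y)\<^sup>2) x\<bar> \<le> 1" for s
        by (rule heat_abs_le) (auto simp: h01 abs_le_iff power_le_one order_trans[of _ 0])
      then show "AE s in lborel. s \<in> {0..t} \<longrightarrow> norm (\<beta> * exp (- \<beta> * s) * heat s (\<lambda>y. (h (t - s) y)\<^sup>2) x) \<le> \<beta>"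
        using rate_pos by (auto simp: abs_mult mult_le_one)
    qed (auto simp: emeasure_lborel_Icc_eq)
  qed
  also have "(\<integral>s. heat t f x * (indicator {t<..} s * exponential_density \<beta> s) \<partial>lborel) = exp (- \<beta> * t) * heat t f x"
  proof -
    have "(\<integral>s. indicator {t<..} s * exponential_density \<beta> s \<partial>lborel) = (\<integral>s. indicator {t<..} s \<partial>distr M borel (\<tau> []))"
    proof -
      have "distr M borel (\<tau> []) = density lborel (\<lambda>x. ennreal (exponential_density \<beta> x))"
        using distributed_distr_eq_density[OF lifetime[of "[]"]] by (simp cong: distr_cong)
      then show ?thesis
        using rate_pos by (simp only:) (subst integral_density, auto simp: exponential_density_nonneg mult.commute)
    qed
    also have "\<dots> = prob {\<omega>\<in>space M. t < \<tau> [] \<omega>}"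
      by (subst integral_distr) (auto simp: Int_def vimage_def conj_commute indicator_vimage[symmetric] intro!: arg_cong[where f=prob])
    also have "\<dots> = exp (- t * \<beta>)" by (rule exponential_distributedD_gt[OF lifetime t rate_pos])
    finally show ?thesis by (simp add: mult.commute)
  qed
  finally show ?thesis by (simp only: duhamel_def)
qed

lemma tree_product_expectation_measurable:
  fixes f :: "'v \<Rightarrow> real"
  assumes [measurable]: "f \<in> borel_measurable borel"
  shows "(\<lambda>(t, x). \<integral>\<omega>. tree_product \<tau> W f n t x \<omega> \<partial>M) \<in> borel_measurable (borel \<Otimes>\<^sub>M borel)"
proof -
  interpret P: branching_paths M \<tau> W by (rule branching_paths)
  show ?thesis unfolding split_beta' by measurable
qed

lemma expectation_tree_product_bounds:
  fixes f :: "'v \<Rightarrow> real"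
  assumes [measurable]: "f \<in> borel_measurable borel" and f: "\<And>y. 0 \<le> f y" "\<And>y. f y \<le> 1"
  shows "0 \<le> (\<integral>\<omega>. tree_product \<tau> W f n t x \<omega> \<partial>M)" "(\<integral>\<omega>. tree_product \<tau> W f n t x \<omega> \<partial>M) \<le> 1"
proof -
  interpret P: branching_paths M \<tau> W by (rule branching_paths)
  show "0 \<le> (\<integral>\<omega>. tree_product \<tau> W f n t x \<omega> \<partial>M)"
    by (rule Bochner_Integration.integral_nonneg) (rule tree_product_bounds; rule f)
  show "(\<integral>\<omega>. tree_product \<tau> W f n t x \<omega> \<partial>M) \<le> 1"
    using tree_product_bounds[of f \<tau> W n t x, OF f]
    by (intro integral_le_const integrable_const_bound[of _ 1]) (auto intro!: AE_I2)
qed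

end

text \<open>Stated outside the locale because the induction changes the process: the hypothesis is
  applied to the subtrees in place of \<tau> and \<open>W\<close>.\<close>

lemma expectation_tree_product:
  fixes f :: "'v::euclidean_space \<Rightarrow> real"
  assumes "dyadic_branching_brownian_motion M \<beta> \<tau> W"
    and f: "f \<in> borel_measurable borel" "\<And>y. 0 \<le> f y" "\<And>y. f y \<le> 1" and t: "0 \<le> t"
  shows "(\<integral>\<omega>. tree_product \<tau> W f n t x \<omega> \<partial>M) = kpp_iterate \<beta> f n t x"
  using assms(1) t
proof (induction n arbitrary: \<tau> W t x)
  case 0
  then interpret dyadic_branching_brownian_motion M \<beta> \<tau> W by simp
  show ?case by (simp add: tree_product_def prob_space)
next
  case (Suc n)
  interpret dyadic_branching_brownian_motion M \<beta> \<tau> W by fact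
  let ?h = "\<lambda>t x. \<integral>\<omega>. tree_product \<tau> W f n t x \<omega> \<partial>M"
  have h: "?h s y = kpp_iterate \<beta> f n s y" if "0 \<le> s" for s y
    by (rule Suc.IH) (use Suc.prems that in auto)
  have "(\<integral>\<omega>. tree_product \<tau> W f (Suc n) t x \<omega> \<partial>M) =
    exp (- \<beta> * t) * heat t f x + duhamel \<beta> t (\<lambda>s. heat s (\<lambda>y. (?h (t - s) y)\<^sup>2) x)"
    by (rule expectation_first_branching[OF f tree_product_expectation_measurable
          expectation_tree_product_bounds])
      (use Suc.prems f h Suc.IH[OF subtree] in auto)
  also have "\<dots> = kpp_iterate \<beta> f (Suc n) t x" by (auto intro!: duhamel_cong simp: h)
  finally show ?case .
qed

section \<open>Particle counts and Laplace transforms\<close>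

lemma tree_product_Suc_le:
  assumes "\<And>y. 0 \<le> f y" "\<And>y. f y \<le> 1"
  shows "tree_product \<tau> W f (Suc n) t x \<omega> \<le> tree_product \<tau> W f n t x \<omega>"
proof -
  let ?g = "\<lambda>u. if u \<in> alive \<tau> t \<omega> then f (x + position \<tau> W u t \<omega>) else 1"
  let ?A = "{u::bool list. length u < n}" and ?B = "{u::bool list. length u < Suc n}"
  have "prod ?g ?B = prod ?g (?B - ?A) * prod ?g ?A" by (rule prod.subset_diff) auto
  also have "\<dots> \<le> 1 * prod ?g ?A" using assms by (intro mult_right_mono prod_le_1 prod_nonneg) auto
  finally show ?thesis by (simp add: tree_product_def)
qed

context dyadic_branching_brownian_motion
begin

text \<open>For \<open>f\<close> with values in the unit interval the expectations decrease in the
  truncation level, so the limit exists. A direct \<open>prod\<close> over the infinite set of all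
  labels would be 1 by convention.\<close>

definition tree_solution :: "('v \<Rightarrow> real) \<Rightarrow> real \<Rightarrow> 'v \<Rightarrow> real" where
  "tree_solution f t x = lim (\<lambda>n. \<integral>\<omega>. tree_product \<tau> W f n t x \<omega> \<partial>M)"

lemma tree_product_integrable:
  fixes f :: "'v \<Rightarrow> real"
  assumes [measurable]: "f \<in> borel_measurable borel" and f: "\<And>y. 0 \<le> f y" "\<And>y. f y \<le> 1"
  shows "integrable M (tree_product \<tau> W f n t x)"
proof -
  interpret P: branching_paths M \<tau> W by (rule branching_paths)
  show ?thesis
    using tree_product_bounds[of f \<tau> W n t x, OF f]
    by (intro integrable_const_bound[of _ 1]) (auto intro!: AE_I2)
qed

lemma tree_solution_tendsto:
  fixes f :: "'v \<Rightarrow> real"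
  assumes f: "f \<in> borel_measurable borel" "\<And>y. 0 \<le> f y" "\<And>y. f y \<le> 1"
  shows "(\<lambda>n. \<integral>\<omega>. tree_product \<tau> W f n t x \<omega> \<partial>M) \<longlonglongrightarrow> tree_solution f t x"
proof -
  have "decseq (\<lambda>n. \<integral>\<omega>. tree_product \<tau> W f n t x \<omega> \<partial>M)"
    by (intro decseq_SucI integral_mono tree_product_integrable f tree_product_Suc_le)
  then have "convergent (\<lambda>n. \<integral>\<omega>. tree_product \<tau> W f n t x \<omega> \<partial>M)"
    using expectation_tree_product_bounds(1)[OF f] decseq_convergent[of _ 0]
    unfolding convergent_def by metis
  then show ?thesis by (simp add: tree_solution_def convergent_LIMSEQ_iff)
qed

text \<open>Dominated convergence in the recursion of \<open>expectation_first_branching\<close>,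
  once under \<open>heat\<close> and once under \<open>duhamel\<close>.\<close>

lemma kpp_tree_solution:
  fixes f :: "'v \<Rightarrow> real"
  assumes f [measurable]: "f \<in> borel_measurable borel" and f01: "\<And>y. 0 \<le> f y" "\<And>y. f y \<le> 1"
  shows "kpp_solution \<beta> f (tree_solution f)"
proof
  let ?E = "\<lambda>n t x. \<integral>\<omega>. tree_product \<tau> W f n t x \<omega> \<partial>M"
  note E01 = expectation_tree_product_bounds[OF f f01]
  note lim = tree_solution_tendsto[OF f f01]
  have E_meas [measurable]: "case_prod (?E n) \<in> borel_measurable (borel \<Otimes>\<^sub>M borel)" for n
    using tree_product_expectation_measurable[OF f] by simp
  show "0 \<le> tree_solution f t y" for t y by (rule LIMSEQ_le_const[OF lim]) (use E01 in auto)
  show "tree_solution f t y \<le> 1" for t y by (rule LIMSEQ_le_const2[OF lim]) (use E01 in auto)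
  have "(\<lambda>p. lim (\<lambda>n. case_prod (?E n) p)) \<in> borel_measurable (borel \<Otimes>\<^sub>M borel)" by measurable
  moreover have "(\<lambda>p. lim (\<lambda>n. case_prod (?E n) p)) = case_prod (tree_solution f)"
    by (auto simp: tree_solution_def)
  ultimately show sol_meas [measurable]: "case_prod (tree_solution f) \<in> borel_measurable (borel \<Otimes>\<^sub>M borel)"
    by simp
  fix t x assume t: "0 \<le> (t::real)"
  have E2: "0 \<le> (?E n s y)\<^sup>2" "(?E n s y)\<^sup>2 \<le> 1" for n s y using E01 by (auto intro: power_le_one)
  have heat_lim: "(\<lambda>n. heat s (\<lambda>y. (?E n (t - s) y)\<^sup>2) x) \<longlonglongrightarrow> heat s (\<lambda>y. (tree_solution f (t - s) y)\<^sup>2) x" for s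
    unfolding heat_def
  proof (rule integral_dominated_convergence[where w="\<lambda>_. 1"])
    show "AE z in gauss. (\<lambda>n. (?E n (t - s) (x + sqrt s *\<^sub>R z))\<^sup>2) \<longlonglongrightarrow> (tree_solution f (t - s) (x + sqrt s *\<^sub>R z))\<^sup>2"
      by (intro AE_I2 tendsto_power lim)
    show "AE z in gauss. norm ((?E n (t - s) (x + sqrt s *\<^sub>R z))\<^sup>2) \<le> 1" for n
      using E2 by (intro AE_I2) simp
  qed auto
  have "(\<lambda>n. duhamel \<beta> t (\<lambda>s. heat s (\<lambda>y. (?E n (t - s) y)\<^sup>2) x)) \<longlonglongrightarrow>
      duhamel \<beta> t (\<lambda>s. heat s (\<lambda>y. (tree_solution f (t - s) y)\<^sup>2) x)"
    unfolding duhamel_def set_lebesgue_integral_def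
  proof (rule integral_dominated_convergence[where w="\<lambda>s. indicator {0..t} s *\<^sub>R \<beta>"])
    show "integrable lborel (\<lambda>s. indicat_real {0..t} s *\<^sub>R \<beta>)"
      by (intro integrable_scaleR_left integrable_real_indicator) (auto simp: emeasure_lborel_Icc_eq)
    show "AE s in lborel. (\<lambda>n. indicat_real {0..t} s *\<^sub>R (\<beta> * exp (- \<beta> * s) * heat s (\<lambda>y. (?E n (t - s) y)\<^sup>2) x))
      \<longlonglongrightarrow> indicat_real {0..t} s *\<^sub>R (\<beta> * exp (- \<beta> * s) * heat s (\<lambda>y. (tree_solution f (t - s) y)\<^sup>2) x)"
      by (intro AE_I2 tendsto_intros heat_lim)
    show "AE s in lborel. norm (indicat_real {0..t} s *\<^sub>R (\<beta> * exp (- \<beta> * s) * heat s (\<lambda>y. (?E n (t - s) y)\<^sup>2) x))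
      \<le> indicator {0..t} s *\<^sub>R \<beta>" for n
    proof (intro AE_I2)
      fix s
      have "\<bar>heat s (\<lambda>y. (?E n (t - s) y)\<^sup>2) x\<bar> \<le> 1" by (rule heat_abs_le) (use E2 in auto)
      then have "0 \<le> s \<Longrightarrow> exp (- \<beta> * s) * \<bar>heat s (\<lambda>y. (?E n (t - s) y)\<^sup>2) x\<bar> \<le> 1"
        using rate_pos by (intro mult_le_one) auto
      then show "norm (indicat_real {0..t} s *\<^sub>R (\<beta> * exp (- \<beta> * s) * heat s (\<lambda>y. (?E n (t - s) y)\<^sup>2) x))
          \<le> indicator {0..t} s *\<^sub>R \<beta>"
        using rate_pos by (auto simp: indicator_def abs_mult mult.assoc mult_left_le)
    qed
  qed measurable
  then have "(\<lambda>n. exp (- \<beta> * t) * heat t f x + duhamel \<beta> t (\<lambda>s. heat s (\<lambda>y. (?E n (t - s) y)\<^sup>2) x))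
    \<longlonglongrightarrow> exp (- \<beta> * t) * heat t f x + duhamel \<beta> t (\<lambda>s. heat s (\<lambda>y. (tree_solution f (t - s) y)\<^sup>2) x)"
    by (intro tendsto_add tendsto_const)
  \<comment> \<open>Both subtrees have the truncated expectations of the whole tree, because all of
    them equal \<open>kpp_iterate\<close>.\<close>
  moreover have "exp (- \<beta> * t) * heat t f x + duhamel \<beta> t (\<lambda>s. heat s (\<lambda>y. (?E n (t - s) y)\<^sup>2) x) = ?E (Suc n) t x" for n
    by (rule expectation_first_branching[OF f f01 E_meas E01, symmetric])
      (use t f01 in \<open>auto simp: expectation_tree_product[OF subtree f f01]
        expectation_tree_product[OF dyadic_branching_brownian_motion_axioms f f01]\<close>)
  ultimately have "(\<lambda>n. ?E (Suc n) t x) \<longlonglongrightarrow>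
      exp (- \<beta> * t) * heat t f x + duhamel \<beta> t (\<lambda>s. heat s (\<lambda>y. (tree_solution f (t - s) y)\<^sup>2) x)"
    by simp
  moreover have "(\<lambda>n. ?E (Suc n) t x) \<longlonglongrightarrow> tree_solution f t x" by (rule LIMSEQ_Suc[OF lim])
  ultimately show "tree_solution f t x =
      exp (- \<beta> * t) * heat t f x + duhamel \<beta> t (\<lambda>s. heat s (\<lambda>y. (tree_solution f (t - s) y)\<^sup>2) x)"
    using LIMSEQ_unique by blast
qed (use f f01 rate_pos in auto)

section \<open>Truncated particle counts and their measurability\<close>

definition particles_in :: "'v set \<Rightarrow> real \<Rightarrow> 'w \<Rightarrow> bool list set" where
  "particles_in A t \<omega> = {u \<in> alive \<tau> t \<omega>. position \<tau> W u t \<omega> \<in> A}"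

definition early_count :: "'v set \<Rightarrow> real \<Rightarrow> nat \<Rightarrow> 'w \<Rightarrow> nat" where
  "early_count A t n \<omega> = card {u \<in> particles_in A t \<omega>. length u < n}"

lemma early_count_measurable [measurable]:
  assumes [measurable]: "A \<in> sets borel"
  shows "early_count A t n \<in> measurable M (count_space UNIV)"
proof -
  interpret P: branching_paths M \<tau> W by (rule branching_paths)
  have [measurable]: "Measurable.pred M (\<lambda>\<omega>. u \<in> particles_in A t \<omega>)" for u
  proof -
    have "(\<lambda>\<omega>. if u \<in> alive \<tau> t \<omega> then indicator A (0 + position \<tau> W u t \<omega>) else (1::real)) \<in> borel_measurable M"
      by (rule P.tree_factor_measurable[where f="indicator A" and t="\<lambda>_. t" and x="\<lambda>_. 0" and w="\<lambda>\<omega>. \<omega>"])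
        measurable
    then have "Measurable.pred M (\<lambda>\<omega>. u \<in> alive \<tau> t \<omega> \<and>
        (if u \<in> alive \<tau> t \<omega> then indicator A (0 + position \<tau> W u t \<omega>) else 1) = (1::real))"
      by measurable
    also have "(\<lambda>\<omega>. u \<in> alive \<tau> t \<omega> \<and>
        (if u \<in> alive \<tau> t \<omega> then indicator A (0 + position \<tau> W u t \<omega>) else 1) = (1::real))
        = (\<lambda>\<omega>. u \<in> particles_in A t \<omega>)"
      by (auto simp: particles_in_def indicator_def split: if_splits)
    finally show ?thesis .
  qed
  have "early_count A t n = (\<lambda>\<omega>. \<Sum>u\<in>{u. length u < n}. if u \<in> particles_in A t \<omega> then 1 else 0)"
  proof
    fix \<omega>
    have "{u \<in> particles_in A t \<omega>. length u < n} = {u. length u < n} \<inter> {u. u \<in> particles_in A t \<omega>}" by auto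
    then show "early_count A t n \<omega> = (\<Sum>u\<in>{u. length u < n}. if u \<in> particles_in A t \<omega> then 1 else 0)"
      unfolding early_count_def by (simp add: sum.If_cases)
  qed
  also have "\<dots> \<in> measurable M (count_space UNIV)" by measurable
  finally show ?thesis .
qed

lemma early_count_finite:
  assumes "finite (particles_in A t \<omega>)"
  shows "early_count A t n \<omega> \<le> card (particles_in A t \<omega>)"
    "\<forall>\<^sub>F n in sequentially. early_count A t n \<omega> = card (particles_in A t \<omega>)"
proof -
  show "early_count A t n \<omega> \<le> card (particles_in A t \<omega>)"
    unfolding early_count_def using assms by (intro card_mono) auto
  let ?m = "Max (insert 0 (length ` particles_in A t \<omega>))"
  have "{u \<in> particles_in A t \<omega>. length u < n} = particles_in A t \<omega>" if "Suc ?m \<le> n" for n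
  proof -
    have "length u < n" if "u \<in> particles_in A t \<omega>" for u
    proof -
      have "length u \<le> ?m" using assms that by (intro Max_ge) auto
      then show ?thesis using \<open>Suc ?m \<le> n\<close> by simp
    qed
    then show ?thesis by auto
  qed
  then show "\<forall>\<^sub>F n in sequentially. early_count A t n \<omega> = card (particles_in A t \<omega>)"
    unfolding early_count_def eventually_sequentially by (intro exI[of _ "Suc ?m"]) auto
qed

lemma early_count_infinite:
  assumes "infinite (particles_in A t \<omega>)"
  shows "filterlim (\<lambda>n. early_count A t n \<omega>) at_top sequentially"
  unfolding filterlim_at_top
proof
  fix k :: nat
  obtain F where F: "F \<subseteq> particles_in A t \<omega>" "finite F" "card F = k"
    using infinite_arbitrarily_large[OF assms] by blast
  let ?m = "Max (insert 0 (length ` F))"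
  have "k \<le> early_count A t n \<omega>" if "Suc ?m \<le> n" for n
  proof -
    have "F \<subseteq> {u \<in> particles_in A t \<omega>. length u < n}"
    proof
      fix u assume u: "u \<in> F"
      then have "length u \<le> ?m" using F by (intro Max_ge) auto
      then have "length u < n" using that by linarith
      then show "u \<in> {u \<in> particles_in A t \<omega>. length u < n}" using F u by auto
    qed
    then have "card F \<le> early_count A t n \<omega>"
      unfolding early_count_def
      by (intro card_mono) (auto intro: finite_subset[OF _ finite_labels[of n]])
    then show ?thesis using F by simp
  qed
  then show "\<forall>\<^sub>F n in sequentially. k \<le> early_count A t n \<omega>"
    unfolding eventually_sequentially by (intro exI[of _ "Suc ?m"]) auto
qed

text \<open>Countable quantifiers over measurable counts: this form shows that the event of an
  infinite population is measurable.\<close>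

lemma finite_particles_iff: "finite (particles_in A t \<omega>) \<longleftrightarrow> (\<exists>m. \<forall>n. early_count A t n \<omega> \<le> m)"
proof
  assume "finite (particles_in A t \<omega>)"
  then show "\<exists>m. \<forall>n. early_count A t n \<omega> \<le> m" using early_count_finite(1) by blast
next
  assume "\<exists>m. \<forall>n. early_count A t n \<omega> \<le> m"
  then obtain m where m: "\<And>n. early_count A t n \<omega> \<le> m" by blast
  show "finite (particles_in A t \<omega>)"
  proof (rule ccontr)
    assume "infinite (particles_in A t \<omega>)"
    from early_count_infinite[OF this] have "\<forall>\<^sub>F n in sequentially. Suc m \<le> early_count A t n \<omega>"
      by (simp add: filterlim_at_top)
    then obtain n where "Suc m \<le> early_count A t n \<omega>" unfolding eventually_sequentially by blast
    with m[of n] show False by simp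
  qed
qed

text \<open>
  An infinite population is counted as 0 by \<^const>\<open>card\<close>, whence the first disjunct.
\<close>

lemma particle_count_less_iff:
  assumes "0 < K"
  shows "real (particle_count \<tau> W t A \<omega>) < K \<longleftrightarrow>
    infinite (particles_in A t \<omega>) \<or> (\<forall>n. real (early_count A t n \<omega>) < K)"
proof (cases "finite (particles_in A t \<omega>)")
  case True
  have "(\<forall>n. real (early_count A t n \<omega>) < K) \<longleftrightarrow> real (card (particles_in A t \<omega>)) < K"
  proof
    assume "\<forall>n. real (early_count A t n \<omega>) < K"
    moreover obtain n where "early_count A t n \<omega> = card (particles_in A t \<omega>)"
      using early_count_finite(2)[OF True] unfolding eventually_sequentially by blast
    ultimately show "real (card (particles_in A t \<omega>)) < K" by metis
  next
    assume "real (card (particles_in A t \<omega>)) < K"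
    then show "\<forall>n. real (early_count A t n \<omega>) < K"
      using early_count_finite(1)[OF True] by (meson of_nat_mono order_le_less_trans)
  qed
  then show ?thesis using True by (simp add: particle_count_def particles_in_def)
next
  case False
  then show ?thesis using assms by (simp add: particle_count_def particles_in_def)
qed

lemma infinite_particles_measurable [measurable]:
  assumes [measurable]: "A \<in> sets borel"
  shows "Measurable.pred M (\<lambda>\<omega>. infinite (particles_in A t \<omega>))"
  unfolding finite_particles_iff by measurable

lemma particle_count_less_measurable [measurable]:
  assumes [measurable]: "A \<in> sets borel" and K: "0 < K"
  shows "Measurable.pred M (\<lambda>\<omega>. real (particle_count \<tau> W t A \<omega>) < K)"
  unfolding particle_count_less_iff[OF K] by measurable

text \<open>The value 0 for an infinite population is the limit of the transforms of
  \<open>early_count\<close>; going through \<open>card\<close>, which is 0 there, would give 1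
  instead.\<close>

definition count_transform :: "real \<Rightarrow> 'v set \<Rightarrow> real \<Rightarrow> 'w \<Rightarrow> real" where
  "count_transform \<theta> A t \<omega> =
    (if finite (particles_in A t \<omega>) then exp (- \<theta> * card (particles_in A t \<omega>)) else 0)"

text \<open>For this datum each particle in \<open>A\<close> contributes
  \<open>exp (- \<theta>)\<close> and every other label 1, so \<open>tree_product\<close> is the
  transform of \<open>early_count\<close>, and dominated convergence in \<open>n\<close>
  applies.\<close>

lemma tree_solution_count:
  assumes [measurable]: "A \<in> sets borel" and \<theta>: "0 < \<theta>"
  shows "integrable M (count_transform \<theta> A t)"
    "tree_solution (\<lambda>y. exp (- \<theta> * indicator A y)) t 0 = (\<integral>\<omega>. count_transform \<theta> A t \<omega> \<partial>M)"
proof -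
  interpret P: branching_paths M \<tau> W by (rule branching_paths)
  let ?f = "\<lambda>y. exp (- \<theta> * indicator A y) :: real"
  have f [measurable]: "?f \<in> borel_measurable borel" by measurable
  have f01: "0 \<le> ?f y" "?f y \<le> 1" for y using \<theta> by (auto simp: indicator_def)
  have tp: "tree_product \<tau> W ?f n t 0 \<omega> = exp (- \<theta> * real (early_count A t n \<omega>))" for n \<omega>
  proof -
    have "tree_product \<tau> W ?f n t 0 \<omega> = (\<Prod>u\<in>{u. length u < n}. exp (- \<theta> * (if u \<in> particles_in A t \<omega> then 1 else 0)))"
      unfolding tree_product_def by (intro prod.cong refl) (auto simp: particles_in_def indicator_def)
    also have "\<dots> = exp (\<Sum>u\<in>{u. length u < n}. - \<theta> * (if u \<in> particles_in A t \<omega> then 1 else 0))"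
      by (rule exp_sum[symmetric]) simp
    also have "(\<Sum>u\<in>{u. length u < n}. - \<theta> * (if u \<in> particles_in A t \<omega> then 1 else 0)) = - \<theta> * real (early_count A t n \<omega>)"
    proof -
      have "{u \<in> particles_in A t \<omega>. length u < n} = {u. length u < n} \<inter> {u. u \<in> particles_in A t \<omega>}" by auto
      then show ?thesis
        unfolding early_count_def sum_distrib_left[symmetric] by (simp add: sum.If_cases)
    qed
    finally show ?thesis .
  qed
  have lim: "(\<lambda>n. tree_product \<tau> W ?f n t 0 \<omega>) \<longlonglongrightarrow> count_transform \<theta> A t \<omega>" for \<omega>
  proof (cases "finite (particles_in A t \<omega>)")
    case True
    have "\<forall>\<^sub>F n in sequentially. tree_product \<tau> W ?f n t 0 \<omega> = count_transform \<theta> A t \<omega>"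
      by (rule eventually_mono[OF early_count_finite(2)[OF True]])
        (simp only: tp count_transform_def True if_True)
    then show ?thesis by (rule tendsto_eventually)
  next
    case False
    have "filterlim (\<lambda>n. real (early_count A t n \<omega>)) at_top sequentially"
      by (rule filterlim_compose[OF filterlim_real_sequentially early_count_infinite[OF False]])
    then have "((\<lambda>n. exp (- \<theta> * real (early_count A t n \<omega>))) \<longlongrightarrow> 0) sequentially"
      using \<theta>
      by (intro filterlim_compose[OF exp_at_bot] filterlim_tendsto_neg_mult_at_bot[OF tendsto_const]) auto
    then show ?thesis unfolding tp using False by (simp add: count_transform_def)
  qed
  have meas: "count_transform \<theta> A t \<in> borel_measurable M"
    by (rule borel_measurable_LIMSEQ_real[OF lim]) measurable
  show int: "integrable M (count_transform \<theta> A t)"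
    by (rule integrable_const_bound[of _ 1]) (use meas \<theta> in \<open>auto simp: count_transform_def\<close>)
  have "(\<lambda>n. \<integral>\<omega>. tree_product \<tau> W ?f n t 0 \<omega> \<partial>M) \<longlonglongrightarrow> (\<integral>\<omega>. count_transform \<theta> A t \<omega> \<partial>M)"
  proof (rule integral_dominated_convergence[where w="\<lambda>_. 1"])
    show "AE \<omega> in M. norm (tree_product \<tau> W ?f n t 0 \<omega>) \<le> 1" for n
      unfolding tp using \<theta> by (intro AE_I2) simp
  qed (use meas lim in auto)
  then show "tree_solution ?f t 0 = (\<integral>\<omega>. count_transform \<theta> A t \<omega> \<partial>M)"
    using tree_solution_tendsto[OF f f01] LIMSEQ_unique by blast
qed

text \<open>On this event the transform is 0 for every positive \<theta>, so the probability is at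
  most the deficit of \<open>tree_solution\<close>, which \<open>deficit_upper\<close> bounds by
  \<open>exp (\<beta> * t) * \<theta>\<close>. Letting \<theta> tend to 0 gives the claim.\<close>

lemma prob_infinite_particles:
  assumes [measurable]: "A \<in> sets borel" and t: "0 \<le> t"
  shows "prob {\<omega> \<in> space M. infinite (particles_in A t \<omega>)} = 0"
proof -
  let ?I = "{\<omega> \<in> space M. infinite (particles_in A t \<omega>)}"
  have bound: "prob ?I \<le> exp (\<beta> * t) * \<theta>" if \<theta>: "0 < \<theta>" for \<theta>
  proof -
    let ?f = "\<lambda>y. exp (- \<theta> * indicator A y) :: real"
    have f: "?f \<in> borel_measurable borel" by measurable
    have f01: "0 \<le> ?f y" "?f y \<le> 1" for y using \<theta> by (auto simp: indicator_def)
    interpret kpp_solution \<beta> ?f "tree_solution ?f" by (rule kpp_tree_solution[OF f f01])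
    have "prob ?I = (\<integral>\<omega>. indicator ?I \<omega> \<partial>M)" by simp
    also have "\<dots> \<le> (\<integral>\<omega>. 1 - count_transform \<theta> A t \<omega> \<partial>M)"
    proof (rule integral_mono)
      show "integrable M (indicator ?I :: 'w \<Rightarrow> real)"
        by (intro integrable_real_indicator) (auto simp: emeasure_eq_measure)
      show "integrable M (\<lambda>\<omega>. 1 - count_transform \<theta> A t \<omega>)"
        using tree_solution_count(1)[of A \<theta> t] \<theta> by (intro Bochner_Integration.integrable_diff) auto
      show "indicator ?I \<omega> \<le> 1 - count_transform \<theta> A t \<omega>" for \<omega>
        using \<theta> by (auto simp: count_transform_def indicator_def)
    qed
    also have "\<dots> = 1 - tree_solution ?f t 0"
      using tree_solution_count[of A \<theta> t] \<theta> by (simp add: prob_space)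
    also have "\<dots> \<le> exp (\<beta> * t) * heat t (\<lambda>y. 1 - ?f y) 0" by (rule deficit_upper[OF t])
    also have "\<dots> \<le> exp (\<beta> * t) * \<theta>"
    proof (intro mult_left_mono heat_le[of _ 1])
      show "1 - ?f y \<le> \<theta>" for y using exp_ge_add_one_self[of "- \<theta>"] \<theta> by (simp add: indicator_def)
      show "\<bar>1 - ?f y\<bar> \<le> 1" for y using f01[of y] by simp
    qed auto
    finally show ?thesis .
  qed
  have "prob ?I \<le> 0 + \<epsilon>" if "0 < \<epsilon>" for \<epsilon> using bound[of "\<epsilon> / exp (\<beta> * t)"] that by simp
  then have "prob ?I \<le> 0" by (rule field_le_epsilon)
  then show ?thesis using measure_nonneg[of M ?I] by linarith
qed

text \<open>The first bound is the exponential Markov inequality, after an infinite population, with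
  \<open>particle_count\<close> 0 but transform 0, is discarded as a null event. For the second, the
  transform is at most 1 on the event and at most \<open>exp (- \<theta> * K)\<close> off
  it.\<close>

lemma prob_particle_count_less:
  assumes [measurable]: "A \<in> sets borel" and t: "0 \<le> t" and K: "0 < K" and \<theta>: "0 < \<theta>"
  shows "prob {\<omega> \<in> space M. real (particle_count \<tau> W t A \<omega>) < K}
      \<le> exp (\<theta> * K) * tree_solution (\<lambda>y. exp (- \<theta> * indicator A y)) t 0"
    "tree_solution (\<lambda>y. exp (- \<theta> * indicator A y)) t 0
      \<le> prob {\<omega> \<in> space M. real (particle_count \<tau> W t A \<omega>) < K} + exp (- \<theta> * K)"
proof -
  let ?P = "{\<omega> \<in> space M. real (particle_count \<tau> W t A \<omega>) < K}"
  let ?I = "{\<omega> \<in> space M. infinite (particles_in A t \<omega>)}"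
  note int = tree_solution_count(1)[OF assms(1) \<theta>, of t]
  have [measurable]: "?P \<in> events" "?I \<in> events"
    using particle_count_less_measurable[OF assms(1) K, of t] by measurable
  have "prob ?P = (\<integral>\<omega>. indicator ?P \<omega> \<partial>M)" by simp
  also have "\<dots> \<le> (\<integral>\<omega>. exp (\<theta> * K) * count_transform \<theta> A t \<omega> + indicator ?I \<omega> \<partial>M)"
  proof (intro integral_mono Bochner_Integration.integrable_add)
    fix \<omega> assume \<omega>: "\<omega> \<in> space M"
    show "indicator ?P \<omega> \<le> exp (\<theta> * K) * count_transform \<theta> A t \<omega> + (indicator ?I \<omega> :: real)"
    proof (cases "finite (particles_in A t \<omega>) \<and> \<omega> \<in> ?P")
      case True
      then have "real (card (particles_in A t \<omega>)) \<le> K"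
        by (simp add: particle_count_def particles_in_def)
      then have "\<theta> * real (card (particles_in A t \<omega>)) \<le> \<theta> * K"
        using \<theta> by (intro mult_left_mono) auto
      then have "1 \<le> exp (\<theta> * K) * count_transform \<theta> A t \<omega>"
        using True by (simp add: count_transform_def exp_add[symmetric])
      then show ?thesis using True by (simp add: indicator_def)
    next
      case False
      then show ?thesis using \<omega> by (auto simp: indicator_def count_transform_def)
    qed
  qed (use int in \<open>auto intro!: integrable_real_indicator simp: emeasure_eq_measure\<close>)
  also have "\<dots> = exp (\<theta> * K) * (\<integral>\<omega>. count_transform \<theta> A t \<omega> \<partial>M) + prob ?I"
    using int by (subst Bochner_Integration.integral_add)
      (auto intro!: integrable_real_indicator simp: emeasure_eq_measure)
  finally show "prob ?P \<le> exp (\<theta> * K) * tree_solution (\<lambda>y. exp (- \<theta> * indicator A y)) t 0"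
    using tree_solution_count(2)[OF assms(1) \<theta>, of t] prob_infinite_particles[OF assms(1) t] by simp
  have "(\<integral>\<omega>. count_transform \<theta> A t \<omega> \<partial>M) \<le> (\<integral>\<omega>. indicator ?P \<omega> + exp (- \<theta> * K) \<partial>M)"
  proof (intro integral_mono Bochner_Integration.integrable_add int)
    fix \<omega> assume \<omega>: "\<omega> \<in> space M"
    show "count_transform \<theta> A t \<omega> \<le> indicator ?P \<omega> + exp (- \<theta> * K)"
    proof (cases "\<omega> \<in> ?P")
      case True
      then show ?thesis using \<theta> by (auto simp: count_transform_def indicator_def intro: add_increasing2)
    next
      case False
      then have "K \<le> real (card (particles_in A t \<omega>))"
        using \<omega> by (simp add: particle_count_def particles_in_def)
      then have "\<theta> * K \<le> \<theta> * real (card (particles_in A t \<omega>))"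
        using \<theta> by (intro mult_left_mono) auto
      then show ?thesis using False by (simp add: count_transform_def)
    qed
  qed (auto intro!: integrable_real_indicator simp: emeasure_eq_measure)
  also have "\<dots> = prob ?P + exp (- \<theta> * K)" by (subst Bochner_Integration.integral_add)
      (auto intro!: integrable_real_indicator simp: emeasure_eq_measure prob_space)
  finally show "tree_solution (\<lambda>y. exp (- \<theta> * indicator A y)) t 0 \<le> prob ?P + exp (- \<theta> * K)"
    using tree_solution_count(2)[OF assms(1) \<theta>, of t] by simp
qed

end

section \<open>The exponential decay rate\<close>

text \<open>Source of the 1/2 in the condition on the datum: a transform parameter \<open>x\<close>
  in the unit interval gives a deficit of at least \<open>x / 2\<close> on the ball.\<close>

lemma exp_minus_le:
  fixes x :: real
  assumes "0 \<le> x" "x \<le> 1"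
  shows "exp (- x) \<le> 1 - x / 2"
proof -
  have "x * x \<le> x * 1" using assms by (intro mult_left_mono) auto
  then have "1 \<le> (1 - x / 2) * (1 + x)" by (simp add: algebra_simps)
  also have "\<dots> \<le> (1 - x / 2) * exp x"
    using assms exp_ge_add_one_self[of x] by (intro mult_left_mono) auto
  finally show ?thesis by (simp add: exp_minus divide_simps)
qed

theorem corollary1:
  fixes M :: "'w measure" and \<beta> a r :: real
    and \<tau> :: "bool list \<Rightarrow> 'w \<Rightarrow> real"
    and W :: "bool list \<Rightarrow> real \<Rightarrow> 'w \<Rightarrow> real ^ 'd"
    and c :: "real ^ 'd"
  assumes "\<beta> > 0"
    and "dyadic_branching_brownian_motion M \<beta> \<tau> W"
    and "r > 0"
    and "0 \<le> a" and "a < 1"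
  shows "((\<lambda>t. 1 / t * ln (measure M {\<omega> \<in> space M.
              real (particle_count \<tau> W t (ball c r) \<omega>) < exp (\<beta> * a * t)}))
          \<longlongrightarrow> (if a < 1 / 2 then - \<beta> * (2 * sqrt (2 * (1 - a)) - 2 + a)
               else - \<beta> * (1 - a))) at_top"
proof -
  interpret dyadic_branching_brownian_motion M \<beta> \<tau> W by fact
  let ?B = "ball c r"
  let ?f = "\<lambda>\<theta> y. exp (- \<theta> * indicator ?B y) :: real"
  define p where "p t = prob {\<omega> \<in> space M. real (particle_count \<tau> W t ?B \<omega>) < exp (\<beta> * a * t)}" for t
  have B [measurable]: "?B \<in> sets borel" by simp
  have sol: "kpp_solution \<beta> (?f \<theta>) (tree_solution (?f \<theta>))" if "0 < \<theta>" for \<theta>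
  proof (rule kpp_tree_solution)
    show "?f \<theta> \<in> borel_measurable borel" by measurable
  qed (use that in \<open>auto simp: indicator_def\<close>)
  have bounds: "\<forall>\<^sub>F t in at_top. - (\<beta> * decay_rate a) - e < 1 / t * ln (p t) \<and> 1 / t * ln (p t) < - (\<beta> * decay_rate a) + e"
    if e: "0 < e" for e
  proof -
    \<comment> \<open>Of the allowed error \<open>e\<close>, the asymptotic bounds take
      \<open>e / 4\<close> and constant factors another \<open>e / 4\<close>; the remaining
      \<open>e / 2\<close> makes the inequalities strict.\<close>
    have e2: "0 < e / 2" "0 < e / 4" using e by auto
    have "\<forall>\<^sub>F t in at_top. exp 1 \<le> exp (e / 4 * t)" using e by real_asymp
    \<comment> \<open>The factor \<open>t\<^sup>2\<close> in the transform parameter makes the error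
      superexponentially small, so it uses up at most half of the lower bound.\<close>
    moreover have "\<forall>\<^sub>F t in at_top. exp (- (t\<^sup>2)) \<le> exp (- (\<beta> * decay_rate a + e / 4) * t) / 2"
      using eventually_ge_at_top[of "\<bar>\<beta> * decay_rate a + e / 4\<bar> + 1"]
    proof eventually_elim
      fix t :: real assume t: "\<bar>\<beta> * decay_rate a + e / 4\<bar> + 1 \<le> t"
      have "((\<beta> * decay_rate a + e / 4) + 1) * t \<le> t * t" using t by (intro mult_right_mono) auto
      moreover have "ln 2 \<le> t" using t ln_le_minus_one[of 2] by simp
      ultimately have "- (t\<^sup>2) \<le> - (\<beta> * decay_rate a + e / 4) * t - ln 2"
        by (simp add: power2_eq_square algebra_simps)
      then have "exp (- (t\<^sup>2)) \<le> exp (- (\<beta> * decay_rate a + e / 4) * t - ln 2)" by simp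
      then show "exp (- (t\<^sup>2)) \<le> exp (- (\<beta> * decay_rate a + e / 4) * t) / 2"
        by (simp only: exp_diff) simp
    qed
    moreover have "\<forall>\<^sub>F t in at_top. 2 < exp (e / 4 * t)" using e by real_asymp
    moreover have "\<forall>\<^sub>F t in at_top. 1 \<le> (t :: real)" by (rule eventually_ge_at_top)
    moreover note kpp_upper_asymptotics[OF \<open>0 < \<beta>\<close> \<open>0 < r\<close> \<open>0 \<le> a\<close> \<open>a < 1\<close> e2(2), of c]
      kpp_lower_asymptotics[OF \<open>0 < \<beta>\<close> \<open>0 < r\<close> \<open>0 \<le> a\<close> \<open>a < 1\<close> e2(2), of c]
    ultimately show ?thesis
    proof eventually_elim
      fix t :: real
      assume t1: "exp 1 \<le> exp (e / 4 * t)" "exp (- (t\<^sup>2)) \<le> exp (- (\<beta> * decay_rate a + e / 4) * t) / 2"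
          "2 < exp (e / 4 * t)" "1 \<le> t"
        and up: "\<forall>f \<phi>. kpp_solution \<beta> f \<phi> \<longrightarrow>
          (\<forall>y\<in>ball c r. exp (- \<beta> * a * t) / 2 \<le> 1 - f y) \<longrightarrow> \<phi> t 0 \<le> exp (- (\<beta> * decay_rate a - e / 4) * t)"
        and lo: "\<forall>f \<phi>. kpp_solution \<beta> f \<phi> \<longrightarrow>
          (\<forall>y. 1 - f y \<le> t\<^sup>2 * exp (- \<beta> * a * t) * indicator (ball c r) y) \<longrightarrow>
          exp (- (\<beta> * decay_rate a + e / 4) * t) \<le> \<phi> t 0"
      have t0: "0 \<le> t" "0 < t" using t1 by auto
      have K: "0 < exp (\<beta> * a * t)" by simp
      let ?\<theta> = "exp (- \<beta> * a * t)" and ?\<eta> = "t\<^sup>2 * exp (- \<beta> * a * t)"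
      have \<theta>: "0 < ?\<theta>" "?\<theta> \<le> 1" "?\<theta> * exp (\<beta> * a * t) = 1"
        using \<open>0 < \<beta>\<close> \<open>0 \<le> a\<close> t0 by (auto simp: exp_add[symmetric])
      have \<eta>: "0 < ?\<eta>" "?\<eta> * exp (\<beta> * a * t) = t\<^sup>2" using t0 \<theta>(3) by (simp_all add: mult.assoc)
      have "tree_solution (?f ?\<theta>) t 0 \<le> exp (- (\<beta> * decay_rate a - e / 4) * t)"
      proof (rule up[rule_format, OF sol[OF \<theta>(1)]])
        fix y assume "y \<in> ball c r"
        with exp_minus_le[of ?\<theta>] \<theta> show "exp (- \<beta> * a * t) / 2 \<le> 1 - ?f ?\<theta> y" by simp
      qed
      moreover have "p t \<le> exp (?\<theta> * exp (\<beta> * a * t)) * tree_solution (?f ?\<theta>) t 0"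
        unfolding p_def by (rule prob_particle_count_less(1)[OF B t0(1) K \<theta>(1)])
      ultimately have "p t \<le> exp (e / 4 * t) * exp (- (\<beta> * decay_rate a - e / 4) * t)"
        unfolding \<theta>(3) using t1(1) by (meson exp_ge_zero mult_mono order_trans mult_left_mono mult_right_mono)
      also have "\<dots> = exp ((- (\<beta> * decay_rate a) + e / 2) * t)"
        by (subst exp_add[symmetric]) (simp add: algebra_simps)
      finally have upper: "p t \<le> exp ((- (\<beta> * decay_rate a) + e / 2) * t)" .
      have "exp (- (\<beta> * decay_rate a + e / 4) * t) \<le> tree_solution (?f ?\<eta>) t 0"
      proof (rule lo[rule_format, OF sol[OF \<eta>(1)]])
        fix y
        \<comment> \<open>On the ball this is \<open>1 - exp (- x) \<le> x\<close>; off it both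
          sides are 0.\<close>
        show "1 - ?f ?\<eta> y \<le> t\<^sup>2 * exp (- \<beta> * a * t) * indicator (ball c r) y"
          using exp_ge_add_one_self[of "- (?\<eta> * indicator (ball c r) y)"] by simp
      qed
      moreover have e\<eta>: "- ?\<eta> * exp (\<beta> * a * t) = - (t\<^sup>2)" using \<eta>(2) by simp
      have "tree_solution (?f ?\<eta>) t 0 \<le> p t + exp (- (t\<^sup>2))"
        using prob_particle_count_less(2)[OF B t0(1) K \<eta>(1)]
        unfolding p_def e\<eta> .
      ultimately have "exp (- (\<beta> * decay_rate a + e / 4) * t) / 2 \<le> p t" using t1(2) by linarith
      moreover have "exp ((- (\<beta> * decay_rate a) - e / 2) * t) < exp (- (\<beta> * decay_rate a + e / 4) * t) / 2"
      proof -
        have "exp ((- (\<beta> * decay_rate a) - e / 2) * t) * 2 < exp ((- (\<beta> * decay_rate a) - e / 2) * t) * exp (e / 4 * t)"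
          using t1(3) by (intro mult_strict_left_mono) auto
        also have "\<dots> = exp (- (\<beta> * decay_rate a + e / 4) * t)"
          by (subst exp_add[symmetric]) (simp add: algebra_simps)
        finally show ?thesis by simp
      qed
      ultimately have lower: "exp ((- (\<beta> * decay_rate a) - e / 2) * t) < p t" by linarith
      \<comment> \<open>The logarithm carries information only for a positive probability, since
        \<open>ln 0 = 0\<close> by convention; positivity comes from the lower bound.\<close>
      have p0: "0 < p t" using lower by (rule less_trans[OF exp_gt_zero])
      have "ln (exp ((- (\<beta> * decay_rate a) - e / 2) * t)) < ln (p t)"
        using lower p0 by (subst ln_less_cancel_iff) auto
      then have "(- (\<beta> * decay_rate a) - e / 2) * t < ln (p t)" by simp
      moreover have "ln (p t) \<le> ln (exp ((- (\<beta> * decay_rate a) + e / 2) * t))"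
        using upper p0 by (subst ln_le_cancel_iff) auto
      then have "ln (p t) \<le> (- (\<beta> * decay_rate a) + e / 2) * t" by simp
      ultimately have "- (\<beta> * decay_rate a) - e / 2 < ln (p t) / t" "ln (p t) / t \<le> - (\<beta> * decay_rate a) + e / 2"
        using t0 by (simp_all only: pos_less_divide_eq pos_divide_le_eq)
      then show "- (\<beta> * decay_rate a) - e < 1 / t * ln (p t) \<and> 1 / t * ln (p t) < - (\<beta> * decay_rate a) + e"
        using e by simp
    qed
  qed
  have "((\<lambda>t. 1 / t * ln (p t)) \<longlongrightarrow> - (\<beta> * decay_rate a)) at_top"
    unfolding tendsto_iff
  proof safe
    fix e :: real assume "0 < e"
    from bounds[OF this] show "\<forall>\<^sub>F t in at_top. dist (1 / t * ln (p t)) (- (\<beta> * decay_rate a)) < e"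
      by eventually_elim (auto simp: dist_real_def)
  qed
  moreover have "- (\<beta> * decay_rate a) = (if a < 1 / 2 then - \<beta> * (2 * sqrt (2 * (1 - a)) - 2 + a) else - \<beta> * (1 - a))"
    by (simp add: decay_rate_def)
  ultimately show ?thesis unfolding p_def by simp
qed

end
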